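(* Let $f\colon \mathbb{C}\to\mathbb{C}$ be a nonzero polynomial. All the weak solutions $\psi\in L^1_{\mathrm{loc}}(\mathbb{R}^2;\mathbb{R})$ of the equation $$-\Delta\psi = |f|^2 e^{\psi}\quad\text{in }\mathbb{R}^2$$ such that $\int_{\mathbb{R}^2}|f|^2e^{\psi}<\infty$ are of the form $$\psi=\psi_{P,Q}:=\log(8)-2\log(|P|^2+|Q|^2),$$ where $P,Q$ are two coprime complex polynomials which satisfy $f=P'Q-PQ'$. Moreover, $$\max(\deg(P),\deg(Q))=\frac{1}{8\pi}\int_{\mathbb{R}^2}|f|^2e^{\psi},$$ and if $(P,Q)$ and $(\tilde P,\tilde Q)$ are pairs of complex polynomials (not necessarily coprime), then $\psi_{P,Q}=\psi_{\tilde P,\tilde Q}$ if and only if $(\tilde P,\tilde Q)=\Lambda(P,Q)$ for some constant matrix $\Lambda\in \mathrm{U}(2)$.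
   Context: $\mathbb{R}^2$ is identified with $\mathbb{C}$ via $z=x+\mathrm{i}y$. Functions and polynomials on $\mathbb{C}$ are viewed as functions on $\mathbb{R}^2$, and integrals are with respect to Lebesgue measure. A weak solution is a solution in the sense of distributions (with $|f|^2e^\psi\in L^1$). $\mathrm{U}(2)$ is the group of $2\times2$ complex unitary matrices, acting on pairs of polynomials by $(\Lambda(P,Q))(z)=\Lambda(P(z),Q(z))^{T}$ (pair regarded as a column vector). *)

theory Defs
  imports "HOL-Analysis.Analysis" "HOL-Computational_Algebra.Polynomial"
begin

definition partial_deriv :: "'a::euclidean_space \<Rightarrow> ('a \<Rightarrow> real) \<Rightarrow> 'a \<Rightarrow> real" where
  "partial_deriv b u = (\<lambda>x. frechet_derivative u (at x) b)"

primrec Ck :: "nat \<Rightarrow> ('a::euclidean_space \<Rightarrow> real) \<Rightarrow> bool" where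
  "Ck 0 u \<longleftrightarrow> continuous_on UNIV u"
| "Ck (Suc k) u \<longleftrightarrow> u differentiable_on UNIV \<and> (\<forall>b\<in>Basis. Ck k (partial_deriv b u))"

definition test_function :: "('a::euclidean_space \<Rightarrow> real) \<Rightarrow> bool" where
  "test_function \<phi> \<longleftrightarrow> (\<forall>k. Ck k \<phi>) \<and> compact (closure {x. \<phi> x \<noteq> 0})"

text \<open>On \<^typ>\<open>complex\<close> the canonical basis consists of \<^term>\<open>1\<close> and \<^term>\<open>\<i>\<close>, so there this is
  the Laplacian of the real plane.\<close>

definition laplacian :: "('a::euclidean_space \<Rightarrow> real) \<Rightarrow> 'a \<Rightarrow> real" where
  "laplacian u = (\<lambda>x. \<Sum>b\<in>Basis. partial_deriv b (partial_deriv b u) x)"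

definition locally_integrable :: "('a::euclidean_space \<Rightarrow> real) \<Rightarrow> bool" where
  "locally_integrable u \<longleftrightarrow> (\<forall>K. compact K \<longrightarrow> set_integrable lebesgue K u)"

text \<open>The equation \<open>-\<Delta>u = g\<close> in the sense of distributions; it is meaningful when \<open>u\<close> and \<open>g\<close> are
  locally integrable.\<close>

definition distributional_poisson :: "('a::euclidean_space \<Rightarrow> real) \<Rightarrow> ('a \<Rightarrow> real) \<Rightarrow> bool" where
  "distributional_poisson u g \<longleftrightarrow>
     (\<forall>\<phi>. test_function \<phi> \<longrightarrow>
        - (LINT x|lebesgue. u x * laplacian \<phi> x) = (LINT x|lebesgue. g x * \<phi> x))"

definition liouville_density :: "complex poly \<Rightarrow> (complex \<Rightarrow> real) \<Rightarrow> complex \<Rightarrow> real" where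
  "liouville_density f \<psi> = (\<lambda>z. (cmod (poly f z))\<^sup>2 * exp (\<psi> z))"

definition liouville_weak_solution :: "complex poly \<Rightarrow> (complex \<Rightarrow> real) \<Rightarrow> bool" where
  "liouville_weak_solution f \<psi> \<longleftrightarrow>
     locally_integrable \<psi> \<and>
     integrable lebesgue (liouville_density f \<psi>) \<and>
     distributional_poisson \<psi> (liouville_density f \<psi>)"

text \<open>Common zeros of \<open>P\<close> and \<open>Q\<close> get the value \<open>-2 log 0 = \<infinity>\<close>, whereas \<^term>\<open>ln (0::real) = 0\<close>
  would make the pairs \<open>(0, 0)\<close> and \<open>(1, 0)\<close> indistinguishable.\<close>

definition psi :: "complex poly \<Rightarrow> complex poly \<Rightarrow> complex \<Rightarrow> ereal" where
  "psi P Q = (\<lambda>z. let r = (cmod (poly P z))\<^sup>2 + (cmod (poly Q z))\<^sup>2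
                   in if r = 0 then \<infinity> else ereal (ln 8 - 2 * ln r))"

definition conj_transpose :: "complex^'n^'m \<Rightarrow> complex^'m^'n" where
  "conj_transpose A = (\<chi> i j. cnj (A $ j $ i))"

definition unitary_matrix :: "complex^'n^'n \<Rightarrow> bool" where
  "unitary_matrix A \<longleftrightarrow> conj_transpose A ** A = mat 1 \<and> A ** conj_transpose A = mat 1"

end

theory Submission
  imports Defs "HOL-Complex_Analysis.Complex_Analysis" "HOL-Computational_Algebra.Fundamental_Theorem_Algebra"
begin

text \<open>A weak solution \<open>\<psi>\<close> is smooth: the truncated logarithmic potential is a parametrix, the argument of Brezis and
  Merle makes \<open>|f|\<^sup>2 e\<^sup>\<psi>\<close> locally bounded, and each further application of the parametrix gains a derivative.
  Put \<open>u = \<surd>8 exp (-\<psi>/2)\<close>. The equation for \<open>\<psi>\<close> becomes \<open>u \<partial>\<partial>'u -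
  \<partial>u \<partial>'u = |f|\<^sup>2\<close>, with \<open>\<partial>\<close> and \<open>\<partial>'\<close> the Wirtinger derivatives, and
  finiteness of the mass bounds \<open>-\<psi>\<close> by a multiple of \<open>ln |z|\<close>, so that \<open>u\<close> grows polynomially.
  Differentiating, \<open>(f \<partial>\<partial>u - f' \<partial>u) / u\<close> is entire, so that where \<open>f\<close> does not vanish all
  \<open>\<partial>\<^sup>k u\<close> are combinations of \<open>u\<close> and \<open>\<partial>u\<close>, and the mixed derivatives
  \<open>\<partial>\<^sup>k\<partial>'\<^sup>j u\<close> at a point form a Gram matrix of rank two. Its diagonal entries are nonnegative, and
  by the growth bound they vanish for large \<open>k\<close>; hence the Taylor expansion of \<open>u\<close> terminates and exhibits
  \<open>u\<close> as \<open>|P|\<^sup>2 + |Q|\<^sup>2\<close>. The equation then says that \<open>f\<close> and the Wronskian of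
  \<open>P\<close> and \<open>Q\<close> have equal modulus. Uniqueness follows by polarization of \<open>|P|\<^sup>2 + |Q|\<^sup>2\<close>,
  and the total mass is read off from \<open>\<psi> = -4 d ln |z| + O(1)\<close>.\<close>

section \<open>Smooth functions\<close>

text \<open>The equation of second order that P and Q satisfy in z when their Wronskian is
  \<open>f\<close> is singular at the zeros of \<open>f\<close>, and away from them its local
  solutions could a priori be multivalued. This obstacle shapes the algebraic half: no solution is
  continued around a zero. The Gram form is evaluated at a single regular point, and pointwise
  statements are carried to the zeros of \<open>f\<close> by continuity, since these are finitely
  many. The Gram form is positive because the hermitian block with entries u, \<partial>u,
  \<partial>'u, \<partial>\<partial>'u has corner u > 0 and determinant |f|^2, which is exactly the
  equation. Positivity spares any pointwise estimate of derivatives: the growth of u only bounds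
  integrals against dilated cutoffs, and a nonnegative continuous function whose integrals vanish is
  zero. The number 8 is 2 * 4, where 2 comes from \<psi> = ln 8 - 2 ln u and 4 from the Laplacian
  being 4 \<partial>\<partial>'.\<close>

definition pd :: "'a::euclidean_space \<Rightarrow> ('a \<Rightarrow> 'b::real_normed_vector) \<Rightarrow> 'a \<Rightarrow> 'b" where
  "pd b u = (\<lambda>x. frechet_derivative u (at x) b)"

text \<open>Vector-valued counterpart of \<open>Ck\<close>, because the Wirtinger calculus is
  applied to complex-valued functions; \<open>Ckv_eq_Ck\<close> identifies the two on real
  functions.\<close>

primrec Ckv :: "nat \<Rightarrow> ('a::euclidean_space \<Rightarrow> 'b::real_normed_vector) \<Rightarrow> bool" where
  "Ckv 0 u \<longleftrightarrow> continuous_on UNIV u"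
| "Ckv (Suc k) u \<longleftrightarrow> u differentiable_on UNIV \<and> (\<forall>b\<in>Basis. Ckv k (pd b u))"

definition smooth :: "('a::euclidean_space \<Rightarrow> 'b::real_normed_vector) \<Rightarrow> bool" where
  "smooth u \<longleftrightarrow> (\<forall>k. Ckv k u)"

lemma Ckv_eq_Ck: "Ckv k u \<longleftrightarrow> Ck k u"
  by (induction k arbitrary: u) (auto simp: partial_deriv_def pd_def)

lemma pd_eq_partial_deriv: "pd b u = partial_deriv b u"
  by (simp add: partial_deriv_def pd_def)

lemma pd_eqI: "(u has_derivative u') (at x) \<Longrightarrow> pd b u x = u' b"
  by (metis frechet_derivative_at pd_def)

lemma Ckv_SucI:
  assumes "\<And>x. (u has_derivative u' x) (at x)" "\<And>b. b \<in> Basis \<Longrightarrow> Ckv k (\<lambda>x. u' x b)"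
  shows "Ckv (Suc k) u"
proof -
  have "pd b u = (\<lambda>x. u' x b)" for b
    using assms(1) by (auto intro!: ext pd_eqI)
  moreover have "u differentiable_on UNIV"
    using assms(1) by (auto simp: differentiable_on_def differentiable_def intro: has_derivative_at_withinI)
  ultimately show ?thesis using assms(2) by simp
qed

lemma Ckv_Suc_has_derivative_frechet:
  "Ckv (Suc k) u \<Longrightarrow> (u has_derivative frechet_derivative u (at x)) (at x)"
  by (simp add: differentiable_on_def frechet_derivative_works)

lemma Ckv_Suc_has_derivative:
  assumes "Ckv (Suc k) u"
  shows "(u has_derivative (\<lambda>h. \<Sum>b\<in>Basis. (h \<bullet> b) *\<^sub>R pd b u x)) (at x)"
proof -
  have D: "(u has_derivative frechet_derivative u (at x)) (at x)"
    by (rule Ckv_Suc_has_derivative_frechet[OF assms])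
  then have L: "linear (frechet_derivative u (at x))"
    by (rule has_derivative_linear)
  have "frechet_derivative u (at x) h = (\<Sum>b\<in>Basis. (h \<bullet> b) *\<^sub>R pd b u x)" for h
  proof -
    have "frechet_derivative u (at x) h = frechet_derivative u (at x) (\<Sum>b\<in>Basis. (h \<bullet> b) *\<^sub>R b)"
      by (simp add: euclidean_representation)
    also have "\<dots> = (\<Sum>b\<in>Basis. (h \<bullet> b) *\<^sub>R pd b u x)"
      by (simp add: linear_sum[OF L] linear_scale[OF L] pd_def)
    finally show ?thesis .
  qed
  then have "frechet_derivative u (at x) = (\<lambda>h. \<Sum>b\<in>Basis. (h \<bullet> b) *\<^sub>R pd b u x)" by blast
  with D show ?thesis by simp
qed

lemma Ckv_imp_continuous: "Ckv k u \<Longrightarrow> continuous_on UNIV u"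
  by (cases k) (auto simp: differentiable_imp_continuous_on)

lemma Ckv_SucD: "Ckv (Suc k) u \<Longrightarrow> Ckv k u"
proof (induction k arbitrary: u)
  case 0 then show ?case using Ckv_imp_continuous[of "Suc 0" u] by simp
next
  case (Suc k)
  then show ?case by (metis Ckv.simps(2))
qed

lemma Ckv_mono: "Ckv k u \<Longrightarrow> j \<le> k \<Longrightarrow> Ckv j u"
  by (induction k) (use Ckv_SucD le_Suc_eq in blast)+

lemma Ckv_const: "Ckv k (\<lambda>x. c)"
proof (induction k arbitrary: c)
  case (Suc k)
  show ?case by (rule Ckv_SucI[where u' = "\<lambda>_ _. 0"]) (auto simp: Suc)
qed auto

lemma Ckv_add: "Ckv k u \<Longrightarrow> Ckv k v \<Longrightarrow> Ckv k (\<lambda>x. u x + v x)"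
proof (induction k arbitrary: u v)
  case (Suc k)
  show ?case
    by (rule Ckv_SucI[OF has_derivative_add[OF Ckv_Suc_has_derivative_frechet Ckv_Suc_has_derivative_frechet]])
       (use Suc in \<open>auto simp: pd_def\<close>)
qed (auto intro: continuous_intros)

lemma Ckv_bounded_linear:
  assumes "bounded_linear f" shows "Ckv k u \<Longrightarrow> Ckv k (\<lambda>x. f (u x))"
proof (induction k arbitrary: u)
  case 0
  then show ?case by (auto intro!: continuous_on_compose2[OF linear_continuous_on[OF assms, of UNIV]])
next
  case (Suc k)
  show ?case
    by (rule Ckv_SucI[OF bounded_linear.has_derivative[OF assms Ckv_Suc_has_derivative_frechet]])
       (use Suc in \<open>auto simp: pd_def\<close>)
qed

lemma Ckv_linear: "bounded_linear f \<Longrightarrow> Ckv k f"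
  by (cases k) (auto simp: linear_continuous_on simp del: Ckv.simps(2) simp: Ckv_const
     intro!: Ckv_SucI[where u'="\<lambda>x. f"] bounded_linear_imp_has_derivative)

lemma Ckv_bilinear:
  assumes "bounded_bilinear m"
  shows "Ckv k u \<Longrightarrow> Ckv k v \<Longrightarrow> Ckv k (\<lambda>x. m (u x) (v x))"
proof (induction k arbitrary: u v)
  case 0
  then show ?case by (auto intro: bounded_bilinear.continuous_on[OF assms])
next
  case (Suc k)
  have uv: "Ckv k u" "Ckv k v" using Suc.prems Ckv_SucD by blast+
  show ?case
    apply (rule Ckv_SucI[OF bounded_bilinear.FDERIV[OF assms Ckv_Suc_has_derivative_frechet Ckv_Suc_has_derivative_frechet]])
    using Suc uv by (auto simp: pd_def intro!: Ckv_add)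
qed

lemmas Ckv_mult = Ckv_bilinear[OF bounded_bilinear_mult]
lemmas Ckv_scaleR = Ckv_bilinear[OF bounded_bilinear_scaleR]
lemmas Ckv_inner = Ckv_bilinear[OF bounded_bilinear_inner]

lemma Ckv_minus: "Ckv k u \<Longrightarrow> Ckv k (\<lambda>x. - u x)"
  by (rule Ckv_bounded_linear[OF bounded_linear_minus[OF bounded_linear_ident]])

lemma Ckv_diff: "Ckv k u \<Longrightarrow> Ckv k v \<Longrightarrow> Ckv k (\<lambda>x. u x - v x)"
  using Ckv_add[of k u "\<lambda>x. - v x"] Ckv_minus by auto

lemma Ckv_sum: "(\<And>i. i \<in> I \<Longrightarrow> Ckv k (u i)) \<Longrightarrow> Ckv k (\<lambda>x. \<Sum>i\<in>I. u i x)"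
  by (induction I rule: infinite_finite_induct) (auto simp: Ckv_const Ckv_add)

lemma Ckv_affine: "Ckv k u \<Longrightarrow> Ckv k (\<lambda>x. u (a + c *\<^sub>R x))"
proof (induction k arbitrary: u)
  case 0
  then show ?case by (auto intro!: continuous_on_compose2[of UNIV u] continuous_intros)
next
  case (Suc k)
  have "((\<lambda>x. u (a + c *\<^sub>R x)) has_derivative (\<lambda>h. frechet_derivative u (at (a + c *\<^sub>R x)) (c *\<^sub>R h))) (at x)" for x
    by (rule has_derivative_compose[of "\<lambda>x. a + c *\<^sub>R x", OF _ Ckv_Suc_has_derivative_frechet[OF Suc.prems]])
       (auto intro!: derivative_eq_intros)
  then show ?case
  proof (rule Ckv_SucI)
    fix b :: 'a assume b: "b \<in> Basis"
    have "frechet_derivative u (at y) (c *\<^sub>R b) = c *\<^sub>R pd b u y" for y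
      using linear_scale[OF has_derivative_linear[OF Ckv_Suc_has_derivative_frechet[OF Suc.prems]]]
      by (simp add: pd_def)
    then show "Ckv k (\<lambda>x. frechet_derivative u (at (a + c *\<^sub>R x)) (c *\<^sub>R b))"
      using Suc b by (auto intro!: Ckv_scaleR[OF Ckv_const])
  qed
qed

lemma pd_affine:
  assumes "Ckv (Suc k) u"
  shows "pd b (\<lambda>x. u (a + c *\<^sub>R x)) x = c *\<^sub>R pd b u (a + c *\<^sub>R x)"
proof -
  have "((\<lambda>x. u (a + c *\<^sub>R x)) has_derivative (\<lambda>h. frechet_derivative u (at (a + c *\<^sub>R x)) (c *\<^sub>R h))) (at x)"
    by (rule has_derivative_compose[of "\<lambda>x. a + c *\<^sub>R x", OF _ Ckv_Suc_has_derivative_frechet[OF assms]])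
       (auto intro!: derivative_eq_intros)
  from pd_eqI[OF this] show ?thesis
    using linear_scale[OF has_derivative_linear[OF Ckv_Suc_has_derivative_frechet[OF assms]]]
    by (simp add: pd_def)
qed

text \<open>Smoothness is witnessed by the whole sequence of derivatives, so that the chain rule for
  all orders becomes one induction in which the index into the sequence is generalized.\<close>

definition smooth_real_on :: "real set \<Rightarrow> (real \<Rightarrow> real) \<Rightarrow> bool" where
  "smooth_real_on S h \<longleftrightarrow>
     (\<exists>D. D 0 = h \<and> (\<forall>n. \<forall>x\<in>S. (D n has_real_derivative D (Suc n) x) (at x)))"

lemma Ckv_compose_real:
  assumes "smooth_real_on S h" "\<And>x. F x \<in> S"
  shows "Ckv k F \<Longrightarrow> Ckv k (\<lambda>x. h (F x))"
proof -
  obtain D where D: "D 0 = h" and der: "\<And>n x. x \<in> S \<Longrightarrow> (D n has_real_derivative D (Suc n) x) (at x)"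
    using assms(1) unfolding smooth_real_on_def by blast
  have "Ckv k F \<Longrightarrow> Ckv k (\<lambda>x. D n (F x))" for n
  proof (induction k arbitrary: n)
    case 0
    have "continuous_on S (D n)"
      using der by (meson DERIV_isCont continuous_at_imp_continuous_on)
    with 0 show ?case using assms(2) by (auto intro!: continuous_on_compose2[of S "D n"])
  next
    case (Suc k)
    have "((\<lambda>x. D n (F x)) has_derivative (\<lambda>h. D (Suc n) (F x) * frechet_derivative F (at x) h)) (at x)" for x
      using has_derivative_compose[OF Ckv_Suc_has_derivative_frechet[OF Suc.prems]
          der[OF assms(2)[of x], of n, unfolded has_field_derivative_def]]
      by (simp add: mult.commute)
    then show ?case
      by (rule Ckv_SucI) (use Suc Ckv_SucD[OF Suc.prems] in \<open>auto simp: pd_def intro!: Ckv_mult\<close>)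
  qed
  then show "Ckv k F \<Longrightarrow> Ckv k (\<lambda>x. h (F x))" using D by metis
qed

lemma smoothD: "smooth u \<Longrightarrow> Ckv k u" by (simp add: smooth_def)

lemma smooth_pd: "smooth u \<Longrightarrow> b \<in> Basis \<Longrightarrow> smooth (pd b u)"
  unfolding smooth_def by (metis Ckv.simps(2))

lemma smooth_continuous: "smooth u \<Longrightarrow> continuous_on UNIV u"
  using Ckv_imp_continuous smoothD by blast

lemmas smooth_has_derivative = Ckv_Suc_has_derivative[OF smoothD]

named_theorems smooth_intros

lemma smooth_const [smooth_intros]: "smooth (\<lambda>x. c)" by (simp add: smooth_def Ckv_const)
lemma smooth_add [smooth_intros]: "smooth u \<Longrightarrow> smooth v \<Longrightarrow> smooth (\<lambda>x. u x + v x)"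
  by (simp add: smooth_def Ckv_add)
lemma smooth_diff [smooth_intros]: "smooth u \<Longrightarrow> smooth v \<Longrightarrow> smooth (\<lambda>x. u x - v x)"
  by (simp add: smooth_def Ckv_diff)
lemma smooth_mult [smooth_intros]: "smooth u \<Longrightarrow> smooth v \<Longrightarrow> smooth (\<lambda>x. u x * v x)"
  for u :: "_ \<Rightarrow> 'b::real_normed_algebra"
  by (simp add: smooth_def Ckv_mult)
lemma smooth_inner [smooth_intros]: "smooth u \<Longrightarrow> smooth v \<Longrightarrow> smooth (\<lambda>x. u x \<bullet> v x)"
  by (simp add: smooth_def Ckv_inner)
lemma smooth_power [smooth_intros]: "smooth u \<Longrightarrow> smooth (\<lambda>x. u x ^ n)"
  for u :: "_ \<Rightarrow> 'b::real_normed_algebra_1"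
  by (induction n) (auto intro: smooth_intros)
lemma smooth_sum [smooth_intros]: "(\<And>i. i \<in> I \<Longrightarrow> smooth (u i)) \<Longrightarrow> smooth (\<lambda>x. \<Sum>i\<in>I. u i x)"
  by (simp add: smooth_def Ckv_sum)
lemma smooth_linear: "bounded_linear f \<Longrightarrow> smooth f"
  by (simp add: smooth_def Ckv_linear)
lemma smooth_ident [smooth_intros]: "smooth (\<lambda>x. x)"
  by (rule smooth_linear[OF bounded_linear_ident])
lemma smooth_bounded_linear: "bounded_linear f \<Longrightarrow> smooth u \<Longrightarrow> smooth (\<lambda>x. f (u x))"
  by (simp add: smooth_def Ckv_bounded_linear)
lemma smooth_affine: "smooth u \<Longrightarrow> smooth (\<lambda>x. u (a + c *\<^sub>R x))"
  by (simp add: smooth_def Ckv_affine)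
lemma smooth_compose_real: "smooth_real_on S h \<Longrightarrow> (\<And>x. F x \<in> S) \<Longrightarrow> smooth F \<Longrightarrow> smooth (\<lambda>x. h (F x))"
  by (simp add: smooth_def Ckv_compose_real)

lemma pd_add:
  assumes "Ckv (Suc k) u" "Ckv (Suc k) v"
  shows "pd b (\<lambda>x. u x + v x) x = pd b u x + pd b v x"
  using pd_eqI[OF has_derivative_add[OF assms[THEN Ckv_Suc_has_derivative_frechet]]]
  by (simp add: pd_def)

lemma pd_mult:
  fixes u v :: "_ \<Rightarrow> 'b::real_normed_algebra"
  assumes "Ckv (Suc k) u" "Ckv (Suc k) v"
  shows "pd b (\<lambda>x. u x * v x) x = u x * pd b v x + pd b u x * v x"
  using pd_eqI[OF has_derivative_mult[OF assms[THEN Ckv_Suc_has_derivative_frechet]]]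
  by (simp add: pd_def)

lemma pd_bounded_linear:
  assumes "bounded_linear f" "Ckv (Suc k) u"
  shows "pd b (\<lambda>x. f (u x)) x = f (pd b u x)"
  using pd_eqI[OF bounded_linear.has_derivative[OF assms(1) Ckv_Suc_has_derivative_frechet[OF assms(2)]]]
  by (simp add: pd_def)

lemma pd_compose_real:
  assumes "(h has_real_derivative h') (at (u x))" "Ckv (Suc k) u"
  shows "pd b (\<lambda>x. h (u x)) x = h' * pd b u x"
  using pd_eqI[OF has_derivative_compose[OF Ckv_Suc_has_derivative_frechet[OF assms(2)]
      assms(1)[unfolded has_field_derivative_def]]]
  by (simp add: pd_def)

text \<open>The mean value theorem is applied along \<open>a\<close> to a difference of two
  translates of \<open>F\<close>, then along \<open>b\<close>. The second difference on the left is
  symmetric in \<open>a\<close> and \<open>b\<close>; only the order of the partial derivatives on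
  the right depends on the choice.\<close>

lemma second_difference_mvt:
  fixes F :: "'a::euclidean_space \<Rightarrow> real"
  assumes "Ckv (Suc (Suc 0)) F" "a \<in> Basis" "b \<in> Basis" "t > 0"
  shows "\<exists>\<xi> \<eta>. 0 < \<xi> \<and> \<xi> < t \<and> 0 < \<eta> \<and> \<eta> < t \<and>
     F (x + t *\<^sub>R a + t *\<^sub>R b) - F (x + t *\<^sub>R a) - F (x + t *\<^sub>R b) + F x
       = t\<^sup>2 * pd b (pd a F) (x + \<xi> *\<^sub>R a + \<eta> *\<^sub>R b)"
proof -
  have line: "((\<lambda>s. G (y + s *\<^sub>R c)) has_real_derivative pd c G (y + s *\<^sub>R c)) (at s)"
    if "Ckv (Suc 0) G" "c \<in> Basis" for G :: "'a \<Rightarrow> real" and y c s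
  proof -
    have "((\<lambda>s. G (y + s *\<^sub>R c)) has_derivative (\<lambda>h. frechet_derivative G (at (y + s *\<^sub>R c)) (h *\<^sub>R c))) (at s)"
      by (rule has_derivative_compose[of "\<lambda>s. y + s *\<^sub>R c", OF _ Ckv_Suc_has_derivative_frechet[OF that(1)]])
         (auto intro!: derivative_eq_intros)
    moreover have "frechet_derivative G (at (y + s *\<^sub>R c)) (h *\<^sub>R c) = pd c G (y + s *\<^sub>R c) * h" for h
      using linear_scale[OF has_derivative_linear[OF Ckv_Suc_has_derivative_frechet[OF that(1)]]]
      by (simp add: pd_def)
    ultimately show ?thesis by (simp add: has_field_derivative_def)
  qed
  have F1: "Ckv (Suc 0) F" and aF: "Ckv (Suc 0) (pd a F)" using assms Ckv_SucD by (blast, auto)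
  let ?\<phi> = "\<lambda>s. F ((x + t *\<^sub>R b) + s *\<^sub>R a) - F (x + s *\<^sub>R a)"
  have "(?\<phi> has_real_derivative pd a F ((x + t *\<^sub>R b) + s *\<^sub>R a) - pd a F (x + s *\<^sub>R a)) (at s)" for s
    by (intro DERIV_diff line F1 assms)
  from MVT2[OF \<open>t > 0\<close> this] obtain \<xi> where \<xi>: "0 < \<xi>" "\<xi> < t"
    "?\<phi> t - ?\<phi> 0 = t * (pd a F ((x + t *\<^sub>R b) + \<xi> *\<^sub>R a) - pd a F (x + \<xi> *\<^sub>R a))" by auto
  have "((\<lambda>s. pd a F ((x + \<xi> *\<^sub>R a) + s *\<^sub>R b)) has_real_derivative pd b (pd a F) ((x + \<xi> *\<^sub>R a) + s *\<^sub>R b)) (at s)" for s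
    by (intro line aF assms)
  from MVT2[OF \<open>t > 0\<close> this] obtain \<eta> where \<eta>: "0 < \<eta>" "\<eta> < t"
    "pd a F ((x + \<xi> *\<^sub>R a) + t *\<^sub>R b) - pd a F (x + \<xi> *\<^sub>R a) = t * pd b (pd a F) ((x + \<xi> *\<^sub>R a) + \<eta> *\<^sub>R b)" by auto
  have "F (x + t *\<^sub>R a + t *\<^sub>R b) - F (x + t *\<^sub>R a) - F (x + t *\<^sub>R b) + F x = ?\<phi> t - ?\<phi> 0"
    by (simp add: add_ac)
  also have "\<dots> = t * (t * pd b (pd a F) ((x + \<xi> *\<^sub>R a) + \<eta> *\<^sub>R b))"
    using \<xi>(3) \<eta>(3) by (simp add: add_ac)
  finally show ?thesis using \<xi> \<eta> by (auto simp: power2_eq_square)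
qed

text \<open>The symmetric second difference, divided by the square of the step, is a value of either
  mixed derivative at points within twice the step of \<open>x\<close>; continuity of both lets the
  step tend to 0.\<close>

lemma pd_commute_real:
  fixes F :: "'a::euclidean_space \<Rightarrow> real"
  assumes F: "Ckv (Suc (Suc 0)) F" and ab: "a \<in> Basis" "b \<in> Basis"
  shows "pd a (pd b F) x = pd b (pd a F) x"
proof -
  define t where "t = (\<lambda>n. 1 / real (Suc n))"
  have t: "t n > 0" for n by (simp add: t_def)
  have t0: "t \<longlonglongrightarrow> 0" unfolding t_def by (rule LIMSEQ_Suc[OF lim_const_over_n])
  have "\<exists>y y'. norm (y - x) \<le> 2 * t n \<and> norm (y' - x) \<le> 2 * t n \<and> pd b (pd a F) y = pd a (pd b F) y'" for n
  proof -
    obtain \<xi> \<eta> where 1: "0 < \<xi>" "\<xi> < t n" "0 < \<eta>" "\<eta> < t n"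
     "F (x + t n *\<^sub>R a + t n *\<^sub>R b) - F (x + t n *\<^sub>R a) - F (x + t n *\<^sub>R b) + F x
       = (t n)\<^sup>2 * pd b (pd a F) (x + \<xi> *\<^sub>R a + \<eta> *\<^sub>R b)"
      using second_difference_mvt[OF F ab t] by blast
    obtain \<xi>' \<eta>' where 2: "0 < \<xi>'" "\<xi>' < t n" "0 < \<eta>'" "\<eta>' < t n"
     "F (x + t n *\<^sub>R b + t n *\<^sub>R a) - F (x + t n *\<^sub>R b) - F (x + t n *\<^sub>R a) + F x
       = (t n)\<^sup>2 * pd a (pd b F) (x + \<xi>' *\<^sub>R b + \<eta>' *\<^sub>R a)"
      using second_difference_mvt[OF F ab(2,1) t] by blast
    have swap: "x + t n *\<^sub>R b + t n *\<^sub>R a = x + t n *\<^sub>R a + t n *\<^sub>R b" by (simp add: add_ac)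
    have "(t n)\<^sup>2 * pd b (pd a F) (x + \<xi> *\<^sub>R a + \<eta> *\<^sub>R b) = (t n)\<^sup>2 * pd a (pd b F) (x + \<xi>' *\<^sub>R b + \<eta>' *\<^sub>R a)"
      using 1(5) 2(5) unfolding swap by linarith
    then have "pd b (pd a F) (x + \<xi> *\<^sub>R a + \<eta> *\<^sub>R b) = pd a (pd b F) (x + \<xi>' *\<^sub>R b + \<eta>' *\<^sub>R a)"
      using t[of n] by simp
    moreover have "norm (x + \<xi> *\<^sub>R a + \<eta> *\<^sub>R b - x) \<le> 2 * t n"
      using norm_triangle_ineq[of "\<xi> *\<^sub>R a" "\<eta> *\<^sub>R b"] 1 ab by (simp add: add.assoc)
    moreover have "norm (x + \<xi>' *\<^sub>R b + \<eta>' *\<^sub>R a - x) \<le> 2 * t n"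
      using norm_triangle_ineq[of "\<xi>' *\<^sub>R b" "\<eta>' *\<^sub>R a"] 2 ab by (simp add: add.assoc)
    ultimately show ?thesis by blast
  qed
  then obtain y y' where y: "\<And>n. norm (y n - x) \<le> 2 * t n" "\<And>n. norm (y' n - x) \<le> 2 * t n"
    "\<And>n. pd b (pd a F) (y n) = pd a (pd b F) (y' n)" by metis
  have "(\<lambda>n. 2 * t n) \<longlonglongrightarrow> 0" using tendsto_mult_right_zero[OF t0] by simp
  then have "(\<lambda>n. y n - x) \<longlonglongrightarrow> 0" "(\<lambda>n. y' n - x) \<longlonglongrightarrow> 0"
    using y by (auto intro: Lim_null_comparison[where g="\<lambda>n. 2 * t n"])
  then have lim: "y \<longlonglongrightarrow> x" "y' \<longlonglongrightarrow> x" by (auto simp: LIM_zero_iff)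
  have "continuous_on UNIV (pd b (pd a F))" "continuous_on UNIV (pd a (pd b F))"
    using F ab by auto
  then have "(\<lambda>n. pd b (pd a F) (y n)) \<longlonglongrightarrow> pd b (pd a F) x" "(\<lambda>n. pd a (pd b F) (y' n)) \<longlonglongrightarrow> pd a (pd b F) x"
    using lim by (auto intro: continuous_on_tendsto_compose)
  then show ?thesis using y(3) LIMSEQ_unique by simp
qed

lemma pd_commute:
  fixes F :: "'a::euclidean_space \<Rightarrow> 'b::euclidean_space"
  assumes F: "Ckv (Suc (Suc 0)) F" and ab: "a \<in> Basis" "b \<in> Basis"
  shows "pd a (pd b F) x = pd b (pd a F) x"
proof (rule euclidean_eqI)
  fix e :: 'b assume "e \<in> Basis"
  have bl: "bounded_linear (\<lambda>y. y \<bullet> e)" by (rule bounded_linear_inner_left)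
  have 1: "pd c (\<lambda>x. F x \<bullet> e) = (\<lambda>x. pd c F x \<bullet> e)" for c
    using pd_bounded_linear[OF bl F] by auto
  have 2: "pd c (\<lambda>x. pd d F x \<bullet> e) x = pd c (pd d F) x \<bullet> e" if "d \<in> Basis" for c d
    by (rule pd_bounded_linear[OF bl, of 0]) (use F that in auto)
  show "pd a (pd b F) x \<bullet> e = pd b (pd a F) x \<bullet> e"
    using pd_commute_real[OF Ckv_bounded_linear[OF bl F] ab] 2[of a b] 2[of b a] ab by (simp add: 1)
qed

section \<open>A smooth cutoff function\<close>

definition flat_exp :: "real \<Rightarrow> real" where
  "flat_exp x = (if x \<le> 0 then 0 else exp (- (1 / x)))"

lemma poly_times_exp_neg_tendsto_0: "((\<lambda>y::real. poly q y * exp (- y)) \<longlongrightarrow> 0) at_top"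
proof -
  have "((\<lambda>y::real. \<Sum>i\<le>degree q. coeff q i * (y ^ i / exp y)) \<longlongrightarrow> (\<Sum>i\<le>degree q. coeff q i * 0)) at_top"
    by (intro tendsto_intros tendsto_power_div_exp_0)
  then show ?thesis by (simp add: poly_altdef sum_distrib_right exp_minus divide_inverse mult.assoc)
qed

lemma smooth_real_flat_exp: "smooth_real_on UNIV flat_exp"
proof -
  \<comment> \<open>With y = 1/x one has dy/dx = -y^2, so differentiating q(y) exp(-y) in x gives
    y^2 (q - q') (y) exp(-y).\<close>
  define p where "p = rec_nat (1::real poly) (\<lambda>_ p. monom 1 2 * (p - pderiv p))"
  have p0: "p 0 = 1" and pS: "p (Suc n) = monom 1 2 * (p n - pderiv (p n))" for n by (simp_all add: p_def)
  define D where "D n x = (if x \<le> 0 then 0 else poly (p n) (1 / x) * exp (- (1 / x)))" for n and x :: real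
  have "(D n has_real_derivative D (Suc n) x) (at x)" for n x
  proof (cases x "0::real" rule: linorder_cases)
    case less
    have "((\<lambda>_. 0) has_real_derivative D (Suc n) x) (at x)" using less by (simp add: D_def)
    moreover have "open {..<(0::real)}" "x \<in> {..<0}" using less by auto
    ultimately show ?thesis
      by (rule has_field_derivative_transform_within_open) (simp add: D_def)
  next
    case greater
    have "((\<lambda>x. poly (p n) (1 / x) * exp (- (1 / x))) has_real_derivative
        poly (p (Suc n)) (1 / x) * exp (- (1 / x))) (at x)"
      using greater by (auto intro!: derivative_eq_intros simp: pS poly_monom field_simps power2_eq_square)
    then have "((\<lambda>x. poly (p n) (1 / x) * exp (- (1 / x))) has_real_derivative D (Suc n) x) (at x)"
      using greater by (simp add: D_def)
    moreover have "open {0::real<..}" "x \<in> {0<..}" using greater by auto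
    ultimately show ?thesis
      by (rule has_field_derivative_transform_within_open) (simp add: D_def)
  next
    case equal
    \<comment> \<open>The extra factor y = 1/h turns \<open>D n h\<close> into the difference
      quotient \<open>D n h / h\<close>.\<close>
    have "((\<lambda>y. poly (monom 1 1 * p n) y * exp (- y)) \<longlongrightarrow> 0) at_top"
      by (rule poly_times_exp_neg_tendsto_0)
    from filterlim_compose[OF this filterlim_inverse_at_top_right]
    have "((\<lambda>h. D n h / h) \<longlongrightarrow> 0) (at_right 0)"
      by (rule Lim_transform_eventually)
         (auto simp: eventually_at_right_less D_def poly_monom divide_inverse mult_ac
            intro!: eventually_mono[OF eventually_at_right_less])
    moreover have "((\<lambda>h. D n h / h) \<longlongrightarrow> 0) (at_left 0)"
      by (rule Lim_transform_eventually[OF tendsto_const])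
         (auto simp: D_def eventually_at_left_field intro!: exI[of _ "-1"])
    ultimately have "((\<lambda>h. D n h / h) \<longlongrightarrow> 0) (at 0)"
      by (simp add: filterlim_split_at)
    then show ?thesis using equal by (simp add: DERIV_def D_def)
  qed
  moreover have "D 0 = flat_exp" by (auto simp: D_def flat_exp_def p0)
  ultimately show ?thesis unfolding smooth_real_on_def by blast
qed

lemma flat_exp_nonneg: "flat_exp x \<ge> 0" by (simp add: flat_exp_def)
lemma flat_exp_pos_iff: "flat_exp x > 0 \<longleftrightarrow> x > 0" by (simp add: flat_exp_def)
lemma flat_exp_eq_0_iff: "flat_exp x = 0 \<longleftrightarrow> x \<le> 0" by (simp add: flat_exp_def)
lemma flat_exp_mono: "x \<le> y \<Longrightarrow> flat_exp x \<le> flat_exp y"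
  by (auto simp: flat_exp_def frac_le)

lemma continuous_on_flat_exp: "continuous_on UNIV flat_exp"
  using smooth_real_flat_exp unfolding smooth_real_on_def
  by (metis DERIV_isCont UNIV_I continuous_at_imp_continuous_on)

text \<open>The inner \<open>flat_exp\<close> vanishes up to 1/4, which makes the outer argument
  constant there, and it reaches \<open>flat_exp (3/4)\<close> at 1, after which the outer argument
  is nonpositive. Nesting in this way gives a plateau while dividing only by a constant. The
  argument will be a squared norm, whence 1/4 for the radius 1/2.\<close>

definition cutoff_profile :: "real \<Rightarrow> real" where
  "cutoff_profile t = flat_exp (flat_exp (3/4) - flat_exp (t - 1/4)) / flat_exp (flat_exp (3/4))"

lemma cutoff_profile_nonneg: "cutoff_profile t \<ge> 0"
  by (simp add: cutoff_profile_def flat_exp_nonneg)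

lemma flat_exp_const_pos: "flat_exp (flat_exp (3/4)) > 0"
  by (simp add: flat_exp_pos_iff)

lemma cutoff_profile_le_1: "cutoff_profile t \<le> 1"
  using flat_exp_mono[of "flat_exp (3/4) - flat_exp (t - 1/4)" "flat_exp (3/4)"] flat_exp_nonneg[of "t - 1/4"]
    flat_exp_const_pos by (simp add: cutoff_profile_def)

lemma cutoff_profile_eq_1: "t \<le> 1/4 \<Longrightarrow> cutoff_profile t = 1"
  using flat_exp_const_pos by (simp add: cutoff_profile_def flat_exp_eq_0_iff[THEN iffD2])

lemma cutoff_profile_eq_0: "t \<ge> 1 \<Longrightarrow> cutoff_profile t = 0"
  using flat_exp_mono[of "3/4" "t - 1/4"] by (simp add: cutoff_profile_def flat_exp_eq_0_iff)

lemma continuous_on_cutoff_profile: "continuous_on UNIV cutoff_profile"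
  unfolding cutoff_profile_def using flat_exp_const_pos
  by (intro continuous_intros continuous_on_compose2[OF continuous_on_flat_exp]) auto

definition cutoff :: "'a::euclidean_space \<Rightarrow> real" where
  "cutoff z = cutoff_profile ((norm z)\<^sup>2)"

lemma smooth_norm_sq [smooth_intros]: "smooth (\<lambda>z::'a::euclidean_space. (norm z)\<^sup>2)"
  unfolding power2_norm_eq_inner by (intro smooth_intros)

lemma smooth_cutoff [smooth_intros]: "smooth (cutoff :: 'a::euclidean_space \<Rightarrow> real)"
proof -
  have "smooth (\<lambda>z::'a. flat_exp ((norm z)\<^sup>2 - 1/4))"
    by (rule smooth_compose_real[OF smooth_real_flat_exp]) (auto intro: smooth_intros)
  then have "smooth (\<lambda>z::'a. flat_exp (flat_exp (3/4) - flat_exp ((norm z)\<^sup>2 - 1/4)))"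
    by (intro smooth_compose_real[OF smooth_real_flat_exp, where F="\<lambda>z. flat_exp (3/4) - flat_exp ((norm z)\<^sup>2 - 1/4)"])
       (auto intro: smooth_intros)
  then have "smooth (\<lambda>z::'a. flat_exp (flat_exp (3/4) - flat_exp ((norm z)\<^sup>2 - 1/4)) * (1 / flat_exp (flat_exp (3/4))))"
    by (intro smooth_mult smooth_const)
  then show ?thesis by (simp add: cutoff_def[abs_def] cutoff_profile_def)
qed

lemma cutoff_nonneg: "cutoff z \<ge> 0" and cutoff_le_1: "cutoff z \<le> 1"
  by (simp_all add: cutoff_def cutoff_profile_nonneg cutoff_profile_le_1)

lemma cutoff_eq_1: "norm z \<le> 1/2 \<Longrightarrow> cutoff z = 1"
  unfolding cutoff_def by (rule cutoff_profile_eq_1) (use power_mono[of "norm z" "1/2" 2] in \<open>simp add: power_divide\<close>)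

lemma cutoff_eq_0: "norm z \<ge> 1 \<Longrightarrow> cutoff z = 0"
  unfolding cutoff_def by (rule cutoff_profile_eq_0) simp

lemma pd_locally_const:
  assumes "open S" "x \<in> S" "\<And>y. y \<in> S \<Longrightarrow> u y = c"
  shows "pd b u x = 0"
proof -
  have "(u has_derivative (\<lambda>_. 0)) (at x)"
    by (rule has_derivative_transform_within_open[OF has_derivative_const assms(1,2)]) (use assms in auto)
  then show ?thesis by (rule pd_eqI)
qed

lemma pd_eq_0_outside:
  assumes "\<And>z. norm z > R \<Longrightarrow> u z = 0" shows "norm z > R \<Longrightarrow> pd b u z = 0"
  by (rule pd_locally_const[of "- cball 0 R"]) (auto simp: assms)

lemma test_functionI:
  fixes \<phi> :: "'a::euclidean_space \<Rightarrow> real"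
  assumes "smooth \<phi>" "\<And>z. norm z > R \<Longrightarrow> \<phi> z = 0"
  shows "test_function \<phi>"
proof -
  have "{x. \<phi> x \<noteq> 0} \<subseteq> cball 0 R" using assms(2) by force
  then have "closure {x. \<phi> x \<noteq> 0} \<subseteq> cball 0 R" by (rule closure_minimal) auto
  then have "compact (closure {x. \<phi> x \<noteq> 0})"
    by (meson bounded_cball bounded_subset closed_closure compact_eq_bounded_closed)
  with assms(1) show ?thesis by (simp add: test_function_def smooth_def Ckv_eq_Ck)
qed

section \<open>Radial integrals in the plane\<close>

text \<open>Polar coordinates for radial functions without a change of variables: both measures give
  the half-line up to \<open>a\<close> the area of the disc of radius \<open>a\<close>, and
  half-lines generate the Borel sets.\<close>

lemma distr_norm_complex:
  "distr lborel borel (norm :: complex \<Rightarrow> real) = density lborel (\<lambda>t. ennreal (2 * pi * t) * indicator {0..} t)"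
  (is "?M = ?N")
proof (rule measure_eqI_generator_eq)
  have M: "emeasure ?M {..a} = ennreal (if a \<ge> 0 then pi * a\<^sup>2 else 0)" for a
  proof -
    have "emeasure ?M {..a} = emeasure lborel (cball (0::complex) a)"
      by (subst emeasure_distr) (auto intro!: arg_cong[of _ _ "emeasure lborel"])
    then show ?thesis by (auto simp: emeasure_cball unit_ball_vol_2)
  qed
  have N: "emeasure ?N {..a} = ennreal (if a \<ge> 0 then pi * a\<^sup>2 else 0)" for a
  proof (cases "a \<ge> 0")
    case True
    have "emeasure ?N {..a} = (\<integral>\<^sup>+t. ennreal (2 * pi * t) * indicator {0..a} t \<partial>lborel)"
      by (subst emeasure_density) (auto intro!: nn_integral_cong split: split_indicator)
    also have "\<dots> = ennreal (pi * a\<^sup>2 - pi * 0\<^sup>2)"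
      using True by (intro nn_integral_FTC_Icc) (auto intro!: derivative_eq_intros)
    finally show ?thesis using True by simp
  next
    case False
    have "emeasure ?N {..a} = (\<integral>\<^sup>+(t::real). 0 \<partial>lborel)"
      using False by (subst emeasure_density) (simp, simp, intro nn_integral_cong, auto split: split_indicator)
    with False show ?thesis by simp
  qed
  show "emeasure ?M X = emeasure ?N X" if "X \<in> range atMost" for X using that M N by auto
  show "Int_stable (range (atMost :: real \<Rightarrow> _))" by (auto simp: Int_stable_def)
  show "sets ?M = sigma_sets UNIV (range atMost)" "sets ?N = sigma_sets UNIV (range atMost)"
    by (simp_all add: borel_eq_atMost)
  show "range (\<lambda>i::nat. {..real i}) \<subseteq> range atMost" by auto
  show "(\<Union>i::nat. {..real i}) = UNIV" by (auto intro: real_arch_simple)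
  show "emeasure ?M {..real i} \<noteq> \<infinity>" for i by (subst M) simp
qed auto

lemma nn_integral_radial:
  assumes [measurable]: "F \<in> borel_measurable borel"
  shows "(\<integral>\<^sup>+(z::complex). F (norm z) \<partial>lborel) = (\<integral>\<^sup>+t. ennreal (2 * pi * t) * indicator {0..} t * F t \<partial>lborel)"
proof -
  have "(\<integral>\<^sup>+(z::complex). F (norm z) \<partial>lborel) = (\<integral>\<^sup>+t. F t \<partial>distr lborel borel (norm :: complex \<Rightarrow> real))"
    by (simp add: nn_integral_distr)
  also have "\<dots> = (\<integral>\<^sup>+t. ennreal (2 * pi * t) * indicator {0..} t * F t \<partial>lborel)"
    unfolding distr_norm_complex by (subst nn_integral_density) auto
  finally show ?thesis .
qed

lemma nn_integral_inverse_norm: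
  assumes "R \<ge> 0"
  shows "(\<integral>\<^sup>+(z::complex). ennreal (1 / norm z) * indicator (cball 0 R) z \<partial>lborel) = ennreal (2 * pi * R)"
proof -
  have "(\<integral>\<^sup>+(z::complex). ennreal (1 / norm z) * indicator (cball 0 R) z \<partial>lborel)
      = (\<integral>\<^sup>+(z::complex). ennreal (1 / norm z) * indicator {..R} (norm z) \<partial>lborel)"
    by (auto intro!: nn_integral_cong split: split_indicator)
  also have "\<dots> = (\<integral>\<^sup>+t. ennreal (2 * pi * t) * indicator {0..} t * (ennreal (1 / t) * indicator {..R} t) \<partial>lborel)"
    by (rule nn_integral_radial) measurable
  \<comment> \<open>At t = 0 the convention 1 / 0 = 0 makes the two integrands differ, hence the
    restriction to almost every t.\<close>
  also have "\<dots> = (\<integral>\<^sup>+t. ennreal (2 * pi) * indicator {0..R} t \<partial>lborel)"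
    by (rule nn_integral_cong_AE, rule AE_mp[OF AE_lborel_singleton[of 0]])
       (auto intro!: AE_I2 split: split_indicator simp: ennreal_mult'[symmetric])
  also have "\<dots> = ennreal (2 * pi * R)"
    using assms by (simp add: nn_integral_cmult_indicator ennreal_mult)
  finally show ?thesis .
qed

text \<open>Up to a constant the integrand is the area density of the round sphere under
  stereographic projection; against 2 pi t it has the elementary primitive - pi s / (t^2 +
  s).\<close>

lemma nn_integral_spherical_tail:
  assumes "s > 0" "a \<ge> 0"
  shows "(\<integral>\<^sup>+(z::complex). ennreal (s / ((norm z)\<^sup>2 + s)\<^sup>2) * indicator {a..} (norm z) \<partial>lborel) = ennreal (pi * s / (a\<^sup>2 + s))"
proof -
  have "(\<integral>\<^sup>+(z::complex). ennreal (s / ((norm z)\<^sup>2 + s)\<^sup>2) * indicator {a..} (norm z) \<partial>lborel)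
     = (\<integral>\<^sup>+t. ennreal (2 * pi * t) * indicator {0..} t * (ennreal (s / (t\<^sup>2 + s)\<^sup>2) * indicator {a..} t) \<partial>lborel)"
    by (rule nn_integral_radial) measurable
  also have "\<dots> = (\<integral>\<^sup>+t. ennreal (2 * pi * t * s / (t\<^sup>2 + s)\<^sup>2) * indicator {a..} t \<partial>lborel)"
    using assms by (auto intro!: nn_integral_cong simp: ennreal_mult'[symmetric] split: split_indicator)
  also have "\<dots> = ennreal (0 - (- pi * s / (a\<^sup>2 + s)))"
  proof (rule nn_integral_FTC_atLeast)
    have pos: "t\<^sup>2 + s > 0" for t using assms by (simp add: add_nonneg_pos)
    show "((\<lambda>t. - pi * s / (t\<^sup>2 + s)) has_real_derivative 2 * pi * t * s / (t\<^sup>2 + s)\<^sup>2) (at t)" for t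
      using pos[of t] by (auto intro!: derivative_eq_intros simp: power2_eq_square field_simps)
    have "filterlim (\<lambda>t::real. t\<^sup>2 + s) at_top at_top"
      using filterlim_tendsto_add_at_top[OF tendsto_const filterlim_pow_at_top[OF _ filterlim_ident], of 2 s]
      by (simp add: add.commute)
    then show "((\<lambda>t. - pi * s / (t\<^sup>2 + s)) \<longlongrightarrow> 0) at_top"
      by (intro tendsto_divide_0[OF tendsto_const] filterlim_at_top_imp_at_infinity)
  qed (use assms in auto)
  finally show ?thesis by simp
qed

section \<open>Integration by parts and convolutions\<close>

lemma
  fixes f :: "'a::euclidean_space \<Rightarrow> 'b::{banach, second_countable_topology}"
  assumes c: "c \<noteq> 0"
  shows lborel_integral_affine: "(LINT x|lborel. f x) = \<bar>c\<bar> ^ DIM('a) *\<^sub>R (LINT x|lborel. f (t + c *\<^sub>R x))"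
    and lborel_integrable_affine: "integrable lborel f \<Longrightarrow> integrable lborel (\<lambda>x. f (t + c *\<^sub>R x))"
    and lborel_integrable_affine_iff: "integrable lborel (\<lambda>x. f (t + c *\<^sub>R x)) \<longleftrightarrow> integrable lborel f"
proof -
  have T [measurable]: "(\<lambda>x::'a. t + c *\<^sub>R x) \<in> borel_measurable borel" by measurable
  have eq: "density (distr lborel borel (\<lambda>x. t + c *\<^sub>R x)) (\<lambda>_. ennreal (\<bar>c\<bar>^DIM('a))) = (lborel :: 'a measure)" if "c \<noteq> 0" for t c
    by (rule lborel_affine[OF that, symmetric])
  have I: "integrable lborel g \<Longrightarrow> integrable lborel (\<lambda>x. g (t + c *\<^sub>R x))" if "c \<noteq> 0" for g :: "'a \<Rightarrow> 'b" and t c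
  proof -
    assume g: "integrable lborel g"
    then have [measurable]: "g \<in> borel_measurable borel" by auto
    have T [measurable]: "(\<lambda>x::'a. t + c *\<^sub>R x) \<in> borel_measurable borel" by measurable
    from g have "integrable (density (distr lborel borel (\<lambda>x. t + c *\<^sub>R x)) (\<lambda>_. ennreal (\<bar>c\<bar>^DIM('a)))) g"
      by (simp only: eq[OF that])
    then have "integrable (distr lborel borel (\<lambda>x. t + c *\<^sub>R x)) (\<lambda>x. \<bar>c\<bar>^DIM('a) *\<^sub>R g x)"
      by (subst (asm) integrable_density) auto
    then have "integrable lborel (\<lambda>x. \<bar>c\<bar>^DIM('a) *\<^sub>R g (t + c *\<^sub>R x))"
      by (subst (asm) integrable_distr_eq) auto
    then have "integrable lborel (\<lambda>x. (1 / \<bar>c\<bar>^DIM('a)) *\<^sub>R (\<bar>c\<bar>^DIM('a) *\<^sub>R g (t + c *\<^sub>R x)))"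
      by (rule integrable_scaleR_right)
    then show "integrable lborel (\<lambda>x. g (t + c *\<^sub>R x))"
      using that by simp
  qed
  show "integrable lborel f \<Longrightarrow> integrable lborel (\<lambda>x. f (t + c *\<^sub>R x))" by (rule I[OF c])
  show *: "integrable lborel (\<lambda>x. f (t + c *\<^sub>R x)) \<longleftrightarrow> integrable lborel f"
  proof
    assume "integrable lborel (\<lambda>x. f (t + c *\<^sub>R x))"
    from I[OF _ this, of "1/c" "- (1/c) *\<^sub>R t"] show "integrable lborel f"
      using c by (simp add: algebra_simps)
  qed (rule I[OF c])
  show "(LINT x|lborel. f x) = \<bar>c\<bar> ^ DIM('a) *\<^sub>R (LINT x|lborel. f (t + c *\<^sub>R x))"
  proof (cases "integrable lborel f")
    case True
    then have [measurable]: "f \<in> borel_measurable borel" by auto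
    have "(LINT x|lborel. f x) = (LINT x|density (distr lborel borel (\<lambda>x. t + c *\<^sub>R x)) (\<lambda>_. ennreal (\<bar>c\<bar>^DIM('a))). f x)"
      by (simp only: eq[OF c])
    also have "\<dots> = (LINT x|distr lborel borel (\<lambda>x. t + c *\<^sub>R x). \<bar>c\<bar>^DIM('a) *\<^sub>R f x)"
      by (subst integral_density) auto
    also have "\<dots> = \<bar>c\<bar> ^ DIM('a) *\<^sub>R (LINT x|lborel. f (t + c *\<^sub>R x))"
      by (subst integral_distr) auto
    finally show ?thesis .
  next
    case False
    \<comment> \<open>Neither side is integrable in this case, and both integrals are 0 by
      convention.\<close>
    then show ?thesis using * by (simp add: not_integrable_integral_eq)
  qed
qed

lemma lborel_integral_reflect:
  fixes f :: "'a::euclidean_space \<Rightarrow> 'b::{banach, second_countable_topology}"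
  shows "(LINT x|lborel. f (z - x)) = (LINT x|lborel. f x)"
  using lborel_integral_affine[of "-1" f z] by simp

lemma lborel_integrable_reflect:
  fixes f :: "'a::euclidean_space \<Rightarrow> 'b::{banach, second_countable_topology}"
  shows "integrable lborel (\<lambda>x. f (z - x)) \<longleftrightarrow> integrable lborel f"
  using lborel_integrable_affine_iff[of "-1" f z] by simp

text \<open>Compact support phrased as vanishing outside a ball, which passes to products and
  partial derivatives without closures.\<close>

definition bsupp :: "('a::real_normed_vector \<Rightarrow> 'b::zero) \<Rightarrow> bool" where
  "bsupp u \<longleftrightarrow> (\<exists>R. \<forall>x. norm x > R \<longrightarrow> u x = 0)"

lemma bsuppI: "(\<And>x. norm x > R \<Longrightarrow> u x = 0) \<Longrightarrow> bsupp u"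
  unfolding bsupp_def by blast

lemma bsuppE:
  assumes "bsupp u" obtains R where "R > 0" "\<And>x. norm x > R \<Longrightarrow> u x = 0"
proof -
  obtain R where "\<And>x. norm x > R \<Longrightarrow> u x = 0" using assms unfolding bsupp_def by blast
  then show ?thesis using that[of "max R 1"] by auto
qed

lemma bsupp_pd: "bsupp u \<Longrightarrow> bsupp (pd b u)"
  unfolding bsupp_def using pd_eq_0_outside by blast

text \<open>The Borel version of \<open>locally_integrable\<close>: integrability is with respect to
  \<open>lborel\<close>, so that Borel measurability follows.\<close>

definition loc_int :: "('a::euclidean_space \<Rightarrow> real) \<Rightarrow> bool" where
  "loc_int m \<longleftrightarrow> (\<forall>R. integrable lborel (\<lambda>w. indicator (cball 0 R) w * m w))"

lemma loc_int_measurable: "loc_int m \<Longrightarrow> m \<in> borel_measurable borel"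
proof -
  assume m: "loc_int m"
  have "(\<lambda>w. indicator (cball 0 (real n)) w * m w) \<in> borel_measurable borel" for n
    using m unfolding loc_int_def by (metis borel_measurable_integrable measurable_lborel2 measurable_lborel1)
  moreover have "(\<lambda>n. indicator (cball 0 (real n)) w * m w) \<longlonglongrightarrow> m w" for w
  proof (rule tendsto_eventually)
    have "\<forall>\<^sub>F n in sequentially. real n \<ge> norm w"
      by (rule eventually_sequentiallyI[of "nat \<lceil>norm w\<rceil>"]) linarith
    then show "\<forall>\<^sub>F n in sequentially. indicator (cball 0 (real n)) w * m w = m w"
      by (rule eventually_mono) auto
  qed
  ultimately show ?thesis by (rule borel_measurable_LIMSEQ_metric)
qed

lemma loc_int_integrable: "integrable lborel m \<Longrightarrow> loc_int m"
  unfolding loc_int_def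
  using integrable_mult_indicator[of _ lborel m] by auto

lemma loc_int_continuous:
  assumes "continuous_on UNIV m" shows "loc_int m"
  unfolding loc_int_def using borel_integrable_compact[OF compact_cball continuous_on_subset[OF assms]] by auto

lemma integrable_continuous_bsupp:
  fixes f :: "'a::euclidean_space \<Rightarrow> 'b::{banach, second_countable_topology}"
  assumes "continuous_on UNIV f" "bsupp f"
  shows "integrable lborel f"
proof -
  obtain R where R: "\<And>x. norm x > R \<Longrightarrow> f x = 0" using bsuppE[OF assms(2)] by blast
  have "integrable lborel (\<lambda>x. indicator (cball 0 R) x *\<^sub>R f x)"
    by (rule borel_integrable_compact[OF compact_cball continuous_on_subset[OF assms(1)]]) auto
  also have "(\<lambda>x. indicator (cball 0 R) x *\<^sub>R f x) = f"
    using R by (auto simp: fun_eq_iff indicator_def)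
  finally show ?thesis .
qed

lemma continuous_bounded_on_cball:
  fixes f :: "'a::euclidean_space \<Rightarrow> 'b::real_normed_vector"
  assumes "continuous_on UNIV f"
  obtains C where "C > 0" "\<And>x. x \<in> cball a R \<Longrightarrow> norm (f x) \<le> C"
proof -
  have "bounded (f ` cball a R)"
    by (intro compact_imp_bounded compact_continuous_image continuous_on_subset[OF assms]) auto
  then show ?thesis using that unfolding bounded_pos by blast
qed

definition conv :: "('a::euclidean_space \<Rightarrow> 'b::euclidean_space) \<Rightarrow> ('a \<Rightarrow> real) \<Rightarrow> 'a \<Rightarrow> 'b" where
  "conv K m z = (LINT w|lborel. m w *\<^sub>R K (z - w))"

lemma conv_alt: "conv K m z = (LINT w|lborel. m (z - w) *\<^sub>R K w)"
  unfolding conv_def using lborel_integral_reflect[of "\<lambda>w. m w *\<^sub>R K (z - w)" z] by simp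

lemma conv_integrable_base:
  fixes K :: "'a::euclidean_space \<Rightarrow> 'b::euclidean_space"
  assumes m: "integrable lborel m" and R: "\<And>w. norm w > R \<Longrightarrow> m w = 0" and K: "continuous_on UNIV K"
  shows "integrable lborel (\<lambda>w. m w *\<^sub>R K (z - w))"
proof -
  obtain C where C: "C > 0" "\<And>x. x \<in> cball z R \<Longrightarrow> norm (K x) \<le> C"
    using continuous_bounded_on_cball[OF K] by blast
  have [measurable]: "K \<in> borel_measurable borel" "m \<in> borel_measurable borel"
    using K m by (auto intro: borel_measurable_continuous_onI)
  show ?thesis
  proof (rule Bochner_Integration.integrable_bound)
    show "integrable lborel (\<lambda>w. C * m w)" using m by auto
    have "norm (m w *\<^sub>R K (z - w)) \<le> norm (C * m w)" for w
    proof (cases "norm w > R")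
      case False
      then have "norm (K (z - w)) \<le> C" by (intro C) (simp add: dist_norm)
      then have "\<bar>m w\<bar> * norm (K (z - w)) \<le> \<bar>m w\<bar> * C" by (rule mult_left_mono) auto
      then show ?thesis using C(1) by (simp add: abs_mult mult.commute)
    qed (simp add: R)
    then show "AE w in lborel. norm (m w *\<^sub>R K (z - w)) \<le> norm (C * m w)" by simp
  qed measurable
qed

text \<open>Differentiation under the integral. The points \<open>z - w\<close> with
  \<open>w\<close> in the support of \<open>m\<close> stay in a compact set, where the partial
  derivatives of \<open>K\<close> are uniformly continuous; hence the linearization error of
  \<open>K\<close> is uniform in \<open>w\<close>.\<close>

lemma conv_has_derivative_base:
  fixes K :: "'a::euclidean_space \<Rightarrow> 'b::euclidean_space"
  assumes m: "integrable lborel m" and R: "\<And>w. norm w > R \<Longrightarrow> m w = 0" and K: "Ckv (Suc 0) K"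
  shows "(conv K m has_derivative (\<lambda>h. \<Sum>b\<in>Basis. (h \<bullet> b) *\<^sub>R conv (pd b K) m z)) (at z)"
  unfolding has_derivative_at_alt
proof (intro conjI allI impI)
  show "bounded_linear (\<lambda>h. \<Sum>b\<in>Basis. (h \<bullet> b) *\<^sub>R conv (pd b K) m z)"
    by (intro bounded_linear_sum bounded_linear_scaleR_const bounded_linear_inner_left)
next
  fix e :: real assume e: "e > 0"
  define M where "M = (LINT w|lborel. \<bar>m w\<bar>)"
  have M: "M \<ge> 0" unfolding M_def by simp
  \<comment> \<open>The error is at most \<open>DIM('a) * e'\<close> per unit of mass and of
    displacement, and the total mass is \<open>M\<close>; using \<open>M + 1\<close> avoids a
    division by 0.\<close>
  define e' where "e' = e / (M + 1) / DIM('a)"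
  have e': "e' > 0" "M * (DIM('a) * e') \<le> e"
  proof -
    show "e' > 0" using e M by (simp add: e'_def)
    have "M * (DIM('a) * e') = e * (M / (M + 1))" by (simp add: e'_def)
    also have "\<dots> \<le> e * 1" using M e by (intro mult_left_mono) auto
    finally show "M * (DIM('a) * e') \<le> e" by simp
  qed
  have KC: "continuous_on UNIV K" and pdC: "continuous_on UNIV (pd b K)" if "b \<in> Basis" for b
    using K Ckv_imp_continuous that by (blast, auto)
  have KC: "continuous_on UNIV K" using K Ckv_imp_continuous by blast
  define f' where "f' x h = (\<Sum>b\<in>Basis. (h \<bullet> b) *\<^sub>R pd b K x)" for x h
  have der: "(K has_derivative f' x) (at x)" for x
    unfolding f'_def[abs_def] by (rule Ckv_Suc_has_derivative[OF K])
  \<comment> \<open>Contains every \<open>z - w\<close> with \<open>w\<close> in the ball of radius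
    \<open>R\<close>, together with its neighbourhood of radius 1, since \<delta> is at most 1; the
    absolute value covers a negative \<open>R\<close>.\<close>
  let ?B = "cball (0::'a) (norm z + \<bar>R\<bar> + 1)"
  have "\<exists>d>0. \<forall>x\<in>?B. \<forall>y\<in>?B. dist y x < d \<longrightarrow> dist (pd b K y) (pd b K x) < e'" if "b \<in> Basis" for b
    using compact_uniformly_continuous[OF continuous_on_subset[OF pdC[OF that]], of ?B] e'
    unfolding uniformly_continuous_on_def by auto
  then obtain d where d: "\<And>b. b \<in> Basis \<Longrightarrow> d b > 0"
    "\<And>b x y. b \<in> Basis \<Longrightarrow> x \<in> ?B \<Longrightarrow> y \<in> ?B \<Longrightarrow> dist y x < d b \<Longrightarrow> dist (pd b K y) (pd b K x) < e'"
    by metis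
  define \<delta> where "\<delta> = min 1 (Min (d ` Basis))"
  have \<delta>: "\<delta> > 0" "\<delta> \<le> 1" "\<And>b. b \<in> Basis \<Longrightarrow> \<delta> \<le> d b"
    using d(1) by (auto simp: \<delta>_def intro: min.coboundedI2)
  have main: "norm (conv K m y - conv K m z - (\<Sum>b\<in>Basis. ((y - z) \<bullet> b) *\<^sub>R conv (pd b K) m z)) \<le> e * norm (y - z)"
    if y: "norm (y - z) < \<delta>" for y
  proof -
    have lin: "norm (K (y - w) - K (z - w) - f' (z - w) (y - z)) \<le> norm (y - z) * (DIM('a) * e')"
      if w: "norm w \<le> R" for w
    proof -
      have "norm (K (y - w) - K (z - w) - f' (z - w) ((y - w) - (z - w))) \<le> norm ((y - w) - (z - w)) * (DIM('a) * e')"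
      proof (rule differentiable_bound_linearization[where S="ball (z - w) \<delta>"])
        fix t :: real assume t: "t \<in> {0..1}"
        have "norm (t *\<^sub>R (y - z)) \<le> norm (y - z)" using t by (simp add: mult_left_le_one_le)
        then show "(z - w) + t *\<^sub>R ((y - w) - (z - w)) \<in> ball (z - w) \<delta>"
          using y by (simp add: dist_norm)
      next
        fix x assume "x \<in> ball (z - w) \<delta>"
        then have x: "norm (x - (z - w)) < \<delta>" by (simp add: dist_norm norm_minus_commute)
        show "(K has_derivative f' x) (at x within ball (z - w) \<delta>)"
          by (rule has_derivative_at_withinI[OF der])
        have zB: "z - w \<in> ?B" using norm_triangle_ineq4[of z w] w by simp
        have xB: "x \<in> ?B"
          using norm_triangle_ineq[of "x - (z - w)" "z - w"] norm_triangle_ineq4[of z w] w x \<delta> by simp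
        show "onorm (f' x - f' (z - w)) \<le> DIM('a) * e'"
        proof (rule onorm_bound)
          fix h :: 'a
          have "norm ((f' x - f' (z - w)) h) = norm (\<Sum>b\<in>Basis. (h \<bullet> b) *\<^sub>R (pd b K x - pd b K (z - w)))"
            by (simp add: f'_def sum_subtractf scaleR_diff_right)
          also have "\<dots> \<le> (\<Sum>b\<in>(Basis::'a set). norm h * e')"
          proof (rule sum_norm_le)
            fix b :: 'a assume b: "b \<in> Basis"
            have "norm (pd b K x - pd b K (z - w)) \<le> e'"
              using d(2)[OF b zB xB] x \<delta>(3)[OF b] by (simp add: dist_norm)
            then show "norm ((h \<bullet> b) *\<^sub>R (pd b K x - pd b K (z - w))) \<le> norm h * e'"
              by (simp add: mult_mono Basis_le_norm[OF b])
          qed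
          also have "\<dots> = DIM('a) * e' * norm h" by simp
          finally show "norm ((f' x - f' (z - w)) h) \<le> DIM('a) * e' * norm h" .
        qed (use e' in simp)
      qed (use \<delta> in simp)
      then show ?thesis by simp
    qed
    have int1: "integrable lborel (\<lambda>w. m w *\<^sub>R K (y - w))" for y
      by (rule conv_integrable_base[OF m R KC])
    have int2: "integrable lborel (\<lambda>w. m w *\<^sub>R pd b K (z - w))" if "b \<in> Basis" for b
      by (rule conv_integrable_base[OF m R pdC[OF that]])
    have f'eq: "m w *\<^sub>R f' (z - w) (y - z) = (\<Sum>b\<in>Basis. ((y - z) \<bullet> b) *\<^sub>R (m w *\<^sub>R pd b K (z - w)))" for w
      unfolding f'_def scaleR_sum_right by (intro sum.cong refl scaleR_left_commute)
    have int3: "integrable lborel (\<lambda>w. m w *\<^sub>R f' (z - w) (y - z))"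
      unfolding f'eq using int2 by (intro Bochner_Integration.integrable_sum integrable_scaleR_right)
    have "(LINT w|lborel. m w *\<^sub>R f' (z - w) (y - z)) = (\<Sum>b\<in>Basis. (LINT w|lborel. ((y - z) \<bullet> b) *\<^sub>R (m w *\<^sub>R pd b K (z - w))))"
      unfolding f'eq by (rule Bochner_Integration.integral_sum) (intro integrable_scaleR_right int2)
    then have "(\<Sum>b\<in>Basis. ((y - z) \<bullet> b) *\<^sub>R conv (pd b K) m z) = (LINT w|lborel. m w *\<^sub>R f' (z - w) (y - z))"
      unfolding conv_def by (simp only: integral_scaleR_right)
    then have "conv K m y - conv K m z - (\<Sum>b\<in>Basis. ((y - z) \<bullet> b) *\<^sub>R conv (pd b K) m z)
       = (LINT w|lborel. m w *\<^sub>R (K (y - w) - K (z - w) - f' (z - w) (y - z)))"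
      using int1 int3 by (simp add: conv_def scaleR_diff_right)
    also have "norm \<dots> \<le> (LINT w|lborel. norm (m w *\<^sub>R (K (y - w) - K (z - w) - f' (z - w) (y - z))))"
      by (rule integral_norm_bound)
    also have "\<dots> \<le> (LINT w|lborel. \<bar>m w\<bar> * (norm (y - z) * (DIM('a) * e')))"
    proof (rule integral_mono)
      show "integrable lborel (\<lambda>w. norm (m w *\<^sub>R (K (y - w) - K (z - w) - f' (z - w) (y - z))))"
        using int1 int3 by (simp add: scaleR_diff_right)
      show "integrable lborel (\<lambda>w. \<bar>m w\<bar> * (norm (y - z) * (DIM('a) * e')))" using m by auto
      show "norm (m w *\<^sub>R (K (y - w) - K (z - w) - f' (z - w) (y - z))) \<le> \<bar>m w\<bar> * (norm (y - z) * (DIM('a) * e'))" for w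
      proof (cases "norm w \<le> R")
        case True
        then show ?thesis using mult_left_mono[OF lin[OF True], of "\<bar>m w\<bar>"] by simp
      qed (simp add: R)
    qed
    also have "\<dots> = M * (DIM('a) * e') * norm (y - z)" using m by (simp add: M_def)
    also have "\<dots> \<le> e * norm (y - z)" using e' by (intro mult_right_mono) auto
    finally show ?thesis .
  qed
  show "\<exists>d>0. \<forall>y. norm (y - z) < d \<longrightarrow> norm (conv K m y - conv K m z - (\<Sum>b\<in>Basis. ((y - z) \<bullet> b) *\<^sub>R conv (pd b K) m z)) \<le> e * norm (y - z)"
    using \<delta>(1) main by blast
qed

lemma conv_continuous_base:
  fixes K :: "'a::euclidean_space \<Rightarrow> 'b::euclidean_space"
  assumes m: "integrable lborel m" and R: "\<And>w. norm w > R \<Longrightarrow> m w = 0" and K: "continuous_on UNIV K"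
  shows "isCont (conv K m) z"
  unfolding continuous_at_sequentially comp_def
proof (intro allI impI)
  fix x assume x: "x \<longlonglongrightarrow> z"
  then have "bounded (range x)" by (rule convergent_imp_bounded)
  then obtain B where B: "\<And>n. norm (x n) \<le> B" unfolding bounded_iff by auto
  obtain C where C: "C > 0" "\<And>x. x \<in> cball 0 (B + R) \<Longrightarrow> norm (K x) \<le> C"
    using continuous_bounded_on_cball[OF K] by blast
  have [measurable]: "K \<in> borel_measurable borel" "m \<in> borel_measurable borel"
    using K m by (auto intro: borel_measurable_continuous_onI)
  show "(\<lambda>n. conv K m (x n)) \<longlonglongrightarrow> conv K m z"
    unfolding conv_def
  proof (rule integral_dominated_convergence)
    show "integrable lborel (\<lambda>w. C * \<bar>m w\<bar>)" using m by auto
    show "AE w in lborel. (\<lambda>n. m w *\<^sub>R K (x n - w)) \<longlonglongrightarrow> m w *\<^sub>R K (z - w)"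
      by (intro AE_I2 tendsto_intros continuous_on_tendsto_compose[OF K] x) auto
    have "norm (m w *\<^sub>R K (x n - w)) \<le> C * \<bar>m w\<bar>" for w n
    proof (cases "norm w > R")
      case False
      then have "norm (K (x n - w)) \<le> C" using norm_triangle_ineq4[of "x n" w] B[of n] by (intro C) simp
      then have "\<bar>m w\<bar> * norm (K (x n - w)) \<le> \<bar>m w\<bar> * C" by (rule mult_left_mono) auto
      then show ?thesis using C(1) by (simp add: abs_mult mult.commute)
    qed (simp add: R)
    then show "AE w in lborel. norm (m w *\<^sub>R K (x n - w)) \<le> C * \<bar>m w\<bar>" for n by simp
  qed measurable
qed

text \<open>Continuity and differentiability are local in \<open>z\<close>. If the kernel has
  bounded support, then near \<open>z0\<close> only the part of \<open>m\<close> in a fixed ball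
  enters, and the same truncation serves \<open>K\<close> and its partial derivatives; so
  \<open>m\<close> may be taken integrable with bounded support.\<close>

lemma conv_local_base:
  fixes K :: "'a::euclidean_space \<Rightarrow> 'b::euclidean_space" and z0 :: 'a
  assumes "loc_int m" "bsupp m \<or> bsupp K"
  obtains m' R where "integrable lborel m'" "\<And>w. norm w > R \<Longrightarrow> m' w = 0"
    "\<And>z. norm (z - z0) < 1 \<Longrightarrow> conv K m z = conv K m' z"
    "\<And>b z. norm (z - z0) < 1 \<Longrightarrow> conv (pd b K) m z = conv (pd b K) m' z"
proof (cases "bsupp m")
  case True
  then obtain R where R: "\<And>w. norm w > R \<Longrightarrow> m w = 0" using bsuppE by blast
  then have "(\<lambda>w. indicator (cball 0 R) w * m w) = m" by (auto simp: indicator_def fun_eq_iff)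
  then have "integrable lborel m" using assms(1) unfolding loc_int_def by metis
  then show ?thesis using that[of m R] R by auto
next
  case False
  then have K: "bsupp K" using assms by blast
  obtain R0 where R0: "R0 > 0" "\<And>x. norm x > R0 \<Longrightarrow> K x = 0" using bsuppE[OF K] by blast
  define R where "R = R0 + norm z0 + 1"
  let ?m = "\<lambda>w. indicator (cball 0 R) w * m w"
  have eq: "conv L m z = conv L ?m z" if z: "norm (z - z0) < 1" and L: "\<And>x. norm x > R0 \<Longrightarrow> L x = 0" for L :: "'a \<Rightarrow> 'c::euclidean_space" and z
  proof -
    have "L (z - w) = 0" if "w \<notin> cball 0 R" for w
    proof (rule L)
      have "norm w \<le> norm (z - w) + norm (z - z0) + norm z0"
        using norm_triangle_ineq4[of z "z - w"] norm_triangle_ineq[of "z - z0" z0] by simp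
      with that z show "norm (z - w) > R0" by (simp add: R_def)
    qed
    then show ?thesis
      unfolding conv_def by (intro Bochner_Integration.integral_cong) (auto split: split_indicator)
  qed
  show ?thesis
  proof (rule that)
    show "integrable lborel ?m" using assms(1) unfolding loc_int_def by blast
    show "norm w > R \<Longrightarrow> ?m w = 0" for w by simp
    show "conv K m z = conv K ?m z" if "norm (z - z0) < 1" for z by (rule eq[OF that R0(2)])
    show "conv (pd b K) m z = conv (pd b K) ?m z" if "norm (z - z0) < 1" for z b
      by (rule eq[OF that pd_eq_0_outside[OF R0(2)]])
  qed
qed

lemma conv_continuous:
  fixes K :: "'a::euclidean_space \<Rightarrow> 'b::euclidean_space"
  assumes "loc_int m" "bsupp m \<or> bsupp K" "continuous_on UNIV K"
  shows "continuous_on UNIV (conv K m)"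
proof (rule continuous_at_imp_continuous_on, rule ballI)
  fix z0
  obtain m' R where m': "integrable lborel m'" "\<And>w. norm w > R \<Longrightarrow> m' w = 0"
    "\<And>z. norm (z - z0) < 1 \<Longrightarrow> conv K m z = conv K m' z"
    by (rule conv_local_base[OF assms(1,2)]) blast
  have "eventually (\<lambda>z. conv K m z = conv K m' z) (nhds z0)"
    unfolding eventually_nhds by (rule exI[of _ "ball z0 1"]) (auto simp: dist_norm norm_minus_commute m'(3))
  then show "isCont (conv K m) z0"
    using conv_continuous_base[OF m'(1,2) assms(3)] isCont_cong by blast
qed

lemma conv_has_derivative:
  fixes K :: "'a::euclidean_space \<Rightarrow> 'b::euclidean_space" and z :: 'a
  assumes "loc_int m" "bsupp m \<or> bsupp K" "Ckv (Suc 0) K"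
  shows "(conv K m has_derivative (\<lambda>h. \<Sum>b\<in>Basis. (h \<bullet> b) *\<^sub>R conv (pd b K) m z)) (at z)"
proof -
  obtain m' R where m': "integrable lborel m'" "\<And>w. norm w > R \<Longrightarrow> m' w = 0"
    "\<And>y. norm (y - z) < 1 \<Longrightarrow> conv K m y = conv K m' y"
    "\<And>b y. norm (y - z) < 1 \<Longrightarrow> conv (pd b K) m y = conv (pd b K) m' y"
    by (rule conv_local_base[OF assms(1,2), of z]) blast
  have "(conv K m' has_derivative (\<lambda>h. \<Sum>b\<in>Basis. (h \<bullet> b) *\<^sub>R conv (pd b K) m z)) (at z)"
    using conv_has_derivative_base[where z=z, OF m'(1,2) assms(3)] by (simp add: m'(4))
  moreover have "open (ball z 1)" "z \<in> ball z 1" by auto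
  ultimately show ?thesis
    by (rule has_derivative_transform_within_open) (auto simp: dist_norm norm_minus_commute m'(3))
qed

lemma pd_conv:
  fixes K :: "'a::euclidean_space \<Rightarrow> 'b::euclidean_space"
  assumes "loc_int m" "bsupp m \<or> bsupp K" "Ckv (Suc 0) K" "b \<in> Basis"
  shows "pd b (conv K m) = conv (pd b K) m"
proof
  fix z
  have "pd b (conv K m) z = (\<Sum>c\<in>Basis. (b \<bullet> c) *\<^sub>R conv (pd c K) m z)"
    by (rule pd_eqI[OF conv_has_derivative[OF assms(1-3)]])
  also have "\<dots> = (\<Sum>c\<in>Basis. if c = b then conv (pd c K) m z else 0)"
    using assms(4) by (intro sum.cong) (auto simp: inner_Basis)
  finally show "pd b (conv K m) z = conv (pd b K) m z" using assms(4) by simp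
qed

lemma Ckv_conv:
  fixes K :: "'a::euclidean_space \<Rightarrow> 'b::euclidean_space"
  assumes "loc_int m"
  shows "bsupp m \<or> bsupp K \<Longrightarrow> Ckv k K \<Longrightarrow> Ckv k (conv K m)"
proof (induction k arbitrary: K)
  case 0 then show ?case using conv_continuous[OF assms] by simp
next
  case (Suc k)
  have K1: "Ckv (Suc 0) K" using Suc.prems(2) by (rule Ckv_mono) simp
  show ?case
  proof (rule Ckv_SucI[OF conv_has_derivative[OF assms Suc.prems(1) K1]])
    fix b :: 'a assume "b \<in> Basis"
    show "Ckv k (\<lambda>x. \<Sum>c\<in>Basis. (b \<bullet> c) *\<^sub>R conv (pd c K) m x)"
      using Suc.prems bsupp_pd by (intro Ckv_sum Ckv_scaleR Ckv_const Suc.IH) auto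
  qed
qed

lemma smooth_conv: "loc_int m \<Longrightarrow> bsupp m \<or> bsupp K \<Longrightarrow> smooth K \<Longrightarrow> smooth (conv K m)"
  unfolding smooth_def using Ckv_conv by blast

text \<open>Convolution of \<open>F\<close> with the constant 1 is a constant function, and its
  derivative, which is 0, is the convolution of \<open>pd b F\<close> with 1.\<close>

lemma integral_pd_eq_0:
  fixes F :: "'a::euclidean_space \<Rightarrow> 'b::euclidean_space"
  assumes F: "Ckv (Suc 0) F" "bsupp F" and b: "b \<in> Basis"
  shows "(LINT x|lborel. pd b F x) = 0"
proof -
  have L: "loc_int (\<lambda>_::'a. 1)" by (rule loc_int_continuous) simp
  have "conv F (\<lambda>_. 1) = (\<lambda>_. LINT x|lborel. F x)"
    by (auto simp: conv_def lborel_integral_reflect)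
  then have "conv (pd b F) (\<lambda>_. 1) 0 = 0"
    unfolding pd_conv[OF L disjI2[OF F(2)] F(1) b, symmetric] by (simp add: pd_def)
  then have "(LINT x|lborel. pd b F (0 - x)) = 0" unfolding conv_def by simp
  then show ?thesis unfolding lborel_integral_reflect .
qed

lemma bsupp_mult: "bsupp F \<or> bsupp G \<Longrightarrow> bsupp (\<lambda>x. F x * G x)"
  for F G :: "_ \<Rightarrow> 'b::mult_zero"
  unfolding bsupp_def by (metis mult_zero_left mult_zero_right)

lemma integral_by_parts:
  fixes F G :: "'a::euclidean_space \<Rightarrow> 'b::{euclidean_space, real_normed_algebra}"
  assumes F: "Ckv (Suc 0) F" and G: "Ckv (Suc 0) G" and s: "bsupp F \<or> bsupp G" and b: "b \<in> Basis"
  shows "(LINT x|lborel. pd b F x * G x) = - (LINT x|lborel. F x * pd b G x)"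
proof -
  have c: "continuous_on UNIV F" "continuous_on UNIV G" "continuous_on UNIV (pd b F)" "continuous_on UNIV (pd b G)"
    using F G b Ckv_imp_continuous by (blast, blast, auto)
  have i: "integrable lborel (\<lambda>x. F x * pd b G x)" "integrable lborel (\<lambda>x. pd b F x * G x)"
    using s bsupp_pd by (blast intro!: integrable_continuous_bsupp continuous_on_mult c bsupp_mult)+
  have "0 = (LINT x|lborel. pd b (\<lambda>x. F x * G x) x)"
    by (rule integral_pd_eq_0[symmetric, OF Ckv_mult[OF F G] bsupp_mult[OF s] b])
  also have "\<dots> = (LINT x|lborel. F x * pd b G x + pd b F x * G x)"
    by (simp add: pd_mult[OF F G])
  also have "\<dots> = (LINT x|lborel. F x * pd b G x) + (LINT x|lborel. pd b F x * G x)"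
    using i by simp
  finally show ?thesis by (simp add: eq_neg_iff_add_eq_0 add.commute)
qed

lemma lborel_integral_shift:
  fixes f :: "'a::euclidean_space \<Rightarrow> 'b::{banach, second_countable_topology}"
  shows "(LINT x|lborel. f (x - w)) = (LINT x|lborel. f x)"
  using lborel_integral_affine[of 1 f "- w"] by simp

lemma lborel_integrable_shift:
  fixes f :: "'a::euclidean_space \<Rightarrow> 'b::{banach, second_countable_topology}"
  shows "integrable lborel (\<lambda>x. f (x - w)) \<longleftrightarrow> integrable lborel f"
  using lborel_integrable_affine_iff[of 1 f "- w"] by simp

section \<open>Convolutions of integrable functions\<close>

context
  fixes K m :: "'a::euclidean_space \<Rightarrow> real"
  assumes K: "integrable lborel K" and m: "integrable lborel m"
begin

lemma conv_pair_integrable: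
  "integrable (lborel \<Otimes>\<^sub>M lborel) (\<lambda>(w, z). m w * K (z - w))"
proof (rule lborel_pair.Fubini_integrable)
  have [measurable]: "K \<in> borel_measurable borel" "m \<in> borel_measurable borel" using K m by auto
  show "(\<lambda>(w, z). m w * K (z - w)) \<in> borel_measurable (lborel \<Otimes>\<^sub>M lborel)" by measurable
  have "(LINT z|lborel. norm (case (w, z) of (w, z) \<Rightarrow> m w * K (z - w))) = \<bar>m w\<bar> * (LINT z|lborel. \<bar>K z\<bar>)" for w
    using lborel_integral_shift[of "\<lambda>z. \<bar>K z\<bar>" w] by (simp add: abs_mult)
  then show "integrable lborel (\<lambda>w. LINT z|lborel. norm (case (w, z) of (w, z) \<Rightarrow> m w * K (z - w)))"
    using m by simp
  show "AE w in lborel. integrable lborel (\<lambda>z. case (w, z) of (w, z) \<Rightarrow> m w * K (z - w))"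
    using K by (simp add: lborel_integrable_shift)
qed

lemma conv_AE_integrable: "AE z in lborel. integrable lborel (\<lambda>w. m w * K (z - w))"
  using lborel_pair.AE_integrable_snd[OF conv_pair_integrable] by simp

lemma conv_integrable: "integrable lborel (conv K m)"
  using lborel_pair.integrable_snd[OF conv_pair_integrable] by (simp add: conv_def[abs_def])

lemma conv_Fubini:
  assumes [measurable]: "k \<in> borel_measurable borel" and k: "\<And>z. \<bar>k z\<bar> \<le> C"
  shows "(LINT z|lborel. k z * conv K m z) = (LINT w|lborel. m w * (LINT z|lborel. k z * K (z - w)))"
proof -
  have [measurable]: "K \<in> borel_measurable borel" "m \<in> borel_measurable borel" using K m by auto
  have "integrable (lborel \<Otimes>\<^sub>M lborel) (\<lambda>(w, z). k z * (m w * K (z - w)))"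
  proof (rule Bochner_Integration.integrable_bound)
    show "integrable (lborel \<Otimes>\<^sub>M lborel) (\<lambda>x. C * (case x of (w, z) \<Rightarrow> m w * K (z - w)))"
      by (intro integrable_mult_right conv_pair_integrable)
    show "AE x in lborel \<Otimes>\<^sub>M lborel. norm (case x of (w, z) \<Rightarrow> k z * (m w * K (z - w))) \<le> norm (C * (case x of (w, z) \<Rightarrow> m w * K (z - w)))"
      using order_trans[OF k abs_ge_self] by (auto intro!: AE_I2 simp: abs_mult mult_right_mono)
  qed measurable
  from lborel_pair.Fubini_integral[OF this]
  have "(LINT z|lborel. LINT w|lborel. k z * (m w * K (z - w))) = (LINT w|lborel. LINT z|lborel. k z * (m w * K (z - w)))" .
  moreover have "(LINT z|lborel. k z * conv K m z) = (LINT z|lborel. LINT w|lborel. k z * (m w * K (z - w)))"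
    by (simp add: conv_def)
  moreover have "(LINT w|lborel. LINT z|lborel. k z * (m w * K (z - w))) = (LINT w|lborel. m w * (LINT z|lborel. k z * K (z - w)))"
    by (intro Bochner_Integration.integral_cong refl) (subst mult.left_commute, simp)
  ultimately show ?thesis by simp
qed

lemma conv_total_mass: "(LINT z|lborel. conv K m z) = (LINT w|lborel. m w) * (LINT z|lborel. K z)"
  using conv_Fubini[of "\<lambda>_. 1" 1] by (simp add: lborel_integral_shift)

end

lemma conv_L1_bound:
  fixes K m :: "'a::euclidean_space \<Rightarrow> real"
  assumes K: "integrable lborel K" and m: "integrable lborel m"
  shows "(LINT z|lborel. \<bar>conv K m z\<bar>) \<le> (LINT w|lborel. \<bar>m w\<bar>) * (LINT z|lborel. \<bar>K z\<bar>)"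
proof -
  have a: "integrable lborel (\<lambda>z. \<bar>K z\<bar>)" "integrable lborel (\<lambda>z. \<bar>m z\<bar>)" using assms by auto
  have "(LINT z|lborel. \<bar>conv K m z\<bar>) \<le> (LINT z|lborel. conv (\<lambda>z. \<bar>K z\<bar>) (\<lambda>z. \<bar>m z\<bar>) z)"
  proof (rule integral_mono)
    show "\<bar>conv K m z\<bar> \<le> conv (\<lambda>z. \<bar>K z\<bar>) (\<lambda>z. \<bar>m z\<bar>) z" for z
      unfolding conv_def using integral_norm_bound[of lborel "\<lambda>w. m w * K (z - w)"] by (simp add: abs_mult)
  qed (use conv_integrable[OF assms] conv_integrable[OF a] in auto)
  then show ?thesis using conv_total_mass[OF a] by simp
qed

text \<open>The regularized kernels converge in L1, and Young's inequality
  \<open>conv_L1_bound\<close> carries this to the convolutions. Testing against a bounded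
  \<open>k\<close> is the form needed for integrals over boxes.\<close>

lemma conv_L1_limit:
  fixes K :: "'a::euclidean_space \<Rightarrow> real"
  assumes K: "\<And>n. integrable lborel (Ks n)" "integrable lborel K" and m: "integrable lborel m"
    and lim: "(\<lambda>n. LINT z|lborel. \<bar>Ks n z - K z\<bar>) \<longlonglongrightarrow> 0" and k: "k \<in> borel_measurable borel" "\<And>z. \<bar>k z\<bar> \<le> 1"
  shows "(\<lambda>n. LINT z|lborel. k z * conv (Ks n) m z) \<longlonglongrightarrow> (LINT z|lborel. k z * conv K m z)"
proof -
  have ki: "integrable lborel (\<lambda>z. k z * F z)" if "integrable lborel F" for F
  proof (rule Bochner_Integration.integrable_bound[OF that])
    show "(\<lambda>z. k z * F z) \<in> borel_measurable lborel" using k(1) that by measurable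
    show "AE z in lborel. norm (k z * F z) \<le> norm (F z)"
      using k(2) by (intro AE_I2) (simp add: abs_mult mult_left_le_one_le)
  qed
  have D: "integrable lborel (\<lambda>z. Ks n z - K z)" for n using K by auto
  have "norm ((LINT z|lborel. k z * conv (Ks n) m z) - (LINT z|lborel. k z * conv K m z))
      \<le> (LINT w|lborel. \<bar>m w\<bar>) * (LINT z|lborel. \<bar>Ks n z - K z\<bar>)" for n
  proof -
    have "(LINT z|lborel. k z * conv (Ks n) m z) - (LINT z|lborel. k z * conv K m z)
        = (LINT z|lborel. k z * conv (Ks n) m z - k z * conv K m z)"
      by (intro Bochner_Integration.integral_diff[symmetric] ki conv_integrable K m)
    also have "\<dots> = (LINT z|lborel. k z * conv (\<lambda>z. Ks n z - K z) m z)"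
    \<comment> \<open>Linearity in the kernel needs both integrals to exist, which is known for
      almost every \<open>z\<close> only; elsewhere a convolution may have the default value
      0.\<close>
    proof (rule integral_cong_AE)
      show "AE z in lborel. k z * conv (Ks n) m z - k z * conv K m z = k z * conv (\<lambda>z. Ks n z - K z) m z"
        using conv_AE_integrable[OF K(1)[of n] m] conv_AE_integrable[OF K(2) m]
        by eventually_elim (simp add: conv_def right_diff_distrib)
      show "(\<lambda>z. k z * conv (Ks n) m z - k z * conv K m z) \<in> borel_measurable lborel"
        by (intro borel_measurable_integrable Bochner_Integration.integrable_diff ki conv_integrable K m)
      show "(\<lambda>z. k z * conv (\<lambda>z. Ks n z - K z) m z) \<in> borel_measurable lborel"
        by (intro borel_measurable_integrable ki conv_integrable m D)
    qed
    also have "norm \<dots> \<le> (LINT z|lborel. norm (k z * conv (\<lambda>z. Ks n z - K z) m z))"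
      by (rule integral_norm_bound)
    also have "\<dots> \<le> (LINT z|lborel. \<bar>conv (\<lambda>z. Ks n z - K z) m z\<bar>)"
      using k(2) by (intro integral_mono integrable_norm ki conv_integrable m D integrable_abs)
        (simp add: abs_mult mult_left_le_one_le)
    also have "\<dots> \<le> (LINT w|lborel. \<bar>m w\<bar>) * (LINT z|lborel. \<bar>Ks n z - K z\<bar>)"
      by (rule conv_L1_bound[OF D m])
    finally show ?thesis .
  qed
  then have "(\<lambda>n. (LINT z|lborel. k z * conv (Ks n) m z) - (LINT z|lborel. k z * conv K m z)) \<longlonglongrightarrow> 0"
    by (rule Lim_null_comparison[OF always_eventually[OF allI]])
       (use tendsto_mult_right_zero[OF lim] in simp)
  then show ?thesis by (simp add: LIM_zero_iff)
qed

text \<open>On each box \<open>B n\<close> the positive and the negative part of \<open>F\<close>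
  are densities of measures that agree on boxes. Boxes are stable under intersection and generate
  the Borel sets, so the measures agree, and with them the densities almost everywhere. The
  restriction to \<open>B n\<close> keeps the measures finite on the generator.\<close>

lemma AE_zero_boxes:
  fixes F :: "'a::euclidean_space \<Rightarrow> real"
  assumes F: "loc_int F" and box0: "\<And>a b. (LINT x|lborel. indicator (box a b) x * F x) = 0"
  shows "AE x in lborel. F x = 0"
proof -
  have [measurable]: "F \<in> borel_measurable borel" by (rule loc_int_measurable[OF F])
  have Fint: "integrable lborel (\<lambda>x. indicator (box a b) x * F x)" for a b
  proof -
    obtain R where R: "box a b \<subseteq> cball 0 R"
      using bounded_box[of a b] unfolding bounded_iff by (meson mem_cball_0 subsetI)
    have "integrable lborel (\<lambda>x. indicator (box a b) x *\<^sub>R (indicator (cball 0 R) x * F x))"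
      using F unfolding loc_int_def by (intro integrable_mult_indicator) auto
    also have "(\<lambda>x. indicator (box a b) x *\<^sub>R (indicator (cball 0 R) x * F x)) = (\<lambda>x. indicator (box a b) x * F x)"
      using R by (auto simp: fun_eq_iff indicator_def)
    finally show ?thesis .
  qed
  define B where "B n = box (- (real n *\<^sub>R One)) (real n *\<^sub>R One :: 'a)" for n
  have "AE x in lborel. x \<in> B n \<longrightarrow> F x = 0" for n
  proof -
    let ?p = "\<lambda>x. ennreal (F x) * indicator (B n) x" and ?q = "\<lambda>x. ennreal (- F x) * indicator (B n) x"
    have [measurable]: "B n \<in> sets borel" by (simp add: B_def)
    have em: "emeasure (density lborel ?p) (box a b) = emeasure (density lborel ?q) (box a b)
         \<and> emeasure (density lborel ?p) (box a b) \<noteq> \<infinity>" for a b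
    proof -
      obtain c d where cd: "box a b \<inter> B n = box c d" unfolding B_def box_Int_box by blast
      let ?h = "\<lambda>x. indicator (box c d) x * F x"
      have mem: "x \<in> box c d \<longleftrightarrow> x \<in> box a b \<and> x \<in> B n" for x using cd by blast
      have "?p x * indicator (box a b) x = ennreal (?h x)" "?q x * indicator (box a b) x = ennreal (- ?h x)" for x
        by (simp_all add: indicator_def mem)
      moreover have "emeasure (density lborel ?p) (box a b) = (\<integral>\<^sup>+x. ?p x * indicator (box a b) x \<partial>lborel)"
        "emeasure (density lborel ?q) (box a b) = (\<integral>\<^sup>+x. ?q x * indicator (box a b) x \<partial>lborel)"
        by (rule emeasure_density; measurable)+
      ultimately have p: "emeasure (density lborel ?p) (box a b) = (\<integral>\<^sup>+x. ennreal (?h x) \<partial>lborel)"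
        and q: "emeasure (density lborel ?q) (box a b) = (\<integral>\<^sup>+x. ennreal (- ?h x) \<partial>lborel)"
        by simp_all
      have fin: "(\<integral>\<^sup>+x. ennreal (?h x) \<partial>lborel) < \<infinity>" "(\<integral>\<^sup>+x. ennreal (- ?h x) \<partial>lborel) < \<infinity>"
        using Fint[of c d] by (simp_all only: real_integrable_def top.not_eq_extremum infinity_ennreal_def)
      have "enn2real (\<integral>\<^sup>+x. ennreal (?h x) \<partial>lborel) = enn2real (\<integral>\<^sup>+x. ennreal (- ?h x) \<partial>lborel)"
        using real_lebesgue_integral_def[OF Fint[of c d]] box0[of c d] by simp
      then have "(\<integral>\<^sup>+x. ennreal (?h x) \<partial>lborel) = (\<integral>\<^sup>+x. ennreal (- ?h x) \<partial>lborel)"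
        using fin by (metis ennreal_enn2real infinity_ennreal_def)
      then show ?thesis using p q fin by simp
    qed
    have "density lborel ?p = density lborel ?q"
    proof (rule measure_eqI_generator_eq)
      show "Int_stable (range (\<lambda>(a, b). box a b :: 'a set))"
        by (auto simp: Int_stable_def box_Int_box)
      show "sets (density lborel ?p) = sigma_sets UNIV (range (\<lambda>(a, b). box a b))"
           "sets (density lborel ?q) = sigma_sets UNIV (range (\<lambda>(a, b). box a b))"
        by (simp_all add: borel_eq_box)
      show "range B \<subseteq> range (\<lambda>(a, b). box a b)" by (auto simp: B_def)
      show "(\<Union>i. B i) = UNIV" unfolding B_def by (rule UN_box_eq_UNIV)
      show "emeasure (density lborel ?p) (B i) \<noteq> \<infinity>" for i
        using em unfolding B_def by blast
      show "emeasure (density lborel ?p) X = emeasure (density lborel ?q) X" if "X \<in> range (\<lambda>(a, b). box a b)" for X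
        using that em by auto
    qed auto
    then have "AE x in lborel. ?p x = ?q x"
      by (intro sigma_finite_measure.density_unique[OF sigma_finite_lborel]) auto
    then show ?thesis
    proof eventually_elim
      case (elim x)
      show ?case
      proof
        assume "x \<in> B n"
        \<comment> \<open>The embedding \<open>ennreal\<close> sends negative reals to 0, so one of
          the two sides is 0 and hence both are.\<close>
        then have "ennreal (F x) = ennreal (- F x)" using elim by simp
        then show "F x = 0"
          by (cases "F x \<ge> 0") (auto simp: ennreal_neg ennreal_eq_0_iff dest: sym)
      qed
    qed
  qed
  then have "AE x in lborel. \<forall>n. x \<in> B n \<longrightarrow> F x = 0" by (subst AE_all_countable) blast
  then show ?thesis
  proof eventually_elim
    case (elim x)
    have "x \<in> (\<Union>n. B n)" unfolding B_def UN_box_eq_UNIV by simp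
    then show ?case using elim by blast
  qed
qed

section \<open>The logarithmic parametrix\<close>

lemma smooth_real_inverse: "smooth_real_on {0<..} (\<lambda>x. 1 / x)"
  unfolding smooth_real_on_def
proof (intro exI conjI allI ballI)
  let ?D = "\<lambda>n x::real. (-1) ^ n * fact n / x ^ Suc n"
  show "?D 0 = (\<lambda>x. 1 / x)" by simp
  fix n and x :: real assume "x \<in> {0<..}"
  then have x: "x > 0" by simp
  have "(?D n has_real_derivative (0 * x ^ Suc n - (-1) ^ n * fact n * (real (Suc n) * x ^ n)) / (x ^ Suc n * x ^ Suc n)) (at x)"
    using x by (auto intro!: derivative_eq_intros simp del: power_Suc fact_Suc)
  moreover have "(0 * x ^ Suc n - (-1) ^ n * fact n * (real (Suc n) * x ^ n)) / (x ^ Suc n * x ^ Suc n) = ?D (Suc n) x"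
    using x by (simp add: field_simps)
  ultimately show "(?D n has_real_derivative ?D (Suc n) x) (at x)" by simp
qed

lemma smooth_real_onI_deriv:
  assumes "\<And>x. x \<in> S \<Longrightarrow> (h has_real_derivative h' x) (at x)" "smooth_real_on S h'"
  shows "smooth_real_on S h"
proof -
  obtain D where D: "D 0 = h'" "\<And>n x. x \<in> S \<Longrightarrow> (D n has_real_derivative D (Suc n) x) (at x)"
    using assms(2) unfolding smooth_real_on_def by blast
  have "(case_nat h D n has_real_derivative case_nat h D (Suc n) x) (at x)" if "x \<in> S" for n x
    using assms(1) D that by (cases n) auto
  then show ?thesis unfolding smooth_real_on_def by (intro exI[of _ "case_nat h D"]) auto
qed

lemma smooth_real_ln: "smooth_real_on {0<..} ln"
  by (rule smooth_real_onI_deriv[OF _ smooth_real_inverse]) (auto intro!: derivative_eq_intros)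

lemma smooth_real_exp: "smooth_real_on S (\<lambda>x. exp (c * x))"
  unfolding smooth_real_on_def
  by (rule exI[of _ "\<lambda>n x. c ^ n * exp (c * x)"]) (auto intro!: derivative_eq_intros)

text \<open>\<open>Phi 0\<close> is the truncated fundamental solution of the Laplacian and \<open>Phi s\<close> its regularization: the Laplacian
  of \<open>Phi s\<close> is the sum of \<open>cutoff * eta s\<close>, an approximate identity as \<open>s \<rightarrow> 0\<close>, and of \<open>kap s\<close>, which
  remains smooth in the limit.\<close>

definition elog :: "real \<Rightarrow> complex \<Rightarrow> real" where
  "elog s z = ln ((norm z)\<^sup>2 + s) / (4 * pi)"

definition Phi :: "real \<Rightarrow> complex \<Rightarrow> real" where
  "Phi s z = cutoff z * elog s z"

definition eta :: "real \<Rightarrow> complex \<Rightarrow> real" where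
  "eta s z = s / (pi * ((norm z)\<^sup>2 + s)\<^sup>2)"

text \<open>An explicit formula rather than \<open>pd b (Phi s)\<close>, so that it is also
  available for \<open>s = 0\<close>, where \<open>Phi 0\<close> has a singularity at the
  origin.\<close>

definition dPhi :: "complex \<Rightarrow> real \<Rightarrow> complex \<Rightarrow> real" where
  "dPhi b s z = pd b cutoff z * elog s z + cutoff z * ((z \<bullet> b) / (2 * pi * ((norm z)\<^sup>2 + s)))"

definition kap :: "real \<Rightarrow> complex \<Rightarrow> real" where
  "kap s z = (\<Sum>b\<in>Basis. pd b cutoff z * ((z \<bullet> b) / (pi * ((norm z)\<^sup>2 + s))) + pd b (pd b cutoff) z * elog s z)"

lemma norm_sq_add_pos: "s > 0 \<Longrightarrow> (norm z)\<^sup>2 + s > 0"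
  by (simp add: add_nonneg_pos)

lemma pd_norm_sq: "pd b (\<lambda>z::'a::euclidean_space. (norm z)\<^sup>2 + s) z = 2 * (z \<bullet> b)"
proof -
  have "((\<lambda>z::'a. z \<bullet> z + s) has_derivative (\<lambda>h. 2 * (z \<bullet> h))) (at z)"
    by (auto intro!: derivative_eq_intros simp: inner_commute)
  then show ?thesis unfolding power2_norm_eq_inner by (rule pd_eqI)
qed

lemma pd_inner: "pd b (\<lambda>z::'a::euclidean_space. z \<bullet> c) z = b \<bullet> c"
  by (rule pd_eqI) (auto intro!: derivative_eq_intros)

lemma smooth_elog:
  assumes "s > 0" shows "smooth (elog s)"
proof -
  have "smooth (\<lambda>z::complex. ln ((norm z)\<^sup>2 + s))"
    by (rule smooth_compose_real[OF smooth_real_ln])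
       (use assms in \<open>auto intro!: smooth_intros norm_sq_add_pos\<close>)
  then have "smooth (\<lambda>z::complex. ln ((norm z)\<^sup>2 + s) * (1 / (4 * pi)))" by (intro smooth_intros)
  then show ?thesis by (simp add: elog_def[abs_def])
qed

lemma pd_elog:
  assumes "s > 0" shows "pd b (elog s) = (\<lambda>z. (z \<bullet> b) * (1 / (2 * pi) * (1 / ((norm z)\<^sup>2 + s))))"
proof
  fix z :: complex
  have p: "(norm z)\<^sup>2 + s > 0" using assms by (rule norm_sq_add_pos)
  have "((\<lambda>x. ln x / (4 * pi)) has_real_derivative (1 / ((norm z)\<^sup>2 + s) / (4 * pi))) (at ((norm z)\<^sup>2 + s))"
    using p by (auto intro!: derivative_eq_intros)
  from pd_compose_real[where u="\<lambda>z. (norm z)\<^sup>2 + s", OF this smoothD]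
  have "pd b (elog s) z = 1 / ((norm z)\<^sup>2 + s) / (4 * pi) * (2 * (z \<bullet> b))"
    by (simp add: elog_def[abs_def] pd_norm_sq smooth_intros)
  then show "pd b (elog s) z = (z \<bullet> b) * (1 / (2 * pi) * (1 / ((norm z)\<^sup>2 + s)))" by simp
qed

lemmas pd_mult_smooth = pd_mult[OF smoothD[where k="Suc 0"] smoothD[where k="Suc 0"]]
lemmas pd_add_smooth = pd_add[OF smoothD[where k="Suc 0"] smoothD[where k="Suc 0"]]

lemma laplacian_pd: "laplacian F z = (\<Sum>b\<in>Basis. pd b (pd b F) z)"
  by (simp add: laplacian_def pd_eq_partial_deriv)

lemma laplacian_mult:
  fixes u v :: "'a::euclidean_space \<Rightarrow> real"
  assumes u: "smooth u" and v: "smooth v"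
  shows "laplacian (\<lambda>z. u z * v z) z = u z * laplacian v z + laplacian u z * v z + 2 * (\<Sum>b\<in>Basis. pd b u z * pd b v z)"
proof -
  have "pd b (pd b (\<lambda>z. u z * v z)) z = u z * pd b (pd b v) z + pd b (pd b u) z * v z + 2 * (pd b u z * pd b v z)"
    if b: "b \<in> Basis" for b
  proof -
    have s: "smooth (pd b u)" "smooth (pd b v)" using u v b by (auto intro: smooth_pd)
    have "pd b (\<lambda>z. u z * v z) = (\<lambda>z. u z * pd b v z + pd b u z * v z)"
      by (rule ext, rule pd_mult_smooth[OF u v])
    then have "pd b (pd b (\<lambda>z. u z * v z)) z = pd b (\<lambda>z. u z * pd b v z) z + pd b (\<lambda>z. pd b u z * v z) z"
      by (simp add: pd_add_smooth[of "\<lambda>z. u z * pd b v z" "\<lambda>z. pd b u z * v z"] s u v smooth_mult)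
    then show ?thesis
      by (simp add: pd_mult_smooth s u v)
  qed
  then show ?thesis
    unfolding laplacian_pd by (simp add: sum.distrib sum_distrib_left sum_distrib_right)
qed

lemma laplacian_elog:
  assumes s: "s > 0" shows "laplacian (elog s) z = eta s z"
proof -
  define q where "q = (\<lambda>z::complex. 1 / ((norm z)\<^sup>2 + s))"
  have p: "(norm z)\<^sup>2 + s > 0" for z :: complex using s by (rule norm_sq_add_pos)
  have sq: "smooth q" unfolding q_def
    by (rule smooth_compose_real[OF smooth_real_inverse]) (use p in \<open>auto intro!: smooth_intros\<close>)
  have "pd b q z = - (1 / ((norm z)\<^sup>2 + s)\<^sup>2) * (2 * (z \<bullet> b))" for b
  proof -
    have "((\<lambda>x. 1 / x) has_real_derivative - (1 / ((norm z)\<^sup>2 + s)\<^sup>2)) (at ((norm z)\<^sup>2 + s))"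
      using p[of z] by (auto intro!: derivative_eq_intros simp: power2_eq_square)
    from pd_compose_real[where u="\<lambda>z. (norm z)\<^sup>2 + s", OF this smoothD] show ?thesis
      by (simp add: q_def pd_norm_sq smooth_intros)
  qed
  moreover have "pd b (pd b (elog s)) z = (z \<bullet> b) * (1 / (2 * pi) * pd b q z) + (b \<bullet> b) * (1 / (2 * pi) * q z)" for b
  proof -
    have "pd b (elog s) = (\<lambda>z. (z \<bullet> b) * (1 / (2 * pi) * q z))" using pd_elog[OF s] by (simp add: q_def)
    moreover have "pd b (\<lambda>z. (z \<bullet> b) * (1 / (2 * pi) * q z)) z = (z \<bullet> b) * pd b (\<lambda>z. 1 / (2 * pi) * q z) z + (b \<bullet> b) * (1 / (2 * pi) * q z)"
      by (rule pd_mult_smooth[of "\<lambda>z. z \<bullet> b" "\<lambda>z. 1 / (2 * pi) * q z" b z, unfolded pd_inner]) (intro smooth_intros sq)+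
    moreover have "pd b (\<lambda>z. 1 / (2 * pi) * q z) z = 1 / (2 * pi) * pd b q z"
      by (rule pd_bounded_linear[OF bounded_linear_mult_right smoothD[OF sq, of "Suc 0"]])
    ultimately show ?thesis by simp
  qed
  ultimately have "laplacian (elog s) z = (\<Sum>b\<in>Basis. - ((z \<bullet> b)\<^sup>2 / (pi * ((norm z)\<^sup>2 + s)\<^sup>2)) + (b \<bullet> b) * (1 / (2 * pi) * q z))"
    unfolding laplacian_pd by (intro sum.cong) (simp_all add: power2_eq_square mult_ac)
  \<comment> \<open>Dimension two enters here, through the two equal terms with
    \<open>b \<bullet> b = 1\<close>.\<close>
  also have "\<dots> = - ((norm z)\<^sup>2 / (pi * ((norm z)\<^sup>2 + s)\<^sup>2)) + 1 / (pi * ((norm z)\<^sup>2 + s))"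
    by (simp add: Basis_complex_def q_def cmod_power2 add_divide_distrib)
  also have "\<dots> = eta s z"
    unfolding eta_def using p[of z] by (simp add: divide_simps power2_eq_square)
  finally show ?thesis .
qed

lemma smooth_Phi: "s > 0 \<Longrightarrow> smooth (Phi s)"
  unfolding Phi_def[abs_def] by (intro smooth_intros smooth_elog)

lemma Phi_outside: "norm z \<ge> 1 \<Longrightarrow> Phi s z = 0"
  by (simp add: Phi_def cutoff_eq_0)

lemma pd_cutoff_outside: "norm z > 1 \<Longrightarrow> pd b cutoff z = 0"
  by (rule pd_eq_0_outside[of 1]) (auto simp: cutoff_eq_0)

lemma pd_pd_cutoff_outside: "norm z > 1 \<Longrightarrow> pd b (pd b cutoff) z = 0"
  by (rule pd_eq_0_outside[of 1]) (auto simp: pd_cutoff_outside)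

lemma pd_cutoff_inside: "norm z < 1/2 \<Longrightarrow> pd b cutoff z = 0"
  by (rule pd_locally_const[of "ball 0 (1/2)" _ _ 1]) (auto simp: cutoff_eq_1)

lemma pd_pd_cutoff_inside: "norm z < 1/2 \<Longrightarrow> pd b (pd b cutoff) z = 0"
  by (rule pd_locally_const[of "ball 0 (1/2)" _ _ 0]) (auto simp: pd_cutoff_inside)

lemma pd_Phi: "s > 0 \<Longrightarrow> pd b (Phi s) z = dPhi b s z"
  unfolding Phi_def[abs_def]
  by (subst pd_mult_smooth)
     (auto intro!: smooth_intros smooth_elog simp: pd_elog dPhi_def)

lemma laplacian_Phi:
  assumes "s > 0" shows "laplacian (Phi s) z = cutoff z * eta s z + kap s z"
proof -
  have "laplacian (Phi s) z = cutoff z * eta s z + laplacian cutoff z * elog s z + 2 * (\<Sum>b\<in>Basis. pd b cutoff z * pd b (elog s) z)"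
    unfolding Phi_def[abs_def] laplacian_mult[OF smooth_cutoff smooth_elog[OF assms]] laplacian_elog[OF assms] ..
  also have "2 * (\<Sum>b\<in>Basis. pd b cutoff z * pd b (elog s) z) = (\<Sum>b\<in>Basis. pd b cutoff z * ((z \<bullet> b) / (pi * ((norm z)\<^sup>2 + s))))"
    unfolding sum_distrib_left by (intro sum.cong refl) (simp add: pd_elog[OF assms])
  finally show ?thesis
    by (simp add: kap_def laplacian_pd[of cutoff] sum.distrib sum_distrib_right)
qed

text \<open>Near the origin, where \<open>|z|\<^sup>2\<close> degenerates, the derivatives of the cutoff vanish, so that
  \<open>|z|\<^sup>2\<close> may be replaced by a positive smooth function.\<close>

lemma smooth_kap_0: "smooth (kap 0)"
proof -
  \<comment> \<open>The added bump is 1 at the origin and supported in |z| <= 1/4, so it is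
    invisible where |z| >= 1/2, the only region in which the cutoff varies.\<close>
  define den where "den z = (norm z)\<^sup>2 + cutoff (0 + 4 *\<^sub>R z)" for z :: complex
  have den_pos: "den z > 0" for z
  proof (cases "z = 0")
    case True then show ?thesis by (simp add: den_def cutoff_eq_1)
  next
    case False then show ?thesis using cutoff_nonneg[of "4 *\<^sub>R z"] by (simp add: den_def add_pos_nonneg)
  qed
  have den_eq: "den z = (norm z)\<^sup>2" if "norm z \<ge> 1/2" for z
    using that by (simp add: den_def cutoff_eq_0)
  have sden: "smooth den" unfolding den_def[abs_def] by (intro smooth_intros smooth_affine[OF smooth_cutoff])
  have s1: "smooth (\<lambda>z. 1 / den z)"
    by (rule smooth_compose_real[OF smooth_real_inverse _ sden]) (simp add: den_pos)
  have s2: "smooth (\<lambda>z. ln (den z))"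
    by (rule smooth_compose_real[OF smooth_real_ln _ sden]) (simp add: den_pos)
  have "kap 0 z = (\<Sum>b\<in>Basis. pd b cutoff z * ((z \<bullet> b) * (1 / pi) * (1 / den z)) + pd b (pd b cutoff) z * (ln (den z) * (1 / (4 * pi))))" for z
  proof (cases "norm z < 1/2")
    case True then show ?thesis by (simp add: kap_def pd_cutoff_inside pd_pd_cutoff_inside)
  next
    case False then show ?thesis by (simp add: kap_def elog_def den_eq)
  qed
  then have "kap 0 = (\<lambda>z. \<Sum>b\<in>Basis. pd b cutoff z * ((z \<bullet> b) * (1 / pi) * (1 / den z)) + pd b (pd b cutoff) z * (ln (den z) * (1 / (4 * pi))))"
    by blast
  moreover have "smooth (\<lambda>z. \<Sum>b\<in>Basis. pd b cutoff z * ((z \<bullet> b) * (1 / pi) * (1 / den z)) + pd b (pd b cutoff) z * (ln (den z) * (1 / (4 * pi))))"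
    by (intro smooth_sum smooth_add smooth_mult smooth_pd smooth_cutoff smooth_inner smooth_const smooth_ident s1 s2)
  ultimately show ?thesis by simp
qed

lemma bsupp_kap: "bsupp (kap s)"
  by (rule bsuppI[of 1]) (simp add: kap_def pd_cutoff_outside pd_pd_cutoff_outside)

lemma kap_outside: "norm z > 1 \<Longrightarrow> kap s z = 0"
  by (simp add: kap_def pd_cutoff_outside pd_pd_cutoff_outside)

section \<open>Domination of the kernels by the inverse norm\<close>

text \<open>One integrable majorant, uniform in \<open>s\<close>, for the truncated logarithm and
  for its gradient. At the origin it takes the default value 0, which is why the pointwise bounds
  exclude that point.\<close>

definition invnorm :: "complex \<Rightarrow> real" where
  "invnorm z = indicator (cball 0 1) z * (1 / norm z)"

lemma integrable_invnorm: "integrable lborel invnorm"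
proof (rule integrableI_bounded)
  show "invnorm \<in> borel_measurable lborel" unfolding invnorm_def[abs_def]
    by (intro borel_measurable_times borel_measurable_indicator) auto
  have "(\<integral>\<^sup>+z. ennreal (norm (invnorm z)) \<partial>lborel) = (\<integral>\<^sup>+(z::complex). ennreal (1 / norm z) * indicator (cball 0 1) z \<partial>lborel)"
    by (auto intro!: nn_integral_cong simp: invnorm_def split: split_indicator)
  then show "(\<integral>\<^sup>+z. ennreal (norm (invnorm z)) \<partial>lborel) < \<infinity>"
    using nn_integral_inverse_norm[of 1] by simp
qed

text \<open>Both directions come from \<open>ln x <= x - 1\<close>: applied directly for the upper
  bound, and applied to \<open>1 / norm z\<close>, after dropping \<open>s\<close>, for the lower
  one.\<close>

lemma elog_bound:
  assumes "0 \<le> s" "s \<le> 1" "z \<noteq> 0" "norm z \<le> 1" shows "\<bar>elog s z\<bar> \<le> 1 / norm z"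
proof -
  let ?r = "norm z"
  have r: "?r > 0" using assms by simp
  have "?r\<^sup>2 \<le> 1" using assms by (simp add: power_le_one)
  have "ln (?r\<^sup>2 + s) \<le> (?r\<^sup>2 + s) - 1"
    using r assms by (intro ln_le_minus_one) (simp add: add_pos_nonneg)
  also have "\<dots> \<le> 1" using \<open>?r\<^sup>2 \<le> 1\<close> assms by simp
  also have "1 \<le> 2 / ?r" using assms r by (simp add: field_simps)
  finally have up: "ln (?r\<^sup>2 + s) \<le> 2 / ?r" .
  have "- (2 / ?r) \<le> 2 * ln ?r" using ln_le_minus_one[of "1 / ?r"] r by (simp add: ln_div)
  also have "\<dots> = ln (?r\<^sup>2)" using r by (simp add: ln_realpow)
  also have "\<dots> \<le> ln (?r\<^sup>2 + s)" using r assms by (intro ln_mono) (auto simp: add_pos_nonneg)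
  finally have "\<bar>ln (?r\<^sup>2 + s)\<bar> \<le> 2 / ?r" using up by linarith
  from divide_right_mono[OF this, of "4 * pi"] have "\<bar>elog s z\<bar> \<le> 2 / ?r / (4 * pi)"
    by (simp add: elog_def abs_divide)
  also have "\<dots> \<le> 1 / ?r" using r pi_ge_two by (simp add: field_simps)
  finally show ?thesis .
qed

lemma Phi_bound:
  assumes "0 \<le> s" "s \<le> 1" "z \<noteq> 0" shows "\<bar>Phi s z\<bar> \<le> invnorm z"
proof (cases "norm z \<le> 1")
  case True
  have "\<bar>cutoff z\<bar> * \<bar>elog s z\<bar> \<le> 1 * (1 / norm z)"
    using elog_bound[OF assms True] cutoff_nonneg[of z] cutoff_le_1[of z] by (intro mult_mono) auto
  then show ?thesis using True by (simp add: Phi_def invnorm_def abs_mult)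
qed (simp add: Phi_outside invnorm_def)

lemma pd_elog_bound:
  assumes "0 \<le> s" "z \<noteq> 0" "b \<in> Basis" shows "\<bar>(z \<bullet> b) / ((norm z)\<^sup>2 + s)\<bar> \<le> 1 / norm z"
proof -
  have r: "norm z > 0" using assms by simp
  have "\<bar>(z \<bullet> b) / ((norm z)\<^sup>2 + s)\<bar> = \<bar>z \<bullet> b\<bar> / ((norm z)\<^sup>2 + s)" using assms by (simp add: abs_divide)
  also have "\<dots> \<le> norm z / (norm z)\<^sup>2"
    using assms r Basis_le_norm[OF assms(3), of z] by (intro frac_le) auto
  also have "\<dots> = 1 / norm z" by (simp add: power2_eq_square)
  finally show ?thesis .
qed

lemma cutoff_derivs_bounded:
  obtains C where "C > 0" "\<And>b z::complex. b \<in> Basis \<Longrightarrow> \<bar>pd b cutoff z\<bar> \<le> C" "\<And>b z::complex. b \<in> Basis \<Longrightarrow> \<bar>pd b (pd b cutoff) z\<bar> \<le> C"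
proof -
  have B: "\<exists>C>0. \<forall>z. \<bar>F z\<bar> \<le> C" if F: "smooth F" "\<And>z. norm z > 1 \<Longrightarrow> F z = 0" for F :: "complex \<Rightarrow> real"
  proof -
    obtain C where "C > 0" "\<And>x. x \<in> cball 0 1 \<Longrightarrow> norm (F x) \<le> C"
      using continuous_bounded_on_cball[OF smooth_continuous[OF F(1)]] by blast
    then have "\<bar>F z\<bar> \<le> C" for z using F(2) by (cases "norm z \<le> 1") auto
    then show ?thesis using \<open>C > 0\<close> by blast
  qed
  have "\<exists>C>0. \<forall>z. \<bar>pd b cutoff z\<bar> \<le> C" "\<exists>C>0. \<forall>z. \<bar>pd b (pd b cutoff) z\<bar> \<le> C" if "b \<in> Basis" for b :: complex
    using that by (auto intro!: B smooth_pd smooth_cutoff pd_cutoff_outside pd_pd_cutoff_outside)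
  then obtain c d where c: "\<And>b z. b \<in> Basis \<Longrightarrow> \<bar>pd b cutoff (z::complex)\<bar> \<le> c b" and c0: "\<And>b. b \<in> Basis \<Longrightarrow> c b > 0"
     and d: "\<And>b z. b \<in> Basis \<Longrightarrow> \<bar>pd b (pd b cutoff) (z::complex)\<bar> \<le> d b" and d0: "\<And>b. b \<in> Basis \<Longrightarrow> d b > 0"
    by metis
  have le: "c b \<le> c 1 + c \<i> + d 1 + d \<i>" "d b \<le> c 1 + c \<i> + d 1 + d \<i>" if "b \<in> Basis" for b
    using that c0[of 1] c0[of \<i>] d0[of 1] d0[of \<i>] by (auto simp: Basis_complex_def)
  show ?thesis
  proof (rule that[of "c 1 + c \<i> + d 1 + d \<i>"])
    show "c 1 + c \<i> + d 1 + d \<i> > 0"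
      using c0[of 1] c0[of \<i>] d0[of 1] d0[of \<i>] by (simp add: Basis_complex_def)
    show "\<bar>pd b cutoff z\<bar> \<le> c 1 + c \<i> + d 1 + d \<i>" "\<bar>pd b (pd b cutoff) z\<bar> \<le> c 1 + c \<i> + d 1 + d \<i>"
      if "b \<in> Basis" for b z :: complex
      using order_trans[OF c le(1)] order_trans[OF d le(2)] that by blast+
  qed
qed

lemma dPhi_bound:
  obtains C where "C > 0" "\<And>s b z. 0 \<le> s \<Longrightarrow> s \<le> 1 \<Longrightarrow> z \<noteq> 0 \<Longrightarrow> b \<in> Basis \<Longrightarrow> \<bar>dPhi b s z\<bar> \<le> C * invnorm z"
proof -
  obtain C where C: "C > 0" "\<And>b z::complex. b \<in> Basis \<Longrightarrow> \<bar>pd b cutoff z\<bar> \<le> C"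
    using cutoff_derivs_bounded by metis
  show ?thesis
  proof (rule that[of "C + 1"])
    fix s :: real and b z :: complex
    assume a: "0 \<le> s" "s \<le> 1" "z \<noteq> 0" "b \<in> Basis"
    show "\<bar>dPhi b s z\<bar> \<le> (C + 1) * invnorm z"
    proof (cases "norm z \<le> 1")
      case True
      have "\<bar>(z \<bullet> b) / (2 * pi * ((norm z)\<^sup>2 + s))\<bar> = \<bar>(z \<bullet> b) / ((norm z)\<^sup>2 + s)\<bar> / (2 * pi)"
        by (simp add: abs_divide abs_mult)
      also have "\<dots> \<le> (1 / norm z) / 1"
        by (rule frac_le[OF _ pd_elog_bound[OF a(1,3,4)]]) (use pi_ge_two in auto)
      finally have e: "\<bar>(z \<bullet> b) / (2 * pi * ((norm z)\<^sup>2 + s))\<bar> \<le> 1 / norm z" by simp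
      have "\<bar>pd b cutoff z * elog s z\<bar> \<le> C * (1 / norm z)"
        unfolding abs_mult using elog_bound[OF a(1-3) True] C a(4) by (intro mult_mono) auto
      moreover have "\<bar>cutoff z * ((z \<bullet> b) / (2 * pi * ((norm z)\<^sup>2 + s)))\<bar> \<le> 1 * (1 / norm z)"
        unfolding abs_mult[of "cutoff z"] using e cutoff_nonneg[of z] cutoff_le_1[of z] by (intro mult_mono) auto
      moreover have "(C + 1) * invnorm z = C * (1 / norm z) + 1 * (1 / norm z)"
        using True by (simp add: invnorm_def add_divide_distrib)
      ultimately show ?thesis unfolding dPhi_def by linarith
    qed (simp add: dPhi_def invnorm_def cutoff_eq_0 pd_cutoff_outside)
  qed (use C in auto)
qed

lemma kap_bound:
  obtains C where "C > 0" "\<And>s z. 0 \<le> s \<Longrightarrow> s \<le> 1 \<Longrightarrow> z \<noteq> 0 \<Longrightarrow> \<bar>kap s z\<bar> \<le> C * invnorm z"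
proof -
  obtain C where C: "C > 0" "\<And>b z::complex. b \<in> Basis \<Longrightarrow> \<bar>pd b cutoff z\<bar> \<le> C" "\<And>b z::complex. b \<in> Basis \<Longrightarrow> \<bar>pd b (pd b cutoff) z\<bar> \<le> C"
    using cutoff_derivs_bounded by metis
  show ?thesis
  \<comment> \<open>Two basis vectors with two terms each.\<close>
  proof (rule that[of "4 * C"])
    fix s :: real and z :: complex
    assume a: "0 \<le> s" "s \<le> 1" "z \<noteq> 0"
    show "\<bar>kap s z\<bar> \<le> 4 * C * invnorm z"
    proof (cases "norm z \<le> 1")
      case True
      have "\<bar>pd b cutoff z * ((z \<bullet> b) / (pi * ((norm z)\<^sup>2 + s))) + pd b (pd b cutoff) z * elog s z\<bar> \<le> 2 * C * (1 / norm z)"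
        if b: "b \<in> Basis" for b
      proof -
        have "\<bar>(z \<bullet> b) / (pi * ((norm z)\<^sup>2 + s))\<bar> = \<bar>(z \<bullet> b) / ((norm z)\<^sup>2 + s)\<bar> / pi"
          by (simp add: abs_divide abs_mult)
        also have "\<dots> \<le> (1 / norm z) / 1"
          by (rule frac_le[OF _ pd_elog_bound[OF a(1,3) b]]) (use pi_ge_two in auto)
        finally have e: "\<bar>(z \<bullet> b) / (pi * ((norm z)\<^sup>2 + s))\<bar> \<le> 1 / norm z" by simp
        have "\<bar>pd b (pd b cutoff) z * elog s z\<bar> \<le> C * (1 / norm z)"
          unfolding abs_mult using elog_bound[OF a True] C b by (intro mult_mono) auto
        moreover have "\<bar>pd b cutoff z * ((z \<bullet> b) / (pi * ((norm z)\<^sup>2 + s)))\<bar> \<le> C * (1 / norm z)"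
          unfolding abs_mult[of "pd b cutoff z"] using e C b by (intro mult_mono) auto
        ultimately show ?thesis by linarith
      qed
      then have "\<bar>kap s z\<bar> \<le> (\<Sum>b\<in>(Basis::complex set). 2 * C * (1 / norm z))"
        unfolding kap_def by (intro order_trans[OF sum_abs] sum_mono)
      also have "\<dots> = 4 * C * (1 / norm z)" by simp
      finally show ?thesis using True by (simp add: invnorm_def)
    qed (simp add: kap_outside invnorm_def)
  qed (use C in auto)
qed

lemma laplacian_affine:
  assumes "smooth u"
  shows "laplacian (\<lambda>x. u (a + c *\<^sub>R x)) x = c\<^sup>2 * laplacian u (a + c *\<^sub>R x)"
proof -
  have "pd b (pd b (\<lambda>x. u (a + c *\<^sub>R x))) x = c\<^sup>2 * pd b (pd b u) (a + c *\<^sub>R x)" if b: "b \<in> Basis" for b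
  proof -
    have s: "smooth (pd b u)" using assms b by (rule smooth_pd)
    have "pd b (\<lambda>x. u (a + c *\<^sub>R x)) = (\<lambda>x. c * pd b u (a + c *\<^sub>R x))"
      by (rule ext) (simp add: pd_affine[OF smoothD[OF assms, of "Suc 0"]])
    moreover have "pd b (\<lambda>x. c * pd b u (a + c *\<^sub>R x)) x = c * pd b (\<lambda>x. pd b u (a + c *\<^sub>R x)) x"
      by (rule pd_bounded_linear[OF bounded_linear_mult_right smoothD[OF smooth_affine[OF s], of "Suc 0"]])
    ultimately show ?thesis by (simp add: pd_affine[OF smoothD[OF s, of "Suc 0"]] power2_eq_square)
  qed
  then show ?thesis by (simp add: laplacian_pd sum_distrib_left)
qed

lemma loc_int_add: "loc_int u \<Longrightarrow> loc_int v \<Longrightarrow> loc_int (\<lambda>x. u x + v x)"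
  unfolding loc_int_def by (auto simp: distrib_left)

lemma conv_integrable_loc:
  fixes K :: "'a::euclidean_space \<Rightarrow> 'b::euclidean_space"
  assumes m: "loc_int m" and K: "continuous_on UNIV K" "bsupp K"
  shows "integrable lborel (\<lambda>w. m w *\<^sub>R K (z - w))"
proof -
  obtain R where R: "R > 0" "\<And>x. norm x > R \<Longrightarrow> K x = 0" using bsuppE[OF K(2)] by blast
  let ?m = "\<lambda>w. indicator (cball 0 (R + norm z)) w * m w"
  have "integrable lborel (\<lambda>w. ?m w *\<^sub>R K (z - w))"
    using m unfolding loc_int_def by (intro conv_integrable_base[OF _ _ K(1), of _ "R + norm z"]) auto
  also have "(\<lambda>w. ?m w *\<^sub>R K (z - w)) = (\<lambda>w. m w *\<^sub>R K (z - w))"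
  proof
    fix w
    have "K (z - w) = 0" if "w \<notin> cball 0 (R + norm z)"
      using that norm_triangle_ineq4[of z "z - w"] by (intro R) simp
    then show "?m w *\<^sub>R K (z - w) = m w *\<^sub>R K (z - w)" by (auto simp: indicator_def)
  qed
  finally show ?thesis .
qed

lemma invnorm_nonneg: "invnorm z \<ge> 0" by (simp add: invnorm_def)

text \<open>The common source of \<open>Phi_L1\<close>, \<open>dPhi_L1\<close> and
  \<open>kap_L1\<close>: dominated convergence, with the origin discarded as a null set.\<close>

lemma invnorm_dominated:
  fixes F :: "nat \<Rightarrow> complex \<Rightarrow> real"
  assumes F: "\<And>n. F n \<in> borel_measurable borel" and G: "G \<in> borel_measurable borel"
    and FC: "\<And>n z. z \<noteq> 0 \<Longrightarrow> \<bar>F n z\<bar> \<le> C * invnorm z" and GC: "\<And>z. z \<noteq> 0 \<Longrightarrow> \<bar>G z\<bar> \<le> C * invnorm z"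
    and lim: "\<And>z. z \<noteq> 0 \<Longrightarrow> (\<lambda>n. F n z) \<longlonglongrightarrow> G z"
  shows "integrable lborel (F n)" "integrable lborel G" "(\<lambda>n. LINT z|lborel. \<bar>F n z - G z\<bar>) \<longlonglongrightarrow> 0"
proof -
  note [measurable] = F G
  have C: "integrable lborel (\<lambda>z. C * invnorm z)" using integrable_invnorm by simp
  have nz: "AE z in lborel. z \<noteq> (0::complex)" by (rule AE_lborel_singleton)
  show "integrable lborel (F n)"
    by (rule Bochner_Integration.integrable_bound[OF C])
       (auto intro!: eventually_mono[OF nz] order_trans[OF FC] simp: F)
  show "integrable lborel G"
    by (rule Bochner_Integration.integrable_bound[OF C])
       (auto intro!: eventually_mono[OF nz] order_trans[OF GC] simp: G)
  have "(\<lambda>n. LINT z|lborel. \<bar>F n z - G z\<bar>) \<longlonglongrightarrow> (LINT z|(lborel :: complex measure). 0)"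
  proof (rule integral_dominated_convergence)
    show "integrable lborel (\<lambda>z. 2 * (C * invnorm z))" using C by simp
    show "AE z in lborel. (\<lambda>n. \<bar>F n z - G z\<bar>) \<longlonglongrightarrow> 0"
      using nz
    proof eventually_elim
      case (elim z)
      then show ?case using tendsto_rabs_zero[OF tendsto_diff[OF lim[OF elim] tendsto_const[of "G z"], simplified]] by simp
    qed
    show "AE z in lborel. norm \<bar>F n z - G z\<bar> \<le> 2 * (C * invnorm z)" for n
      using nz
    proof eventually_elim
      case (elim z)
      then show ?case using FC[OF elim, of n] GC[OF elim] by simp
    qed
  qed measurable
  then show "(\<lambda>n. LINT z|lborel. \<bar>F n z - G z\<bar>) \<longlonglongrightarrow> 0" by simp
qed

definition sreg :: "nat \<Rightarrow> real" where "sreg n = 1 / real (Suc n)"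

lemma sreg: "sreg n > 0" "sreg n \<le> 1" "sreg \<longlonglongrightarrow> 0"
  unfolding sreg_def[abs_def] using LIMSEQ_inverse_real_of_nat by (auto simp: inverse_eq_divide)

lemma elog_measurable [measurable]: "elog s \<in> borel_measurable borel"
  unfolding elog_def[abs_def] by measurable

lemma smooth_measurable: "smooth F \<Longrightarrow> F \<in> borel_measurable borel"
  using smooth_continuous borel_measurable_continuous_onI by blast

lemma cutoff_measurable [measurable]: "cutoff \<in> borel_measurable borel"
  by (rule smooth_measurable[OF smooth_cutoff])

lemma Phi_measurable [measurable]: "Phi s \<in> borel_measurable borel"
  unfolding Phi_def[abs_def] by measurable

lemma dPhi_measurable: "b \<in> Basis \<Longrightarrow> dPhi b s \<in> borel_measurable borel"
proof -
  assume "b \<in> Basis"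
  then have [measurable]: "pd b (cutoff :: complex \<Rightarrow> real) \<in> borel_measurable borel"
    by (intro smooth_measurable smooth_pd smooth_cutoff)
  show ?thesis unfolding dPhi_def[abs_def] by measurable
qed

lemma kap_measurable: "kap s \<in> borel_measurable borel"
proof -
  have [measurable]: "pd b (cutoff :: complex \<Rightarrow> real) \<in> borel_measurable borel"
     "pd b (pd b cutoff) \<in> borel_measurable borel" if "b \<in> Basis" for b :: complex
    using that by (auto intro!: smooth_measurable smooth_pd smooth_cutoff)
  show ?thesis unfolding kap_def[abs_def] by (intro borel_measurable_sum) measurable
qed

lemma elog_tendsto: "z \<noteq> 0 \<Longrightarrow> (\<lambda>n. elog (sreg n) z) \<longlonglongrightarrow> elog 0 z"
  unfolding elog_def by (intro tendsto_intros sreg) auto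

lemma Phi_L1:
  shows "integrable lborel (Phi (sreg n))" "integrable lborel (Phi 0)" "(\<lambda>n. LINT z|lborel. \<bar>Phi (sreg n) z - Phi 0 z\<bar>) \<longlonglongrightarrow> 0"
proof -
  have 1: "\<bar>Phi (sreg n) z\<bar> \<le> 1 * invnorm z" "\<bar>Phi 0 z\<bar> \<le> 1 * invnorm z" if "z \<noteq> 0" for n z
    using Phi_bound[of _ z] that sreg(1,2)[of n] by (simp_all add: less_imp_le)
  have 2: "(\<lambda>n. Phi (sreg n) z) \<longlonglongrightarrow> Phi 0 z" if "z \<noteq> 0" for z
    unfolding Phi_def by (intro tendsto_intros elog_tendsto that)
  show "integrable lborel (Phi (sreg n))" "integrable lborel (Phi 0)" "(\<lambda>n. LINT z|lborel. \<bar>Phi (sreg n) z - Phi 0 z\<bar>) \<longlonglongrightarrow> 0"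
    by (rule invnorm_dominated[where F="\<lambda>n. Phi (sreg n)" and G="Phi 0" and C=1, OF Phi_measurable Phi_measurable 1 2]; assumption)+
qed

lemma dPhi_L1:
  assumes b: "b \<in> Basis"
  shows "integrable lborel (dPhi b (sreg n))" "integrable lborel (dPhi b 0)" "(\<lambda>n. LINT z|lborel. \<bar>dPhi b (sreg n) z - dPhi b 0 z\<bar>) \<longlonglongrightarrow> 0"
proof -
  obtain C where C: "\<And>s b z. 0 \<le> s \<Longrightarrow> s \<le> 1 \<Longrightarrow> z \<noteq> 0 \<Longrightarrow> b \<in> Basis \<Longrightarrow> \<bar>dPhi b s z\<bar> \<le> C * invnorm z"
    using dPhi_bound by metis
  have 1: "\<bar>dPhi b (sreg n) z\<bar> \<le> C * invnorm z" "\<bar>dPhi b 0 z\<bar> \<le> C * invnorm z" if "z \<noteq> 0" for n z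
    using C that b sreg(1,2)[of n] by (simp_all add: less_imp_le)
  have 2: "(\<lambda>n. dPhi b (sreg n) z) \<longlonglongrightarrow> dPhi b 0 z" if "z \<noteq> 0" for z
    unfolding dPhi_def using that by (intro tendsto_intros elog_tendsto sreg) auto
  show "integrable lborel (dPhi b (sreg n))" "integrable lborel (dPhi b 0)" "(\<lambda>n. LINT z|lborel. \<bar>dPhi b (sreg n) z - dPhi b 0 z\<bar>) \<longlonglongrightarrow> 0"
    by (rule invnorm_dominated[where F="\<lambda>n. dPhi b (sreg n)" and G="dPhi b 0" and C=C, OF dPhi_measurable[OF b] dPhi_measurable[OF b] 1 2]; assumption)+
qed

lemma kap_L1:
  shows "integrable lborel (kap (sreg n))" "integrable lborel (kap 0)" "(\<lambda>n. LINT z|lborel. \<bar>kap (sreg n) z - kap 0 z\<bar>) \<longlonglongrightarrow> 0"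
proof -
  obtain C where C: "\<And>s z. 0 \<le> s \<Longrightarrow> s \<le> 1 \<Longrightarrow> z \<noteq> 0 \<Longrightarrow> \<bar>kap s z\<bar> \<le> C * invnorm z"
    using kap_bound by metis
  have 1: "\<bar>kap (sreg n) z\<bar> \<le> C * invnorm z" "\<bar>kap 0 z\<bar> \<le> C * invnorm z" if "z \<noteq> 0" for n z
    using C that sreg(1,2)[of n] by (simp_all add: less_imp_le)
  have 2: "(\<lambda>n. kap (sreg n) z) \<longlonglongrightarrow> kap 0 z" if "z \<noteq> 0" for z
    unfolding kap_def using that by (intro tendsto_intros elog_tendsto sreg) auto
  show "integrable lborel (kap (sreg n))" "integrable lborel (kap 0)" "(\<lambda>n. LINT z|lborel. \<bar>kap (sreg n) z - kap 0 z\<bar>) \<longlonglongrightarrow> 0"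
    by (rule invnorm_dominated[where F="\<lambda>n. kap (sreg n)" and G="kap 0" and C=C, OF kap_measurable kap_measurable 1 2]; assumption)+
qed

lemma eta_nonneg: "s > 0 \<Longrightarrow> eta s z \<ge> 0" by (simp add: eta_def)

lemma continuous_on_eta: "s > 0 \<Longrightarrow> continuous_on UNIV (eta s)"
proof -
  assume "s > 0"
  then have "(norm z)\<^sup>2 + s \<noteq> 0" for z :: complex using norm_sq_add_pos[of s z] by simp
  then show ?thesis unfolding eta_def[abs_def] by (intro continuous_intros) auto
qed

text \<open>The exact mass outside a disc of radius \<open>a\<close>. For \<open>a = 0\<close> it is
  1, and for fixed \<open>a > 0\<close> it tends to 0 with \<open>s\<close>, so the mass
  concentrates at the origin.\<close>

lemma eta_tail:
  assumes s: "s > 0" and a: "a \<ge> 0"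
  shows "has_bochner_integral lborel (\<lambda>z. eta s z * indicator {a..} (norm z)) (s / (a\<^sup>2 + s))"
proof (rule has_bochner_integral_nn_integral)
  have [measurable]: "eta s \<in> borel_measurable borel"
    using continuous_on_eta[OF s] by (rule borel_measurable_continuous_onI)
  show "(\<lambda>z. eta s z * indicator {a..} (norm z)) \<in> borel_measurable lborel" by measurable
  have "(\<integral>\<^sup>+ z. ennreal (eta s z * indicator {a..} (norm z)) \<partial>lborel)
     = (\<integral>\<^sup>+ (z::complex). ennreal (1 / pi) * (ennreal (s / ((norm z)\<^sup>2 + s)\<^sup>2) * indicator {a..} (norm z)) \<partial>lborel)"
    using s by (intro nn_integral_cong) (auto simp: eta_def ennreal_mult'[symmetric] split: split_indicator)
  also have "\<dots> = ennreal (1 / pi) * ennreal (pi * s / (a\<^sup>2 + s))"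
    by (subst nn_integral_cmult) (auto simp: nn_integral_spherical_tail[OF s a])
  also have "\<dots> = ennreal (s / (a\<^sup>2 + s))"
    using s by (subst ennreal_mult'[symmetric]) auto
  finally show "(\<integral>\<^sup>+ z. ennreal (eta s z * indicator {a..} (norm z)) \<partial>lborel) = ennreal (s / (a\<^sup>2 + s))" .
qed (use s in \<open>auto simp: eta_nonneg add_nonneg_nonneg\<close>)

lemma eta_integral: "s > 0 \<Longrightarrow> integrable lborel (eta s)" "s > 0 \<Longrightarrow> (LINT z|lborel. eta s z) = 1"
  using eta_tail[of s 0] by (auto simp: has_bochner_integral_iff)

section \<open>The approximate identity\<close>

definition rho :: "real \<Rightarrow> complex \<Rightarrow> real" where "rho s z = cutoff z * eta s z"

lemma rho_props:
  assumes s: "s > 0"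
  shows "0 \<le> rho s z" "rho s z \<le> eta s z" "norm z \<le> 1/2 \<Longrightarrow> rho s z = eta s z" "norm z \<ge> 1 \<Longrightarrow> rho s z = 0"
    "continuous_on UNIV (rho s)" "bsupp (rho s)" "integrable lborel (rho s)"
proof -
  show "0 \<le> rho s z" "rho s z \<le> eta s z" "norm z \<le> 1/2 \<Longrightarrow> rho s z = eta s z"
    using s eta_nonneg[OF s, of z] cutoff_nonneg[of z] cutoff_le_1[of z]
    by (auto simp: rho_def cutoff_eq_1 mult_left_le_one_le)
  show z: "norm z \<ge> 1 \<Longrightarrow> rho s z = 0" for z by (simp add: rho_def cutoff_eq_0)
  show c: "continuous_on UNIV (rho s)" unfolding rho_def[abs_def]
    by (intro continuous_on_mult smooth_continuous[OF smooth_cutoff] continuous_on_eta s)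
  show b: "bsupp (rho s)" by (rule bsuppI[of 1]) (simp add: z)
  show "integrable lborel (rho s)" by (rule integrable_continuous_bsupp[OF c b])
qed

lemma integrable_bounded_mult:
  fixes F :: "'a::euclidean_space \<Rightarrow> real"
  assumes F: "integrable lborel F" and [measurable]: "k \<in> borel_measurable borel" and k: "\<And>z. \<bar>k z\<bar> \<le> C"
  shows "integrable lborel (\<lambda>z. k z * F z)"
proof (rule Bochner_Integration.integrable_bound[OF integrable_mult_right[OF F, of C]])
  have [measurable]: "F \<in> borel_measurable borel" using F by auto
  show "(\<lambda>z. k z * F z) \<in> borel_measurable lborel" by measurable
  show "AE z in lborel. norm (k z * F z) \<le> norm (C * F z)"
    using order_trans[OF k abs_ge_self] by (intro AE_I2) (simp add: abs_mult mult_right_mono)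
qed

text \<open>If \<open>w\<close> is in the open box, the smoothed indicator is at least the mass of
  \<open>eta\<close> in a small disc and at most 1; if \<open>w\<close> is outside the closed box,
  it is at most the mass of a tail. The frontier, where neither argument applies, is a null
  set.\<close>

lemma rho_smoothing_limit:
  fixes a b w :: complex
  assumes w: "w \<notin> cbox a b - box a b"
  shows "(\<lambda>n. LINT z|lborel. indicator (box a b) z * rho (sreg n) (z - w)) \<longlonglongrightarrow> indicator (box a b) w"
proof -
  note s = sreg(1)
  define T where "T n = (LINT z|lborel. indicator (box a b) z * rho (sreg n) (z - w))" for n
  have int: "integrable lborel (\<lambda>z. indicator (box a b) z * rho (sreg n) (z - w))" for n
    using rho_props(7)[OF s] by (intro integrable_bounded_mult[where C=1]) (auto simp: lborel_integrable_shift)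
  have tail: "has_bochner_integral lborel (\<lambda>z. eta (sreg n) (z - w) * indicator {r..} (norm (z - w))) (sreg n / (r\<^sup>2 + sreg n))" if "r \<ge> 0" for r n
    using eta_tail[OF s[of n] that] lborel_integrable_shift[of "\<lambda>z. eta (sreg n) z * indicator {r..} (norm z)" w]
      lborel_integral_shift[of "\<lambda>z. eta (sreg n) z * indicator {r..} (norm z)" w]
    by (simp add: has_bochner_integral_iff)
  have tl0: "(\<lambda>n. sreg n / (r\<^sup>2 + sreg n)) \<longlonglongrightarrow> 0" if "r > 0" for r
  proof -
    have "(\<lambda>n. sreg n / (r\<^sup>2 + sreg n)) \<longlonglongrightarrow> 0 / (r\<^sup>2 + 0)" using that by (intro tendsto_intros sreg) auto
    then show ?thesis by simp
  qed
  have eta_sh: "integrable lborel (\<lambda>z. eta (sreg n) (z - w))" "(LINT z|lborel. eta (sreg n) (z - w)) = 1" for n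
    using eta_integral[OF s[of n]] by (simp_all add: lborel_integrable_shift lborel_integral_shift)
  have T1: "T n \<le> 1" for n
  proof -
    have "T n \<le> (LINT z|lborel. eta (sreg n) (z - w))" unfolding T_def
      using rho_props(1,2)[OF s] eta_nonneg[OF s] by (intro integral_mono int eta_sh) (auto split: split_indicator)
    then show ?thesis using eta_sh by simp
  qed
  have T0: "0 \<le> T n" for n unfolding T_def
    using rho_props(1)[OF s] by (intro integral_nonneg_AE AE_I2) auto
  show ?thesis
  proof (cases "w \<in> box a b")
    case True
    obtain r0 where r0: "r0 > 0" "ball w r0 \<subseteq> box a b" using True open_box open_contains_ball by blast
    \<comment> \<open>The bound 1/2 keeps the disc inside the region where \<open>rho\<close>
      coincides with \<open>eta\<close>.\<close>
    define r where "r = min r0 (1/2)"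
    have r: "r > 0" "r \<le> 1/2" "ball w r \<subseteq> box a b" using r0 by (auto simp: r_def)
    have "1 - sreg n / (r\<^sup>2 + sreg n) \<le> T n" for n
    proof -
      have "1 - sreg n / (r\<^sup>2 + sreg n) = (LINT z|lborel. eta (sreg n) (z - w) - eta (sreg n) (z - w) * indicator {r..} (norm (z - w)))"
        using eta_sh[of n] tail[of r n] r(1) by (subst Bochner_Integration.integral_diff) (auto simp: has_bochner_integral_iff)
      also have "\<dots> \<le> T n" unfolding T_def
      proof (rule integral_mono[OF _ int])
        show "integrable lborel (\<lambda>z. eta (sreg n) (z - w) - eta (sreg n) (z - w) * indicator {r..} (norm (z - w)))"
          using eta_sh[of n] tail[of r n] r(1) by (auto simp: has_bochner_integral_iff)
        fix z
        show "eta (sreg n) (z - w) - eta (sreg n) (z - w) * indicator {r..} (norm (z - w)) \<le> indicator (box a b) z * rho (sreg n) (z - w)"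
        proof (cases "norm (z - w) < r")
          case True
          then have "z \<in> box a b" using r(3) by (auto simp: dist_norm norm_minus_commute)
          then show ?thesis using True r(2) rho_props(3)[OF s, of "z - w" n] by simp
        next
          case False
          then show ?thesis using rho_props(1)[OF s, of n "z - w"] by (simp split: split_indicator)
        qed
      qed
      finally show ?thesis .
    qed
    moreover have "(\<lambda>n. 1 - sreg n / (r\<^sup>2 + sreg n)) \<longlonglongrightarrow> 1"
      using tendsto_diff[OF tendsto_const tl0[OF r(1)], of 1] by simp
    ultimately have "T \<longlonglongrightarrow> 1"
      by (intro tendsto_sandwich[OF always_eventually always_eventually _ tendsto_const, of _ T 1]) (use T1 in auto)
    then show ?thesis using True by (simp add: T_def[abs_def])
  next
    case False
    then have "w \<in> - cbox a b" using w by auto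
    then obtain r where r: "r > 0" "ball w r \<subseteq> - cbox a b"
      using open_contains_ball[of "- cbox a b"] by auto
    have "T n \<le> sreg n / (r\<^sup>2 + sreg n)" for n
    proof -
      have "T n \<le> (LINT z|lborel. eta (sreg n) (z - w) * indicator {r..} (norm (z - w)))" unfolding T_def
      proof (rule integral_mono[OF int])
        show "integrable lborel (\<lambda>z. eta (sreg n) (z - w) * indicator {r..} (norm (z - w)))"
          using tail[of r n] r(1) by (auto simp: has_bochner_integral_iff)
        fix z
        show "indicator (box a b) z * rho (sreg n) (z - w) \<le> eta (sreg n) (z - w) * indicator {r..} (norm (z - w))"
        proof (cases "norm (z - w) < r")
          case True
          then have "z \<notin> box a b" using r(2) box_subset_cbox by (fastforce simp: dist_norm norm_minus_commute)
          then show ?thesis using True by simp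
        next
          case False
          then show ?thesis using rho_props(1,2)[OF s, of n "z - w"] eta_nonneg[OF s, of n "z - w"] by (simp split: split_indicator)
        qed
      qed
      then show ?thesis using tail[of r n] r(1) by (simp add: has_bochner_integral_iff)
    qed
    then have "T \<longlonglongrightarrow> 0"
      by (intro tendsto_sandwich[OF always_eventually always_eventually tendsto_const tl0[OF r(1)], of T]) (use T0 in auto)
    then show ?thesis using False by (simp add: T_def[abs_def])
  qed
qed

lemma smooth_laplacian [smooth_intros]: "smooth u \<Longrightarrow> smooth (laplacian u)"
proof -
  assume "smooth u"
  then have "smooth (\<lambda>z. \<Sum>b\<in>Basis. pd b (pd b u) z)" by (intro smooth_sum smooth_pd)
  then show ?thesis by (simp add: laplacian_pd[abs_def])
qed

lemma bsupp_laplacian: "bsupp u \<Longrightarrow> bsupp (laplacian u)"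
proof -
  assume "bsupp u"
  then obtain R where R: "\<And>x. norm x > R \<Longrightarrow> u x = 0" using bsuppE by blast
  show ?thesis
    by (rule bsuppI[of R]) (auto simp: laplacian_pd intro!: sum.neutral pd_eq_0_outside[of R] R)
qed

lemma green:
  fixes u \<phi> :: "'a::euclidean_space \<Rightarrow> real"
  assumes u: "smooth u" and \<phi>: "smooth \<phi>" "bsupp \<phi>"
  shows "(LINT x|lborel. u x * laplacian \<phi> x) = (LINT x|lborel. laplacian u x * \<phi> x)"
proof -
  have "(LINT x|lborel. u x * pd b (pd b \<phi>) x) = (LINT x|lborel. pd b (pd b u) x * \<phi> x)" if b: "b \<in> Basis" for b
  proof -
    note s = smooth_pd[OF u b] smooth_pd[OF \<phi>(1) b] u \<phi>(1)
    note c = s[THEN smoothD[of _ "Suc 0"]]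
    have "(LINT x|lborel. pd b u x * pd b \<phi> x) = - (LINT x|lborel. u x * pd b (pd b \<phi>) x)"
      by (rule integral_by_parts[OF c(3,2) _ b]) (use \<phi> bsupp_pd in blast)
    moreover have "(LINT x|lborel. pd b (pd b u) x * \<phi> x) = - (LINT x|lborel. pd b u x * pd b \<phi> x)"
      by (rule integral_by_parts[OF c(1,4) _ b]) (use \<phi> in blast)
    ultimately show ?thesis by simp
  qed
  moreover have "integrable lborel (\<lambda>x. u x * pd b (pd b \<phi>) x)" "integrable lborel (\<lambda>x. pd b (pd b u) x * \<phi> x)" if "b \<in> Basis" for b
    using that u \<phi> bsupp_pd
    by (blast intro!: integrable_continuous_bsupp smooth_continuous smooth_mult smooth_pd bsupp_mult)+
  ultimately show ?thesis
    by (simp add: laplacian_pd sum_distrib_left sum_distrib_right)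
qed

section \<open>The parametrix identity\<close>

text \<open>The equation is tested with \<open>Phi s\<close> reflected and translated to
  \<open>z\<close>, which for \<open>s > 0\<close> is smooth with bounded support; its Laplacian
  splits into \<open>rho s\<close> and \<open>kap s\<close>.\<close>

lemma parametrix_regularized:
  assumes psi: "loc_int \<psi>" and s: "s > 0"
    and eq: "\<And>\<phi>. smooth \<phi> \<Longrightarrow> bsupp \<phi> \<Longrightarrow> - (LINT x|lborel. \<psi> x * laplacian \<phi> x) = (LINT x|lborel. g x * \<phi> x)"
  shows "conv (rho s) \<psi> z + conv (kap s) \<psi> z + conv (Phi s) g z = 0"
proof -
  have ck: "continuous_on UNIV (kap s)"
  proof -
    have "continuous_on UNIV (\<lambda>z. laplacian (Phi s) z - rho s z)"
      by (intro continuous_on_diff smooth_continuous smooth_laplacian smooth_Phi s rho_props)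
    then show ?thesis by (simp add: laplacian_Phi[OF s] rho_def)
  qed
  let ?\<phi> = "\<lambda>w. Phi s (z + (-1) *\<^sub>R w)"
  have sm: "smooth ?\<phi>" by (rule smooth_affine[OF smooth_Phi[OF s]])
  have bs: "bsupp ?\<phi>"
  proof (rule bsuppI[of "norm z + 1"])
    fix w :: complex assume "norm w > norm z + 1"
    then have "norm (z - w) \<ge> 1" using norm_triangle_ineq2[of w z] by (simp add: norm_minus_commute)
    then show "?\<phi> w = 0" by (simp add: Phi_outside)
  qed
  have lap: "laplacian ?\<phi> w = rho s (z - w) + kap s (z - w)" for w
    using laplacian_affine[OF smooth_Phi[OF s], of z "-1" w] by (simp add: laplacian_Phi[OF s] rho_def)
  have "(LINT w|lborel. \<psi> w * laplacian ?\<phi> w) = conv (rho s) \<psi> z + conv (kap s) \<psi> z"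
    using conv_integrable_loc[OF psi rho_props(5,6)[OF s], of z] conv_integrable_loc[OF psi ck bsupp_kap, of z]
    unfolding lap conv_def by (simp add: distrib_left)
  moreover have "(LINT w|lborel. g w * ?\<phi> w) = conv (Phi s) g z" by (simp add: conv_def)
  ultimately show ?thesis using eq[OF sm bs] by simp
qed

lemma conv_restrict:
  assumes K: "\<And>x. norm x > 1 \<Longrightarrow> K x = 0" and z: "norm z \<le> R"
  shows "conv K m z = conv K (\<lambda>w. indicator (cball 0 (R + 1)) w * m w) z"
  unfolding conv_def
proof (intro Bochner_Integration.integral_cong refl)
  fix w
  have "K (z - w) = 0" if "w \<notin> cball 0 (R + 1)"
    using that z norm_triangle_ineq4[of z "z - w"] by (intro K) simp
  then show "m w *\<^sub>R K (z - w) = (indicator (cball 0 (R + 1)) w * m w) *\<^sub>R K (z - w)"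
    by (auto simp: indicator_def)
qed

text \<open>For \<open>s = 0\<close> the translate of the kernel is no longer a test function, so
  the regularized identity is integrated over an arbitrary box before \<open>s\<close> tends to 0.
  There \<open>rho\<close> turns into evaluation of \<psi>, while the two other kernels converge in
  L1; and integrals over boxes determine a function up to a null set.\<close>

theorem parametrix:
  assumes psi: "loc_int \<psi>" and g: "integrable lborel g"
    and eq: "\<And>\<phi>. smooth \<phi> \<Longrightarrow> bsupp \<phi> \<Longrightarrow> - (LINT x|lborel. \<psi> x * laplacian \<phi> x) = (LINT x|lborel. g x * \<phi> x)"
  shows "AE z in lborel. \<psi> z = - conv (kap 0) \<psi> z - conv (Phi 0) g z"
proof -
  define F where "F z = \<psi> z + conv (kap 0) \<psi> z + conv (Phi 0) g z" for z
  have kapc: "continuous_on UNIV (conv (kap 0) \<psi>)"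
    by (intro conv_continuous psi disjI2 bsupp_kap smooth_continuous smooth_kap_0)
  have F: "loc_int F" unfolding F_def[abs_def]
    by (intro loc_int_add psi loc_int_continuous[OF kapc] loc_int_integrable conv_integrable Phi_L1 g)
  have "AE z in lborel. F z = 0"
  proof (rule AE_zero_boxes[OF F])
    fix a b :: complex
    let ?k = "\<lambda>z. indicator (box a b) z :: real"
    obtain R where R: "box a b \<subseteq> cball 0 R"
      using bounded_box[of a b] unfolding bounded_iff by (meson mem_cball_0 subsetI)
    \<comment> \<open>The kernels vanish beyond distance 1, so for \<open>z\<close> in the box only
      the values of \<psi> on this ball enter, and the truncation is integrable.\<close>
    define m where "m = (\<lambda>w. indicator (cball 0 (R + 1)) w * \<psi> w)"
    have m: "integrable lborel m" using psi unfolding m_def loc_int_def by blast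
    have k: "?k \<in> borel_measurable borel" "\<And>z. \<bar>?k z\<bar> \<le> 1" by auto
    have loc: "?k z * conv K \<psi> z = ?k z * conv K m z" if "\<And>x. norm x > 1 \<Longrightarrow> K x = 0" for K :: "complex \<Rightarrow> real" and z
    proof (cases "z \<in> box a b")
      case True
      then have "norm z \<le> R" using R by auto
      then show ?thesis using conv_restrict[of K z R \<psi>, OF that] by (simp add: m_def)
    qed simp
    note int = integrable_bounded_mult[OF conv_integrable k]
    have rhoK: "\<And>x. norm x > 1 \<Longrightarrow> rho (sreg n) x = 0" for n using rho_props(4)[OF sreg(1)] by simp
    have sum0: "(LINT z|lborel. ?k z * conv (rho (sreg n)) m z) + (LINT z|lborel. ?k z * conv (kap (sreg n)) m z)
      + (LINT z|lborel. ?k z * conv (Phi (sreg n)) g z) = 0" for n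
    proof -
      have "(LINT z|lborel. ?k z * conv (rho (sreg n)) m z) + (LINT z|lborel. ?k z * conv (kap (sreg n)) m z)
        + (LINT z|lborel. ?k z * conv (Phi (sreg n)) g z)
       = (LINT z|lborel. ?k z * conv (rho (sreg n)) m z + ?k z * conv (kap (sreg n)) m z + ?k z * conv (Phi (sreg n)) g z)"
        using int[OF rho_props(7)[OF sreg(1)[of n]] m] int[OF kap_L1(1)[of n] m] int[OF Phi_L1(1)[of n] g] by simp
      also have "\<dots> = (LINT z|lborel. ?k z * (conv (rho (sreg n)) \<psi> z + conv (kap (sreg n)) \<psi> z + conv (Phi (sreg n)) g z))"
        by (simp only: distrib_left loc[of "rho (sreg n)", OF rhoK] loc[of "kap (sreg n)", OF kap_outside])
      also have "\<dots> = 0" using parametrix_regularized[OF psi sreg(1) eq] by simp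
      finally show ?thesis .
    qed
    \<comment> \<open>By Fubini the smoothing is moved from \<open>m\<close>, which is merely
      integrable, to the indicator of the box, for which pointwise convergence is available.\<close>
    have lim1: "(\<lambda>n. LINT z|lborel. ?k z * conv (rho (sreg n)) m z) \<longlonglongrightarrow> (LINT w|lborel. m w * ?k w)"
    proof -
      have [measurable]: "m \<in> borel_measurable borel" using m by auto
      have [measurable]: "rho (sreg n) \<in> borel_measurable borel" for n
        using rho_props(5)[OF sreg(1)] by (rule borel_measurable_continuous_onI)
      have T: "integrable lborel (\<lambda>z. ?k z * rho (sreg n) (z - w))" for n w
        using rho_props(7)[OF sreg(1)] by (intro integrable_bounded_mult[where C=1]) (auto simp: lborel_integrable_shift)
      have "(\<lambda>n. LINT w|lborel. m w * (LINT z|lborel. ?k z * rho (sreg n) (z - w))) \<longlonglongrightarrow> (LINT w|lborel. m w * ?k w)"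
      proof (rule integral_dominated_convergence)
        show "integrable lborel (\<lambda>w. \<bar>m w\<bar>)" using m by simp
        have "negligible (cbox a b - box a b)" by (rule negligible_frontier_interval)
        then have "AE w in lebesgue. w \<notin> cbox a b - box a b"
          unfolding negligible_iff_null_sets by (rule AE_not_in)
        then have "AE w in lborel. w \<notin> cbox a b - box a b" by (simp add: AE_completion_iff)
        then show "AE w in lborel. (\<lambda>n. m w * (LINT z|lborel. ?k z * rho (sreg n) (z - w))) \<longlonglongrightarrow> m w * ?k w"
          by eventually_elim (intro tendsto_intros rho_smoothing_limit)
        show "AE w in lborel. norm (m w * (LINT z|lborel. ?k z * rho (sreg n) (z - w))) \<le> \<bar>m w\<bar>" for n
        proof (rule AE_I2)
          fix w
          have "0 \<le> (LINT z|lborel. ?k z * rho (sreg n) (z - w))"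
            using rho_props(1)[OF sreg(1)] by (intro integral_nonneg_AE AE_I2) auto
          moreover have "(LINT z|lborel. ?k z * rho (sreg n) (z - w)) \<le> (LINT z|lborel. eta (sreg n) (z - w))"
            using rho_props(1,2)[OF sreg(1)[of n]] eta_nonneg[OF sreg(1)[of n]] eta_integral[OF sreg(1)[of n]]
            by (intro integral_mono T) (auto split: split_indicator simp: lborel_integrable_shift)
          ultimately show "norm (m w * (LINT z|lborel. ?k z * rho (sreg n) (z - w))) \<le> \<bar>m w\<bar>"
            using eta_integral[OF sreg(1)[of n]] by (simp add: abs_mult lborel_integral_shift mult_left_le)
        qed
        have "(\<lambda>w. LINT z|lborel. ?k z * rho (sreg n) (z - w)) \<in> borel_measurable lborel" for n
          by measurable
        then show "(\<lambda>w. m w * (LINT z|lborel. ?k z * rho (sreg n) (z - w))) \<in> borel_measurable lborel" for n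
          by measurable
      qed measurable
      then show ?thesis using conv_Fubini[OF rho_props(7)[OF sreg(1)] m k] by simp
    qed
    have lim2: "(\<lambda>n. LINT z|lborel. ?k z * conv (kap (sreg n)) m z) \<longlonglongrightarrow> (LINT z|lborel. ?k z * conv (kap 0) m z)"
      by (rule conv_L1_limit[OF kap_L1(1,2) m kap_L1(3) k])
    have lim3: "(\<lambda>n. LINT z|lborel. ?k z * conv (Phi (sreg n)) g z) \<longlonglongrightarrow> (LINT z|lborel. ?k z * conv (Phi 0) g z)"
      by (rule conv_L1_limit[OF Phi_L1(1,2) g Phi_L1(3) k])
    have "(LINT w|lborel. m w * ?k w) + (LINT z|lborel. ?k z * conv (kap 0) m z) + (LINT z|lborel. ?k z * conv (Phi 0) g z) = 0"
      using tendsto_add[OF tendsto_add[OF lim1 lim2] lim3] by (simp add: sum0 LIMSEQ_const_iff)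
    moreover have "integrable lborel (\<lambda>w. m w * ?k w)"
      using integrable_bounded_mult[OF m k] by (simp add: mult.commute)
    ultimately have "(LINT z|lborel. m z * ?k z + ?k z * conv (kap 0) m z + ?k z * conv (Phi 0) g z) = 0"
      using int[OF kap_L1(2) m] int[OF Phi_L1(2) g] by simp
    also have "(\<lambda>z. m z * ?k z + ?k z * conv (kap 0) m z + ?k z * conv (Phi 0) g z) = (\<lambda>z. ?k z * F z)"
    proof
      fix z
      have "m z * ?k z = ?k z * \<psi> z" using R by (auto simp: m_def indicator_def)
      then show "m z * ?k z + ?k z * conv (kap 0) m z + ?k z * conv (Phi 0) g z = ?k z * F z"
        using loc[of "kap 0" z, OF kap_outside] unfolding F_def distrib_left by linarith
    qed
    finally show "(LINT z|lborel. ?k z * F z) = 0" .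
  qed
  then show ?thesis by eventually_elim (simp add: F_def)
qed

section \<open>Regularity of logarithmic potentials\<close>

lemma conv_commute: "conv K m = conv m K" for K m :: "'a::euclidean_space \<Rightarrow> real"
  by (rule ext) (subst conv_alt, simp add: conv_def mult.commute)

definition ae_loc_bounded :: "(complex \<Rightarrow> real) \<Rightarrow> bool" where
  "ae_loc_bounded G \<longleftrightarrow> (\<forall>R. \<exists>C. AE z in lborel. norm z \<le> R \<longrightarrow> \<bar>G z\<bar> \<le> C)"

lemma ae_loc_bounded_continuous: "continuous_on UNIV G \<Longrightarrow> ae_loc_bounded G"
  unfolding ae_loc_bounded_def
proof
  fix R assume "continuous_on UNIV G"
  then obtain C where "\<And>x. x \<in> cball 0 R \<Longrightarrow> norm (G x) \<le> C" using continuous_bounded_on_cball by metis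
  then show "\<exists>C. AE z in lborel. norm z \<le> R \<longrightarrow> \<bar>G z\<bar> \<le> C" by (auto intro!: exI[of _ C])
qed

lemma AE_lborel_reflect:
  fixes P :: "'a::euclidean_space \<Rightarrow> bool"
  assumes "AE z in lborel. P z" shows "AE w in lborel. P (z - w)"
proof -
  have "AE w in distr lborel borel (\<lambda>w. z - w). P w"
  proof -
    have eq: "distr lborel borel (\<lambda>w::'a. z - w) = lborel"
      using lborel_affine[of "-1" z] by (simp add: density_1 one_ennreal_def[symmetric])
    show ?thesis unfolding eq by (rule assms)
  qed
  then show ?thesis by (rule AE_distrD[rotated]) measurable
qed

lemma conv_diff_bound:
  fixes G :: "complex \<Rightarrow> real"
  assumes G: "G \<in> borel_measurable borel" "AE z in lborel. norm z \<le> R + 1 \<longrightarrow> \<bar>G z\<bar> \<le> C"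
    and K: "integrable lborel K" "integrable lborel L" "\<And>x. norm x > 1 \<Longrightarrow> K x = 0" "\<And>x. norm x > 1 \<Longrightarrow> L x = 0"
    and z: "norm z \<le> R"
  shows "\<bar>conv K G z - conv L G z\<bar> \<le> C * (LINT w|lborel. \<bar>K w - L w\<bar>)"
proof -
  note [measurable] = G(1)
  have AEC: "AE w in lborel. norm w \<le> 1 \<longrightarrow> \<bar>G (z - w)\<bar> \<le> C"
    using AE_lborel_reflect[OF G(2), of z]
  proof eventually_elim
    case (elim w)
    then show ?case using norm_triangle_ineq4[of z w] z by auto
  qed
  have int: "integrable lborel (\<lambda>w. G (z - w) * M w)" if M: "integrable lborel M" "\<And>x. norm x > 1 \<Longrightarrow> M x = 0" for M
  proof (rule Bochner_Integration.integrable_bound[OF integrable_mult_right[OF M(1), of C]])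
    have [measurable]: "M \<in> borel_measurable borel" using M by auto
    show "(\<lambda>w. G (z - w) * M w) \<in> borel_measurable lborel" by measurable
    show "AE w in lborel. norm (G (z - w) * M w) \<le> norm (C * M w)"
      using AEC
    proof eventually_elim
      case (elim w)
      then show ?case using M(2)[of w] by (cases "norm w \<le> 1") (auto simp: abs_mult intro!: mult_right_mono)
    qed
  qed
  have "conv K G z - conv L G z = (LINT w|lborel. G (z - w) * (K w - L w))"
    using int[OF K(1,3)] int[OF K(2,4)] by (simp add: conv_alt right_diff_distrib)
  also have "norm \<dots> \<le> (LINT w|lborel. norm (G (z - w) * (K w - L w)))" by (rule integral_norm_bound)
  also have "\<dots> \<le> (LINT w|lborel. C * \<bar>K w - L w\<bar>)"
  proof (rule integral_mono_AE)
    show "integrable lborel (\<lambda>w. norm (G (z - w) * (K w - L w)))"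
      using int[OF K(1,3)] int[OF K(2,4)] by (simp add: right_diff_distrib)
    show "integrable lborel (\<lambda>w. C * \<bar>K w - L w\<bar>)" using K by simp
    show "AE w in lborel. norm (G (z - w) * (K w - L w)) \<le> C * \<bar>K w - L w\<bar>"
      using AEC
    proof eventually_elim
      case (elim w)
      then show ?case using K(3,4)[of w] by (cases "norm w \<le> 1") (auto simp: abs_mult intro!: mult_right_mono)
    qed
  qed
  finally show ?thesis by simp
qed

lemma dPhi_outside: "norm z > 1 \<Longrightarrow> dPhi b s z = 0"
  by (simp add: dPhi_def cutoff_eq_0 pd_cutoff_outside)

lemma ae_loc_bounded_loc_int:
  assumes G: "G \<in> borel_measurable borel" "ae_loc_bounded G" shows "loc_int G"
  unfolding loc_int_def
proof
  fix R
  obtain C where C: "AE z in lborel. norm z \<le> R \<longrightarrow> \<bar>G z\<bar> \<le> C" using G(2) unfolding ae_loc_bounded_def by blast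
  show "integrable lborel (\<lambda>w. indicator (cball 0 R) w * G w)"
  proof (rule Bochner_Integration.integrable_bound)
    show "integrable lborel (\<lambda>w::complex. indicator (cball 0 R) w * C)"
      using emeasure_lborel_cball_finite[of "0::complex" R]
      by (intro integrable_mult_left integrable_real_indicator) auto
    show "(\<lambda>w. indicator (cball 0 R) w * G w) \<in> borel_measurable lborel"
      using G(1) by (intro borel_measurable_times borel_measurable_indicator) auto
    show "AE w in lborel. norm (indicator (cball 0 R) w * G w) \<le> norm (indicator (cball 0 R) w * C)"
      using C by eventually_elim (auto simp: indicator_def)
  qed
qed

text \<open>The singular kernel gains one derivative: the regularized potentials converge uniformly together
  with their first derivatives, since the gradient of the kernel is still integrable.\<close>

lemma Phi_potential_C1:
  assumes G: "G \<in> borel_measurable borel" "ae_loc_bounded G"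
  shows "Ckv (Suc 0) (conv (Phi 0) G)"
proof (rule Ckv_SucI)
  have L: "loc_int G" by (rule ae_loc_bounded_loc_int[OF G])
  have bs: "bsupp (Phi s)" for s by (rule bsuppI[of 1]) (simp add: Phi_outside)
  have bd: "bsupp (dPhi b s)" for b s by (rule bsuppI[of 1]) (simp add: dPhi_outside)
  have pdP: "pd b (Phi (sreg n)) = dPhi b (sreg n)" for b n using pd_Phi[OF sreg(1)] by blast
  have unif: "\<forall>\<^sub>F n in sequentially. \<forall>x\<in>ball z 1. \<bar>conv (dPhi b (sreg n)) G x - conv (dPhi b 0) G x\<bar> \<le> e"
    if e: "e > 0" and b: "b \<in> Basis" for e b z
  proof -
    obtain C where C: "AE x in lborel. norm x \<le> (norm z + 1) + 1 \<longrightarrow> \<bar>G x\<bar> \<le> C"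
      using G(2) unfolding ae_loc_bounded_def by blast
    have "(\<lambda>n. C * (LINT z|lborel. \<bar>dPhi b (sreg n) z - dPhi b 0 z\<bar>)) \<longlonglongrightarrow> C * 0"
      by (intro tendsto_intros dPhi_L1 b)
    then have "\<forall>\<^sub>F n in sequentially. C * (LINT z|lborel. \<bar>dPhi b (sreg n) z - dPhi b 0 z\<bar>) < e"
      using e by (simp add: order_tendsto_iff)
    then show ?thesis
    proof eventually_elim
      case (elim n)
      show ?case
      proof
        fix x assume "x \<in> ball z 1"
        then have x: "norm x \<le> norm z + 1" using norm_triangle_ineq2[of x z] by (simp add: dist_norm norm_minus_commute)
        show "\<bar>conv (dPhi b (sreg n)) G x - conv (dPhi b 0) G x\<bar> \<le> e"
          using conv_diff_bound[OF G(1) C dPhi_L1(1)[OF b] dPhi_L1(2)[OF b] dPhi_outside dPhi_outside x, of n] elim by linarith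
      qed
    qed
  qed
  show "(conv (Phi 0) G has_derivative (\<lambda>h. \<Sum>b\<in>Basis. (h \<bullet> b) *\<^sub>R conv (dPhi b 0) G z)) (at z)" for z
  proof -
    have lim: "(\<lambda>n. conv (Phi (sreg n)) G x) \<longlonglongrightarrow> conv (Phi 0) G x" for x
    proof -
      obtain C where C: "AE y in lborel. norm y \<le> norm x + 1 \<longrightarrow> \<bar>G y\<bar> \<le> C"
        using G(2) unfolding ae_loc_bounded_def by blast
      have "(\<lambda>n. C * (LINT z|lborel. \<bar>Phi (sreg n) z - Phi 0 z\<bar>)) \<longlonglongrightarrow> C * 0"
        by (intro tendsto_intros Phi_L1)
      then have lim0: "(\<lambda>n. C * (LINT z|lborel. \<bar>Phi (sreg n) z - Phi 0 z\<bar>)) \<longlonglongrightarrow> 0" by simp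
      have PhiO: "Phi s y = 0" if "norm y > 1" for s y using that by (simp add: Phi_outside)
      have bnd: "norm (conv (Phi (sreg n)) G x - conv (Phi 0) G x) \<le> C * (LINT z|lborel. \<bar>Phi (sreg n) z - Phi 0 z\<bar>)" for n
        using conv_diff_bound[OF G(1) C Phi_L1(1)[of n] Phi_L1(2) PhiO PhiO order_refl] by simp
      have "(\<lambda>n. conv (Phi (sreg n)) G x - conv (Phi 0) G x) \<longlonglongrightarrow> 0"
        by (rule Lim_null_comparison[OF _ lim0]) (rule always_eventually, rule allI, rule bnd)
      then show ?thesis by (simp add: LIM_zero_iff)
    qed
    have "\<exists>g. \<forall>x\<in>ball z 1. (\<lambda>n. conv (Phi (sreg n)) G x) \<longlonglongrightarrow> g x \<and>
       (g has_derivative (\<lambda>h. \<Sum>b\<in>Basis. (h \<bullet> b) *\<^sub>R conv (dPhi b 0) G x)) (at x within ball z 1)"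
    proof (rule has_derivative_sequence[where f'="\<lambda>n x h. \<Sum>b\<in>Basis. (h \<bullet> b) *\<^sub>R conv (dPhi b (sreg n)) G x"])
      show "((\<lambda>n. conv (Phi (sreg n)) G z) \<longlongrightarrow> conv (Phi 0) G z) sequentially" by (rule lim)
      show "(conv (Phi (sreg n)) G has_derivative (\<lambda>h. \<Sum>b\<in>Basis. (h \<bullet> b) *\<^sub>R conv (dPhi b (sreg n)) G x)) (at x within ball z 1)" for n x
        using conv_has_derivative[OF L disjI2[OF bs] smoothD[OF smooth_Phi[OF sreg(1)[of n]]], of x]
        unfolding pdP by (rule has_derivative_at_withinI)
      fix e :: real assume e: "e > 0"
      have "\<forall>\<^sub>F n in sequentially. \<forall>b\<in>Basis. \<forall>x\<in>ball z 1. \<bar>conv (dPhi b (sreg n)) G x - conv (dPhi b 0) G x\<bar> \<le> e / 2"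
        using unif[of "e / 2"] e by (intro eventually_ball_finite) auto
      then show "\<forall>\<^sub>F n in sequentially. \<forall>x\<in>ball z 1. \<forall>h. norm ((\<Sum>b\<in>Basis. (h \<bullet> b) *\<^sub>R conv (dPhi b (sreg n)) G x)
          - (\<Sum>b\<in>Basis. (h \<bullet> b) *\<^sub>R conv (dPhi b 0) G x)) \<le> e * norm h"
      proof eventually_elim
        case (elim n)
        show ?case
        proof (intro ballI allI)
          fix x h assume x: "x \<in> ball z 1"
          have "norm (\<Sum>b\<in>Basis. (h \<bullet> b) *\<^sub>R (conv (dPhi b (sreg n)) G x - conv (dPhi b 0) G x))
             \<le> (\<Sum>b\<in>(Basis :: complex set). norm h * (e / 2))"
          proof (rule sum_norm_le)
            fix b :: complex assume b: "b \<in> Basis"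
            show "norm ((h \<bullet> b) *\<^sub>R (conv (dPhi b (sreg n)) G x - conv (dPhi b 0) G x)) \<le> norm h * (e / 2)"
              unfolding real_norm_def real_scaleR_def abs_mult using elim b x
              by (intro mult_mono Basis_le_norm) auto
          qed
          then show "norm ((\<Sum>b\<in>Basis. (h \<bullet> b) *\<^sub>R conv (dPhi b (sreg n)) G x)
             - (\<Sum>b\<in>Basis. (h \<bullet> b) *\<^sub>R conv (dPhi b 0) G x)) \<le> e * norm h"
            by (simp add: sum_subtractf right_diff_distrib mult.commute)
        qed
      qed
    qed auto
    then obtain g where g: "\<And>x. x \<in> ball z 1 \<Longrightarrow> (\<lambda>n. conv (Phi (sreg n)) G x) \<longlonglongrightarrow> g x"
      "\<And>x. x \<in> ball z 1 \<Longrightarrow> (g has_derivative (\<lambda>h. \<Sum>b\<in>Basis. (h \<bullet> b) *\<^sub>R conv (dPhi b 0) G x)) (at x within ball z 1)"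
      by blast
    have geq: "g x = conv (Phi 0) G x" if "x \<in> ball z 1" for x
      using LIMSEQ_unique[OF g(1)[OF that] lim] .
    have "(g has_derivative (\<lambda>h. \<Sum>b\<in>Basis. (h \<bullet> b) *\<^sub>R conv (dPhi b 0) G z)) (at z)"
      using g(2)[of z] at_within_open[of z "ball z 1"] by simp
    moreover have "open (ball z 1)" "z \<in> ball z 1" by auto
    ultimately show ?thesis by (rule has_derivative_transform_within_open) (simp add: geq)
  qed
  fix c :: complex assume "c \<in> Basis"
  have "continuous_on UNIV (conv (dPhi b 0) G)" if b: "b \<in> Basis" for b
  proof -
    have "isCont (conv (dPhi b 0) G) z" for z
    proof -
      have "continuous_on (ball z 1) (conv (dPhi b 0) G)"
      proof (rule uniform_limit_theorem)
        have c: "continuous_on UNIV (conv (dPhi b (sreg n)) G)" for n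
          unfolding pdP[symmetric] using b
          by (intro conv_continuous L disjI2 bsupp_pd bs smooth_continuous smooth_pd smooth_Phi sreg)
        show "\<forall>\<^sub>F n in sequentially. continuous_on (ball z 1) (conv (dPhi b (sreg n)) G)"
          by (rule always_eventually, rule allI, rule continuous_on_subset[OF c subset_UNIV])
        show "uniform_limit (ball z 1) (\<lambda>n. conv (dPhi b (sreg n)) G) (conv (dPhi b 0) G) sequentially"
        proof (rule uniform_limitI)
          fix e :: real assume e: "e > 0"
          have "\<forall>\<^sub>F n in sequentially. \<forall>x\<in>ball z 1. \<bar>conv (dPhi b (sreg n)) G x - conv (dPhi b 0) G x\<bar> \<le> e / 2"
            using e by (intro unif b) simp
          then show "\<forall>\<^sub>F n in sequentially. \<forall>x\<in>ball z 1. dist (conv (dPhi b (sreg n)) G x) (conv (dPhi b 0) G x) < e"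
          proof eventually_elim
            case (elim n)
            show ?case
            proof
              fix x assume "x \<in> ball z 1"
              with elim e show "dist (conv (dPhi b (sreg n)) G x) (conv (dPhi b 0) G x) < e"
                unfolding dist_real_def by (smt (verit) field_sum_of_halves)
            qed
          qed
        qed
      qed auto
      then show ?thesis by (rule continuous_on_interior) (simp add: interior_open)
    qed
    then show ?thesis by (simp add: continuous_at_imp_continuous_on)
  qed
  then show "Ckv 0 (\<lambda>z. \<Sum>b\<in>Basis. (c \<bullet> b) *\<^sub>R conv (dPhi b 0) G z)"
    by (simp only: Ckv.simps) (intro continuous_on_sum continuous_on_scaleR continuous_on_const)
qed

text \<open>The first derivative is gained from the kernel by \<open>Phi_potential_C1\<close>. For
  higher orders the convolution is commuted, so that \<open>Phi 0\<close> becomes the integrable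
  density of bounded support and the derivative falls on \<open>G\<close>.\<close>

lemma Phi_potential_gain: "Ckv k G \<Longrightarrow> Ckv (Suc k) (conv (Phi 0) G)"
proof (induction k arbitrary: G)
  case 0
  then have "continuous_on UNIV G" by simp
  then show ?case
    by (intro Phi_potential_C1 ae_loc_bounded_continuous borel_measurable_continuous_onI)
next
  case (Suc k)
  have P: "loc_int (Phi 0)" "bsupp (Phi 0)"
    by (auto intro!: loc_int_integrable Phi_L1 bsuppI[of 1] simp: Phi_outside)
  have G1: "Ckv (Suc 0) G" using Suc.prems by (rule Ckv_mono) simp
  show ?case
    unfolding conv_commute[of "Phi 0" G]
  proof (subst Ckv.simps(2), intro conjI ballI)
    show "conv G (Phi 0) differentiable_on UNIV"
      using conv_has_derivative[OF P(1) disjI1[OF P(2)] G1]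
      unfolding differentiable_on_def differentiable_def by (blast intro: has_derivative_at_withinI)
    fix b :: complex assume b: "b \<in> Basis"
    have "Ckv (Suc k) (conv (Phi 0) (pd b G))" using Suc b by simp
    then show "Ckv (Suc k) (pd b (conv G (Phi 0)))"
      using pd_conv[OF P(1) disjI1[OF P(2)] G1 b] by (simp add: conv_commute[of "Phi 0"] del: Ckv.simps)
  qed
qed

section \<open>Regularity of weak solutions\<close>

text \<open>Away from the origin this is the positive part of the negative logarithm; it majorizes
  the negative of \<open>2 * pi * Phi 0\<close> and carries no cutoff factor.\<close>

definition neglog :: "complex \<Rightarrow> real" where
  "neglog x = (if norm x \<le> 1 then - ln (norm x) else 0)"

lemma neglog_nonneg: "neglog x \<ge> 0"
  by (cases "x = 0") (auto simp: neglog_def)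

lemma neglog_measurable [measurable]: "neglog \<in> borel_measurable borel"
  unfolding neglog_def[abs_def] by measurable

lemma exp_neglog_le: "exp (neglog x) \<le> 1 + invnorm x"
proof (cases "norm x \<le> 1 \<and> x \<noteq> 0")
  case True
  then have "exp (neglog x) = invnorm x" by (simp add: neglog_def invnorm_def exp_minus inverse_eq_divide)
  then show ?thesis by simp
next
  case False
  then have "neglog x = 0" by (auto simp: neglog_def)
  then show ?thesis using invnorm_nonneg[of x] by simp
qed

text \<open>From \<open>ln t <= 2 * sqrt t\<close> at \<open>t = 1 / norm x\<close>. Square
  integrability of the logarithm is what will be paired with that of the density.\<close>

lemma neglog_sq_le: "(neglog x)\<^sup>2 \<le> 4 * invnorm x"
proof (cases "norm x \<le> 1 \<and> x \<noteq> 0")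
  case True
  let ?t = "1 / norm x"
  have t: "?t \<ge> 1" using True by simp
  have "ln ?t = 2 * ln (sqrt ?t)" using t by (simp add: ln_sqrt)
  also have "\<dots> \<le> 2 * sqrt ?t" using ln_le_minus_one[of "sqrt ?t"] t True by simp
  finally have "ln ?t \<le> 2 * sqrt ?t" .
  moreover have "ln ?t \<ge> 0" using t by simp
  ultimately have "(ln ?t)\<^sup>2 \<le> (2 * sqrt ?t)\<^sup>2" by (intro power_mono)
  also have "\<dots> = 4 * ?t" using t by (simp add: power_mult_distrib)
  finally show ?thesis using True by (simp add: neglog_def invnorm_def ln_div)
next
  case False
  then have "neglog x = 0" by (auto simp: neglog_def)
  then show ?thesis using invnorm_nonneg[of x] by simp
qed

lemma integrable_neglog: "integrable lborel neglog"
proof (rule Bochner_Integration.integrable_bound[OF integrable_invnorm])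
  have "neglog x \<le> invnorm x" for x
    using exp_neglog_le[of x] exp_ge_add_one_self[of "neglog x"] by linarith
  then show "AE x in lborel. norm (neglog x) \<le> norm (invnorm x)"
    by (intro AE_I2) (use neglog_nonneg invnorm_nonneg in \<open>simp add: abs_of_nonneg\<close>)
qed measurable

lemma Phi_0_neglog:
  shows "- Phi 0 x \<le> 1 / (2 * pi) * neglog x" "Phi 0 x \<le> 0"
proof -
  have "elog 0 x = - (1 / (2 * pi) * neglog x)" if "norm x \<le> 1"
    using that by (cases "x = 0") (auto simp: elog_def neglog_def ln_realpow)
  then have eq: "Phi 0 x = - (cutoff x * (1 / (2 * pi) * neglog x))"
    by (cases "norm x \<le> 1") (auto simp: Phi_def cutoff_eq_0)
  have p: "0 \<le> 1 / (2 * pi) * neglog x" using neglog_nonneg by simp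
  show "- Phi 0 x \<le> 1 / (2 * pi) * neglog x"
    unfolding eq using mult_right_mono[OF cutoff_le_1[of x] p] by simp
  show "Phi 0 x \<le> 0" unfolding eq using mult_nonneg_nonneg[OF cutoff_nonneg[of x] p] by simp
qed

text \<open>Mass at distance more than \<open>2 * r\<close> from \<open>a\<close> is at distance at
  least \<open>r\<close> from \<open>z\<close>, where the logarithmic kernel is at most
  \<open>ln (1 / r)\<close>; only the near mass keeps its singular kernel.\<close>

lemma potential_near_far:
  assumes g: "integrable lborel g" "\<And>w. g w \<ge> 0" and r: "0 < r" "r \<le> 1" and z: "z \<in> cball a r"
    and i1: "integrable lborel (\<lambda>w. g w * Phi 0 (z - w))"
    and i2: "integrable lborel (\<lambda>w. (indicator (cball a (2 * r)) w * g w) * neglog (z - w))"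
  shows "- conv (Phi 0) g z \<le> 1 / (2 * pi) * (conv neglog (\<lambda>w. indicator (cball a (2 * r)) w * g w) z + ln (1 / r) * (LINT w|lborel. g w))"
proof -
  let ?n = "\<lambda>w. (indicator (cball a (2 * r)) w * g w) * neglog (z - w)"
  have "- conv (Phi 0) g z = (LINT w|lborel. - (g w * Phi 0 (z - w)))" by (simp add: conv_def)
  also have "\<dots> \<le> (LINT w|lborel. 1 / (2 * pi) * (?n w + ln (1 / r) * g w))"
  proof (rule integral_mono)
    show "integrable lborel (\<lambda>w. - (g w * Phi 0 (z - w)))" using i1 by simp
    show "integrable lborel (\<lambda>w. 1 / (2 * pi) * (?n w + ln (1 / r) * g w))"
      using i2 g by (intro integrable_mult_right Bochner_Integration.integrable_add) auto
    fix w
    have "neglog (z - w) \<le> indicator (cball a (2 * r)) w * neglog (z - w) + ln (1 / r)"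
    proof (cases "w \<in> cball a (2 * r)")
      case True
      then show ?thesis using r by simp
    next
      case False
      have "norm (w - a) \<le> norm (z - w) + norm (z - a)"
        using norm_triangle_ineq[of "w - z" "z - a"] by (simp add: norm_minus_commute)
      then have "norm (z - w) \<ge> r" using False z by (simp add: dist_norm norm_minus_commute)
      then have "- ln (norm (z - w)) \<le> ln (1 / r)" using r by (simp add: ln_div) (subst ln_le_cancel_iff; linarith)
      then show ?thesis using False r by (auto simp: neglog_def)
    qed
    then have "g w * neglog (z - w) \<le> ?n w + ln (1 / r) * g w"
      using mult_left_mono[OF _ g(2)[of w]] by (fastforce simp: algebra_simps)
    then have "1 / (2 * pi) * (g w * neglog (z - w)) \<le> 1 / (2 * pi) * (?n w + ln (1 / r) * g w)"
      by (rule mult_left_mono) simp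
    moreover have "- (g w * Phi 0 (z - w)) \<le> 1 / (2 * pi) * (g w * neglog (z - w))"
      using mult_left_mono[OF Phi_0_neglog(1)[of "z - w"] g(2)[of w]] by (simp add: mult_ac)
    ultimately show "- (g w * Phi 0 (z - w)) \<le> 1 / (2 * pi) * (?n w + ln (1 / r) * g w)" by linarith
  qed
  also have "\<dots> = 1 / (2 * pi) * (conv neglog (\<lambda>w. indicator (cball a (2 * r)) w * g w) z + ln (1 / r) * (LINT w|lborel. g w))"
    using i2 g by (simp add: conv_def)
  finally show ?thesis .
qed

text \<open>Jensen's inequality through the tangent of exp at the value \<open>c\<close> of the
  averaged logarithm. Dividing by pi makes \<open>m\<close> a measure of mass \<mu> at most 1, so
  the exponential of the logarithmic kernel contributes no worse than 1/|x|, which is integrable in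
  the plane.\<close>

lemma exp_potential_le:
  assumes m: "integrable lborel m" "\<And>w. m w \<ge> 0" "(LINT w|lborel. m w) \<le> pi"
    and i: "integrable lborel (\<lambda>w. m w * neglog (z - w))" "integrable lborel (\<lambda>w. m w * invnorm (z - w))"
  shows "exp (conv neglog m z / pi) \<le> 2 + conv invnorm m z / pi"
proof -
  define c where "c = conv neglog m z / pi"
  define \<mu> where "\<mu> = (LINT w|lborel. m w) / pi"
  have \<mu>: "0 \<le> \<mu>" "\<mu> \<le> 1"
    using m by (auto simp: \<mu>_def intro!: divide_nonneg_pos integral_nonneg_AE AE_I2)
  have c: "c \<ge> 0" unfolding c_def conv_def
    using m neglog_nonneg by (intro divide_nonneg_pos integral_nonneg_AE AE_I2) auto
  have "exp c * (\<mu> * (1 - c) + c) = (LINT w|lborel. exp c * (m w * (1 - c) + m w * neglog (z - w)) / pi)"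
  proof -
    have "(LINT w|lborel. m w * neglog (z - w)) = c * pi" "(LINT w|lborel. m w) = \<mu> * pi"
      by (simp_all add: c_def conv_def \<mu>_def)
    moreover have "(LINT w|lborel. exp c * (m w * (1 - c) + m w * neglog (z - w)) / pi)
       = exp c * ((LINT w|lborel. m w) * (1 - c) + (LINT w|lborel. m w * neglog (z - w))) / pi"
      using m i by simp
    ultimately show ?thesis by (simp add: field_simps)
  qed
  also have "\<dots> \<le> (LINT w|lborel. (m w + m w * invnorm (z - w)) / pi)"
  proof (rule integral_mono)
    show "integrable lborel (\<lambda>w. exp c * (m w * (1 - c) + m w * neglog (z - w)) / pi)"
         "integrable lborel (\<lambda>w. (m w + m w * invnorm (z - w)) / pi)" using m i by auto
    fix w
    have "exp c * (1 + (neglog (z - w) - c)) \<le> exp c * exp (neglog (z - w) - c)"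
      by (intro mult_left_mono exp_ge_add_one_self) auto
    also have "\<dots> = exp (neglog (z - w))" by (simp add: exp_diff)
    also have "\<dots> \<le> 1 + invnorm (z - w)" by (rule exp_neglog_le)
    finally have "m w * (exp c * (1 + (neglog (z - w) - c))) \<le> m w * (1 + invnorm (z - w))"
      by (rule mult_left_mono[OF _ m(2)])
    then show "exp c * (m w * (1 - c) + m w * neglog (z - w)) / pi \<le> (m w + m w * invnorm (z - w)) / pi"
      by (intro divide_right_mono) (simp_all add: algebra_simps)
  qed
  also have "\<dots> = \<mu> + conv invnorm m z / pi" using m i by (simp add: \<mu>_def conv_def add_divide_distrib)
  finally have 1: "exp c * (\<mu> * (1 - c) + c) \<le> \<mu> + conv invnorm m z / pi" .
  \<comment> \<open>The missing mass \<open>1 - \<mu>\<close> is treated as if the logarithm were 0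
    there: this is the tangent inequality at 0.\<close>
  have "exp c * (1 - c) \<le> exp c * exp (- c)" using exp_ge_add_one_self[of "- c"] by (intro mult_left_mono) auto
  then have "exp c * (1 - c) \<le> 1" by (simp add: exp_minus)
  then have 2: "(1 - \<mu>) * (exp c * (1 - c)) \<le> (1 - \<mu>) * 1" using \<mu> by (intro mult_left_mono) auto
  have "exp c = exp c * (\<mu> * (1 - c) + c) + (1 - \<mu>) * (exp c * (1 - c))" by (simp add: algebra_simps)
  from order_trans[OF eq_refl[OF this] add_mono[OF 1 2]] have "exp c \<le> 2 + conv invnorm m z / pi" by simp
  then show ?thesis by (simp add: c_def)
qed

lemma small_mass_ball:
  fixes g :: "complex \<Rightarrow> real"
  assumes g: "integrable lborel g" and e: "e > 0"
  obtains r where "0 < r" "r \<le> 1" "(LINT w|lborel. indicator (cball a (2 * r)) w * g w) \<le> e"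
proof -
  have [measurable]: "g \<in> borel_measurable borel" using g by auto
  have "(\<lambda>n. LINT w|lborel. indicator (cball a (2 * sreg n)) w * g w) \<longlonglongrightarrow> (LINT w|(lborel::complex measure). (0::real))"
  proof (rule integral_dominated_convergence)
    show "integrable lborel (\<lambda>w. \<bar>g w\<bar>)" using g by simp
    show "AE w in lborel. (\<lambda>n. indicator (cball a (2 * sreg n)) w * g w) \<longlonglongrightarrow> 0"
      using AE_lborel_singleton[of a]
    proof eventually_elim
      case (elim w)
      have "(\<lambda>n. 2 * sreg n) \<longlonglongrightarrow> 2 * 0" by (intro tendsto_intros sreg)
      then have "\<forall>\<^sub>F n in sequentially. 2 * sreg n < dist a w" using elim by (simp add: order_tendsto_iff)
      then show ?case by (intro tendsto_eventually) (auto elim!: eventually_mono)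
    qed
    show "AE w in lborel. norm (indicator (cball a (2 * sreg n)) w * g w) \<le> \<bar>g w\<bar>" for n
      by (intro AE_I2) (auto split: split_indicator)
    show "(\<lambda>w. indicator (cball a (2 * sreg n)) w * g w) \<in> borel_measurable lborel" for n
      by (intro borel_measurable_times borel_measurable_indicator) auto
  qed simp
  then have "\<forall>\<^sub>F n in sequentially. (LINT w|lborel. indicator (cball a (2 * sreg n)) w * g w) < e"
    using e by (simp add: order_tendsto_iff)
  then obtain n where "(LINT w|lborel. indicator (cball a (2 * sreg n)) w * g w) < e"
    using eventually_happens by force
  then show ?thesis using that[of "sreg n"] sreg(1,2)[of n] by simp
qed

lemma integrable_indicator_cball:
  fixes g :: "complex \<Rightarrow> real"
  shows "integrable lborel g \<Longrightarrow> integrable lborel (\<lambda>w. indicator (cball a r) w * g w)"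
  using integrable_mult_indicator[of "cball a r" lborel g] by simp

text \<open>The argument of Brezis and Merle: on a ball of small mass, \<open>g\<close> is square integrable by Jensen's
  inequality; then the potential of \<open>g\<close> is bounded on a smaller ball.\<close>

lemma Brezis_Merle_local:
  assumes psi: "\<psi> \<in> borel_measurable borel" and G0: "continuous_on UNIV G0"
    and g: "integrable lborel g" "\<And>z. g z = h z * exp (\<psi> z)"
    and h: "continuous_on UNIV h" "\<And>z. h z \<ge> 0"
    and par: "AE z in lborel. \<psi> z = G0 z - conv (Phi 0) g z"
  obtains r C where "r > 0" "AE z in lborel. z \<in> cball a r \<longrightarrow> g z \<le> C"
proof -
  have g0: "g z \<ge> 0" for z using g(2) h(2) by simp
  have [measurable]: "g \<in> borel_measurable borel" using g by auto
  \<comment> \<open>The threshold pi is chosen for the square of \<open>g\<close>: doubling \<psi>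
    turns the factor 1/(2 pi) of the potential into 1/pi, as in
    \<open>exp_potential_le\<close>.\<close>
  obtain r where r: "0 < r" "r \<le> 1" "(LINT w|lborel. indicator (cball a (2 * r)) w * g w) \<le> pi"
    using small_mass_ball[OF g(1) pi_gt_zero] by blast
  obtain C1 where C1: "\<And>x. x \<in> cball a r \<Longrightarrow> norm (G0 x) \<le> C1" using continuous_bounded_on_cball[OF G0] by metis
  obtain Ch where Ch: "Ch > 0" "\<And>x. x \<in> cball a r \<Longrightarrow> norm (h x) \<le> Ch" using continuous_bounded_on_cball[OF h(1)] by metis
  define m where "m = (\<lambda>w. indicator (cball a (2 * r)) w * g w)"
  define M where "M = (LINT w|lborel. g w)"
  have M: "M \<ge> 0" unfolding M_def using g0 by (intro integral_nonneg_AE AE_I2) auto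
  have m: "integrable lborel m" "\<And>w. m w \<ge> 0" unfolding m_def
    using integrable_indicator_cball[OF g(1)] g0 by auto
  have A1: "AE z in lborel. integrable lborel (\<lambda>w. g w * Phi 0 (z - w))" by (rule conv_AE_integrable[OF Phi_L1(2) g(1)])
  have A2: "AE z in lborel. integrable lborel (\<lambda>w. m w * neglog (z - w))" by (rule conv_AE_integrable[OF integrable_neglog m(1)])
  have A3: "AE z in lborel. integrable lborel (\<lambda>w. m w * invnorm (z - w))" by (rule conv_AE_integrable[OF integrable_invnorm m(1)])
  define C2 where "C2 = C1 + 1 / (2 * pi) * (ln (1 / r) * M)"
  have sq: "AE z in lborel. z \<in> cball a r \<longrightarrow> (g z)\<^sup>2 \<le> Ch\<^sup>2 * exp (2 * C2) * (2 + conv invnorm m z / pi)"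
    using par A1 A2 A3
  proof eventually_elim
    case (elim z)
    show ?case
    proof
      assume z: "z \<in> cball a r"
      have "\<psi> z \<le> C2 + conv neglog m z / (2 * pi)"
        using potential_near_far[OF g(1) g0 r(1,2) z elim(2) elim(3)[unfolded m_def], folded m_def] elim(1) C1[OF z]
        by (simp add: C2_def M_def algebra_simps)
      then have "2 * \<psi> z \<le> 2 * C2 + conv neglog m z / pi" by simp
      then have "exp (2 * \<psi> z) \<le> exp (2 * C2) * exp (conv neglog m z / pi)"
        by (simp flip: exp_add)
      also have "\<dots> \<le> exp (2 * C2) * (2 + conv invnorm m z / pi)"
        using exp_potential_le[OF m r(3)[folded m_def] elim(3,4)] by (intro mult_left_mono) auto
      finally have e: "exp (2 * \<psi> z) \<le> exp (2 * C2) * (2 + conv invnorm m z / pi)" .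
      have "(g z)\<^sup>2 = (h z)\<^sup>2 * exp (2 * \<psi> z)" by (simp add: g(2) power_mult_distrib exp_double)
      also have "\<dots> \<le> Ch\<^sup>2 * (exp (2 * C2) * (2 + conv invnorm m z / pi))"
        using e Ch(2)[OF z] h(2)[of z] by (intro mult_mono power_mono) auto
      finally show "(g z)\<^sup>2 \<le> Ch\<^sup>2 * exp (2 * C2) * (2 + conv invnorm m z / pi)" by (simp add: mult.assoc)
    qed
  qed
  define G2 where "G2 = (\<lambda>z. indicator (cball a r) z * (g z)\<^sup>2)"
  have G2: "integrable lborel G2"
  proof (rule Bochner_Integration.integrable_bound)
    have "integrable lborel (\<lambda>z. indicator (cball a r) z * (Ch\<^sup>2 * exp (2 * C2) * 2) + Ch\<^sup>2 * exp (2 * C2) * (conv invnorm m z / pi))"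
      using conv_integrable[OF integrable_invnorm m(1)] emeasure_lborel_cball_finite[of a r]
      by (intro Bochner_Integration.integrable_add integrable_mult_left integrable_mult_right integrable_divide integrable_real_indicator) auto
    then show "integrable lborel (\<lambda>z. indicator (cball a r) z * (Ch\<^sup>2 * exp (2 * C2) * 2) + Ch\<^sup>2 * exp (2 * C2) * (conv invnorm m z / pi))" .
    show "G2 \<in> borel_measurable lborel" unfolding G2_def
      by (intro borel_measurable_times borel_measurable_indicator) auto
    have J: "conv invnorm m z \<ge> 0" for z unfolding conv_def
      using m(2) invnorm_nonneg by (intro integral_nonneg_AE AE_I2) auto
    show "AE z in lborel. norm (G2 z) \<le> norm (indicator (cball a r) z * (Ch\<^sup>2 * exp (2 * C2) * 2) + Ch\<^sup>2 * exp (2 * C2) * (conv invnorm m z / pi))"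
      using sq
    proof eventually_elim
      case (elim z)
      show ?case
      proof (cases "z \<in> cball a r")
        case True
        then show ?thesis using elim J[of z] by (simp add: G2_def algebra_simps abs_of_nonneg)
      qed (simp add: G2_def)
    qed
  qed
  define C3 where "C3 = C1 + 1 / (2 * pi) * ((4 * (LINT w|lborel. invnorm w) + (LINT w|lborel. G2 w)) + ln (1 / (r / 2)) * M)"
  \<comment> \<open>The radius \<open>2 * (r / 2)\<close> is \<open>r\<close>, so for
    \<open>z\<close> in the ball of radius \<open>r / 2\<close> the near mass lies exactly where
    \<open>g\<close> is known to be square integrable.\<close>
  define m' where "m' = (\<lambda>w. indicator (cball a (2 * (r / 2))) w * g w)"
  have m': "integrable lborel m'" unfolding m'_def by (rule integrable_indicator_cball[OF g(1)])
  have A4: "AE z in lborel. integrable lborel (\<lambda>w. m' w * neglog (z - w))" by (rule conv_AE_integrable[OF integrable_neglog m'])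
  have "AE z in lborel. z \<in> cball a (r / 2) \<longrightarrow> g z \<le> Ch * exp C3"
    using par A1 A4
  proof eventually_elim
    case (elim z)
    show ?case
    proof
      assume z: "z \<in> cball a (r / 2)"
      then have z': "z \<in> cball a r" using r by simp
      have "conv neglog m' z \<le> (LINT w|lborel. 4 * invnorm (z - w) + G2 w)"
        unfolding conv_def real_scaleR_def
      proof (rule integral_mono[OF elim(3)])
        show "integrable lborel (\<lambda>w. 4 * invnorm (z - w) + G2 w)"
          using G2 integrable_invnorm by (simp add: lborel_integrable_reflect)
        fix w
        show "m' w * neglog (z - w) \<le> 4 * invnorm (z - w) + G2 w"
        proof (cases "w \<in> cball a r")
          case True
          have "2 * (g w * neglog (z - w)) \<le> (g w)\<^sup>2 + (neglog (z - w))\<^sup>2"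
            using sum_squares_bound[of "g w" "neglog (z - w)"] by simp
          moreover have "0 \<le> g w * neglog (z - w)" using g0 neglog_nonneg by simp
          ultimately show ?thesis using neglog_sq_le[of "z - w"] True by (simp add: m'_def G2_def)
        next
          case False
          then show ?thesis using invnorm_nonneg[of "z - w"] by (simp add: m'_def G2_def)
        qed
      qed
      also have "\<dots> = 4 * (LINT w|lborel. invnorm w) + (LINT w|lborel. G2 w)"
        using G2 integrable_invnorm by (simp add: lborel_integrable_reflect lborel_integral_reflect[of invnorm])
      finally have V: "conv neglog m' z \<le> 4 * (LINT w|lborel. invnorm w) + (LINT w|lborel. G2 w)" .
      have "r / 2 > 0" "r / 2 \<le> 1" using r by auto
      from potential_near_far[OF g(1) g0 this z elim(2) elim(3)[unfolded m'_def], folded m'_def]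
      have "- conv (Phi 0) g z \<le> 1 / (2 * pi) * (conv neglog m' z + ln (1 / (r / 2)) * M)" by (simp only: M_def)
      also have "\<dots> \<le> 1 / (2 * pi) * ((4 * (LINT w|lborel. invnorm w) + (LINT w|lborel. G2 w)) + ln (1 / (r / 2)) * M)"
        using V by (intro mult_left_mono add_right_mono) auto
      finally have "\<psi> z \<le> C3" using elim(1) C1[OF z'] unfolding C3_def by simp
      then show "g z \<le> Ch * exp C3"
        unfolding g(2) using Ch(2)[OF z'] h(2)[of z] by (intro mult_mono) auto
    qed
  qed
  then show ?thesis using that[of "r / 2"] r by simp
qed

text \<open>Finitely many of the balls from \<open>Brezis_Merle_local\<close> cover a given disc; as
  \<open>g\<close> is nonnegative, the upper bounds there bound its absolute value.\<close>

lemma Brezis_Merle: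
  assumes psi: "\<psi> \<in> borel_measurable borel" and G0: "continuous_on UNIV G0"
    and g: "integrable lborel g" "\<And>z. g z = h z * exp (\<psi> z)"
    and h: "continuous_on UNIV h" "\<And>z. h z \<ge> 0"
    and par: "AE z in lborel. \<psi> z = G0 z - conv (Phi 0) g z"
  shows "ae_loc_bounded g"
  unfolding ae_loc_bounded_def
proof
  fix R
  have "\<exists>r C. r > 0 \<and> (AE z in lborel. z \<in> cball a r \<longrightarrow> g z \<le> C)" for a
    using Brezis_Merle_local[OF assms, of a] by metis
  then obtain r C where r: "\<And>a. r a > 0" and C: "\<And>a. AE z in lborel. z \<in> cball a (r a) \<longrightarrow> g z \<le> C a" by metis
  have "cball 0 R \<subseteq> (\<Union>a\<in>cball 0 R. ball a (r a))" using r by force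
  then obtain D where D: "D \<subseteq> cball 0 R" "finite D" "cball 0 R \<subseteq> (\<Union>a\<in>D. ball a (r a))"
    using compactE_image[OF compact_cball, of "cball 0 R" "\<lambda>a. ball a (r a)" 0 R] by auto
  have "AE z in lborel. \<forall>a\<in>D. z \<in> cball a (r a) \<longrightarrow> g z \<le> C a"
    using C D(2) by (intro AE_finite_allI) auto
  then have "AE z in lborel. norm z \<le> R \<longrightarrow> \<bar>g z\<bar> \<le> (\<Sum>a\<in>D. \<bar>C a\<bar>)"
  proof eventually_elim
    case (elim z)
    show ?case
    proof
      assume "norm z \<le> R"
      then obtain a where a: "a \<in> D" "z \<in> ball a (r a)" using D(3) by auto
      then have "g z \<le> \<bar>C a\<bar>" using elim by fastforce
      also have "\<dots> \<le> (\<Sum>a\<in>D. \<bar>C a\<bar>)" using a D(2) by (intro member_le_sum) auto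
      finally show "\<bar>g z\<bar> \<le> (\<Sum>a\<in>D. \<bar>C a\<bar>)" using g(2) h(2) by simp
    qed
  qed
  then show "\<exists>C. AE z in lborel. norm z \<le> R \<longrightarrow> \<bar>g z\<bar> \<le> C" by blast
qed

text \<open>The right side of the parametrix identity is the continuous representative
  \<open>v\<close> of \<psi>. Inside the potential \<psi> may be replaced by \<open>v\<close>, so
  regularity of \<open>v\<close> passes to the density and returns to \<open>v\<close> with one more
  derivative, while the term with \<open>kap 0\<close> is smooth from the start.\<close>

theorem weak_solution_smooth:
  fixes \<psi> h :: "complex \<Rightarrow> real"
  assumes psi: "loc_int \<psi>" and h: "smooth h" "\<And>z. h z \<ge> 0"
    and g: "integrable lborel (\<lambda>z. h z * exp (\<psi> z))"
    and eq: "\<And>\<phi>. smooth \<phi> \<Longrightarrow> bsupp \<phi> \<Longrightarrow>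
       - (LINT x|lborel. \<psi> x * laplacian \<phi> x) = (LINT x|lborel. (h x * exp (\<psi> x)) * \<phi> x)"
  obtains v where "smooth v" "AE z in lborel. \<psi> z = v z"
proof -
  define g where "g = (\<lambda>z. h z * exp (\<psi> z))"
  note gi = g[folded g_def]
  define v where "v = (\<lambda>z. - conv (kap 0) \<psi> z - conv (Phi 0) g z)"
  have AEv: "AE z in lborel. \<psi> z = v z"
    unfolding v_def by (rule parametrix[OF psi gi]) (use eq in \<open>simp add: g_def\<close>)
  have s0: "smooth (conv (kap 0) \<psi>)" by (rule smooth_conv[OF psi disjI2[OF bsupp_kap] smooth_kap_0])
  have mpsi: "\<psi> \<in> borel_measurable borel" by (rule loc_int_measurable[OF psi])
  have bd: "ae_loc_bounded g"
  proof (rule Brezis_Merle[OF mpsi _ gi _ smooth_continuous[OF h(1)] h(2)])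
    show "continuous_on UNIV (\<lambda>z. - conv (kap 0) \<psi> z)" by (intro continuous_intros smooth_continuous s0)
    show "AE z in lborel. \<psi> z = - conv (kap 0) \<psi> z - conv (Phi 0) g z" using AEv by (simp add: v_def)
  qed (simp add: g_def)
  have v1: "Ckv (Suc 0) v" unfolding v_def
    by (intro Ckv_diff Ckv_minus smoothD[OF s0] Phi_potential_C1 bd borel_measurable_integrable[OF gi, simplified])
  have AEg: "AE z in lborel. g z = h z * exp (v z)" using AEv by eventually_elim (simp add: g_def)
  have vc: "continuous_on UNIV v" using v1 by (rule Ckv_imp_continuous)
  \<comment> \<open>The factor 1 in the exponent matches \<open>smooth_real_exp\<close>, which
    treats \<open>exp (c * x)\<close>.\<close>
  have conv_eq: "conv (Phi 0) g z = conv (Phi 0) (\<lambda>z. h z * exp (1 * v z)) z" for z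
    unfolding conv_def
  proof (rule integral_cong_AE)
    have [measurable]: "g \<in> borel_measurable borel" "v \<in> borel_measurable borel" "h \<in> borel_measurable borel"
      using gi vc smooth_measurable[OF h(1)] by (auto intro: borel_measurable_continuous_onI)
    show "(\<lambda>w. g w *\<^sub>R Phi 0 (z - w)) \<in> borel_measurable lborel"
      "(\<lambda>w. (h w * exp (1 * v w)) *\<^sub>R Phi 0 (z - w)) \<in> borel_measurable lborel" by measurable
    show "AE w in lborel. g w *\<^sub>R Phi 0 (z - w) = (h w * exp (1 * v w)) *\<^sub>R Phi 0 (z - w)"
      using AEg by eventually_elim simp
  qed
  have "Ckv k v" for k
  proof (induction k)
    case 0 then show ?case using vc by simp
  next
    case (Suc k)
    have "Ckv k (\<lambda>z. h z * exp (1 * v z))"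
      by (intro Ckv_mult smoothD[OF h(1)] Ckv_compose_real[OF smooth_real_exp[of UNIV]] Suc) auto
    then have "Ckv (Suc k) (conv (Phi 0) (\<lambda>z. h z * exp (1 * v z)))" by (rule Phi_potential_gain)
    then have "Ckv (Suc k) (conv (Phi 0) g)" using conv_eq by presburger
    then show ?case unfolding v_def by (intro Ckv_diff Ckv_minus smoothD[OF s0])
  qed
  then show ?thesis using that[of v] AEv by (simp add: smooth_def)
qed

section \<open>Wirtinger derivatives\<close>

text \<open>The real differential written as p dz + q dz', with z' the conjugate. Being a relation
  at one point, it also serves products whose holomorphic factors are differentiable only on an open
  set.\<close>

definition wirt :: "(complex \<Rightarrow> complex) \<Rightarrow> complex \<Rightarrow> complex \<Rightarrow> complex \<Rightarrow> bool" where
  "wirt F p q z \<longleftrightarrow> (F has_derivative (\<lambda>h. p * h + q * cnj h)) (at z)"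

definition dz :: "(complex \<Rightarrow> complex) \<Rightarrow> complex \<Rightarrow> complex" where
  "dz F = (\<lambda>z. (pd 1 F z - \<i> * pd \<i> F z) / 2)"

definition dzb :: "(complex \<Rightarrow> complex) \<Rightarrow> complex \<Rightarrow> complex" where
  "dzb F = (\<lambda>z. (pd 1 F z + \<i> * pd \<i> F z) / 2)"

lemma wirt_dz: "wirt F p q z \<Longrightarrow> dz F z = p" and wirt_dzb: "wirt F p q z \<Longrightarrow> dzb F z = q"
proof -
  assume "wirt F p q z"
  then have "pd b F z = p * b + q * cnj b" for b
    unfolding wirt_def by (rule pd_eqI)
  then show "dz F z = p" "dzb F z = q" by (auto simp: dz_def dzb_def field_simps)
qed

lemma smooth_wirt:
  assumes "smooth F" shows "wirt F (dz F z) (dzb F z) z"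
proof -
  have "(\<Sum>b\<in>Basis. (h \<bullet> b) *\<^sub>R pd b F z) = dz F z * h + dzb F z * cnj h" for h
    by (simp add: Basis_complex_def dz_def dzb_def complex_eq_iff field_simps)
  then show ?thesis using smooth_has_derivative[OF assms, where x=z] unfolding wirt_def by simp
qed

lemma wirt_const: "wirt (\<lambda>_. c) 0 0 z"
  by (simp add: wirt_def)

lemma wirt_add: "wirt F p q z \<Longrightarrow> wirt G r s z \<Longrightarrow> wirt (\<lambda>z. F z + G z) (p + r) (q + s) z"
  unfolding wirt_def by (drule (1) has_derivative_add) (simp add: algebra_simps)

lemma wirt_sum:
  assumes "\<And>i. i \<in> I \<Longrightarrow> wirt (F i) (p i) (q i) z"
  shows "wirt (\<lambda>z. \<Sum>i\<in>I. F i z) (\<Sum>i\<in>I. p i) (\<Sum>i\<in>I. q i) z"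
  using assms by (induction I rule: infinite_finite_induct) (auto simp: wirt_const intro: wirt_add)

lemma wirt_mult: "wirt F p q z \<Longrightarrow> wirt G r s z \<Longrightarrow> wirt (\<lambda>z. F z * G z) (p * G z + F z * r) (q * G z + F z * s) z"
  unfolding wirt_def by (drule (1) has_derivative_mult) (simp add: algebra_simps)

lemma wirt_cnj: "wirt F p q z \<Longrightarrow> wirt (\<lambda>z. cnj (F z)) (cnj q) (cnj p) z"
  unfolding wirt_def by (drule has_derivative_cnj) (simp add: algebra_simps)

lemma wirt_holo: "(F has_field_derivative p) (at z) \<Longrightarrow> wirt F p 0 z"
  by (simp add: wirt_def has_field_derivative_def)

lemma wirt_imp_field_derivative: "wirt F p 0 z \<Longrightarrow> (F has_field_derivative p) (at z)"
  by (simp add: wirt_def has_field_derivative_def)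

lemma wirt_compose:
  assumes "wirt F p q z" "(G has_field_derivative c) (at (F z))"
  shows "wirt (\<lambda>z. G (F z)) (c * p) (c * q) z"
  using has_derivative_compose[OF assms(1)[unfolded wirt_def] assms(2)[unfolded has_field_derivative_def]]
  by (simp add: wirt_def algebra_simps)

lemma wirt_cong_open:
  assumes "wirt F p q z" "open S" "z \<in> S" "\<And>x. x \<in> S \<Longrightarrow> F x = G x"
  shows "wirt G p q z"
  using has_derivative_transform_within_open[OF assms(1)[unfolded wirt_def] assms(2-4)] by (simp add: wirt_def)

lemma smooth_dz: "smooth F \<Longrightarrow> smooth (dz F)" and smooth_dzb: "smooth F \<Longrightarrow> smooth (dzb F)"
proof -
  assume F: "smooth F"
  have "smooth (\<lambda>z. (pd 1 F z - \<i> * pd \<i> F z) * (1/2))" "smooth (\<lambda>z. (pd 1 F z + \<i> * pd \<i> F z) * (1/2))"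
    by (intro smooth_intros smooth_pd F; simp add: Basis_complex_def)+
  then show "smooth (dz F)" "smooth (dzb F)" by (simp_all add: dz_def dzb_def)
qed

lemma dzb_cnj: "smooth F \<Longrightarrow> dzb (\<lambda>z. cnj (F z)) = (\<lambda>z. cnj (dz F z))"
  by (rule ext) (rule wirt_dzb[OF wirt_cnj[OF smooth_wirt]])

lemma pd_lincomb:
  assumes "smooth u" "smooth v"
  shows "pd b (\<lambda>z. (u z + c * v z) / 2) z = (pd b u z + c * pd b v z) / (2::complex)"
proof -
  have b: "bounded_linear (\<lambda>x::complex. x / 2)" "bounded_linear (\<lambda>x::complex. c * x)"
    by (auto intro: bounded_linear_divide bounded_linear_mult_right)
  have s: "smooth (\<lambda>z. c * v z)" using assms by (intro smooth_intros)
  have "pd b (\<lambda>z. (u z + c * v z) / 2) z = pd b (\<lambda>z. u z + c * v z) z / 2"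
    by (rule pd_bounded_linear[OF b(1) smoothD[OF smooth_add[OF assms(1) s], of "Suc 0"]])
  moreover have "pd b (\<lambda>z. u z + c * v z) z = pd b u z + pd b (\<lambda>z. c * v z) z"
    by (rule pd_add_smooth[OF assms(1) s])
  moreover have "pd b (\<lambda>z. c * v z) z = c * pd b v z"
    by (rule pd_bounded_linear[OF b(2) smoothD[OF assms(2), of "Suc 0"]])
  ultimately show ?thesis by simp
qed

text \<open>The mixed second partial derivatives cancel by \<open>pd_commute\<close>; what remains
  is a quarter of the Laplacian, for either order of the Wirtinger operators.\<close>

lemma dz_dzb_laplacian:
  assumes F: "smooth F"
  shows "dz (dzb F) z = (pd 1 (pd 1 F) z + pd \<i> (pd \<i> F) z) / 4" "dzb (dz F) z = (pd 1 (pd 1 F) z + pd \<i> (pd \<i> F) z) / 4"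
proof -
  have B: "1 \<in> (Basis :: complex set)" "\<i> \<in> (Basis :: complex set)" by (auto simp: Basis_complex_def)
  have s: "smooth (pd 1 F)" "smooth (pd \<i> F)" using F B by (auto intro: smooth_pd)
  have c: "pd 1 (pd \<i> F) z = pd \<i> (pd 1 F) z" by (rule pd_commute[OF smoothD[OF F] B])
  show "dz (dzb F) z = (pd 1 (pd 1 F) z + pd \<i> (pd \<i> F) z) / 4"
    unfolding dz_def dzb_def pd_lincomb[OF s] using c by (simp add: field_simps)
  show "dzb (dz F) z = (pd 1 (pd 1 F) z + pd \<i> (pd \<i> F) z) / 4"
  proof -
    have "dz F = (\<lambda>z. (pd 1 F z + (- \<i>) * pd \<i> F z) / 2)" by (simp add: dz_def)
    then show ?thesis unfolding dzb_def by (simp only: pd_lincomb[OF s]) (use c in \<open>simp add: field_simps\<close>)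
  qed
qed

lemma dz_dzb_commute: "smooth F \<Longrightarrow> dz (dzb F) = dzb (dz F)"
  by (rule ext) (simp add: dz_dzb_laplacian)

lemma dz_dzb_of_real:
  assumes "smooth v" shows "dz (dzb (\<lambda>z. of_real (v z))) z = of_real (laplacian v z) / 4"
proof -
  have 1: "pd b (\<lambda>z. of_real (u z) :: complex) = (\<lambda>z. of_real (pd b u z))" if "smooth u" for b u
    by (rule ext) (rule pd_bounded_linear[OF bounded_linear_of_real smoothD[OF that, of "Suc 0"]])
  have s: "smooth (pd 1 v)" "smooth (pd \<i> v)" using assms by (auto intro!: smooth_pd simp: Basis_complex_def)
  have "smooth (\<lambda>z. of_real (v z) :: complex)" by (rule smooth_bounded_linear[OF bounded_linear_of_real assms])
  from dz_dzb_laplacian(1)[OF this] show ?thesis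
    using assms s by (simp add: 1 laplacian_pd Basis_complex_def)
qed

abbreviation "dzn k \<equiv> dz ^^ k"
abbreviation "dzbn k \<equiv> dzb ^^ k"

lemma smooth_dzn: "smooth F \<Longrightarrow> smooth (dzn k F)" by (induction k) (auto intro: smooth_dz)
lemma smooth_dzbn: "smooth F \<Longrightarrow> smooth (dzbn k F)" by (induction k) (auto intro: smooth_dzb)

lemma dz_dzbn: "smooth F \<Longrightarrow> dz (dzbn j F) = dzbn j (dz F)"
  by (induction j) (auto simp: dz_dzb_commute smooth_dzbn)

lemma dzn_dzbn: "smooth F \<Longrightarrow> dzn k (dzbn j F) = dzbn j (dzn k F)"
  by (induction k) (auto simp: dz_dzbn smooth_dzn)

lemma dzbn_real:
  assumes "smooth F" "\<And>z. cnj (F z) = F z"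
  shows "dzbn j F = (\<lambda>z. cnj (dzn j F z))"
  using assms by (induction j) (auto simp: dzb_cnj smooth_dzn)

section \<open>Integration by parts and dilations for Wirtinger derivatives\<close>

lemma integral_dz_by_parts:
  assumes F: "smooth F" and G: "smooth G" and s: "bsupp F \<or> bsupp G"
  shows "(LINT z|lborel. dz F z * G z) = - (LINT z|lborel. F z * dz G z)" "(LINT z|lborel. dzb F z * G z) = - (LINT z|lborel. F z * dzb G z)"
proof -
  have B: "1 \<in> (Basis :: complex set)" "\<i> \<in> (Basis :: complex set)" by (auto simp: Basis_complex_def)
  have eq: "(LINT x|lborel. pd b F x * G x) = - (LINT x|lborel. F x * pd b G x)" if "b \<in> Basis" for b
    by (rule integral_by_parts[OF smoothD[OF F] smoothD[OF G] s that])
  have i: "integrable lborel (\<lambda>x. F x * pd b G x)" "integrable lborel (\<lambda>x. pd b F x * G x)" if "b \<in> Basis" for b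
    using s bsupp_pd that F G by (blast intro!: integrable_continuous_bsupp smooth_continuous smooth_mult smooth_pd bsupp_mult)+
  have l: "dz F z * G z = (pd 1 F z * G z - \<i> * (pd \<i> F z * G z)) / 2" "F z * dz G z = (F z * pd 1 G z - \<i> * (F z * pd \<i> G z)) / 2"
    "dzb F z * G z = (pd 1 F z * G z + \<i> * (pd \<i> F z * G z)) / 2" "F z * dzb G z = (F z * pd 1 G z + \<i> * (F z * pd \<i> G z)) / 2" for z
    by (simp_all add: dz_def dzb_def algebra_simps)
  have h: "(LINT z|lborel. dz F z * G z) = ((LINT z|lborel. pd 1 F z * G z) - \<i> * (LINT z|lborel. pd \<i> F z * G z)) / 2"
    "(LINT z|lborel. F z * dz G z) = ((LINT z|lborel. F z * pd 1 G z) - \<i> * (LINT z|lborel. F z * pd \<i> G z)) / 2"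
    "(LINT z|lborel. dzb F z * G z) = ((LINT z|lborel. pd 1 F z * G z) + \<i> * (LINT z|lborel. pd \<i> F z * G z)) / 2"
    "(LINT z|lborel. F z * dzb G z) = ((LINT z|lborel. F z * pd 1 G z) + \<i> * (LINT z|lborel. F z * pd \<i> G z)) / 2"
    unfolding l using i[OF B(1)] i[OF B(2)] by simp_all
  show "(LINT z|lborel. dz F z * G z) = - (LINT z|lborel. F z * dz G z)" "(LINT z|lborel. dzb F z * G z) = - (LINT z|lborel. F z * dzb G z)"
    unfolding h eq[OF B(1)] eq[OF B(2)] by (simp_all add: field_simps)
qed

lemma bsupp_dz: "bsupp F \<Longrightarrow> bsupp (dz F)" and bsupp_dzb: "bsupp F \<Longrightarrow> bsupp (dzb F)"
proof -
  assume "bsupp F"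
  then obtain R where R: "\<And>x. norm x > R \<Longrightarrow> F x = 0" using bsuppE by blast
  show "bsupp (dz F)" "bsupp (dzb F)"
    by (rule bsuppI[of R]; simp add: dz_def dzb_def pd_eq_0_outside[OF R])+
qed

lemma bsupp_dzn: "bsupp F \<Longrightarrow> bsupp (dzn k F)" by (induction k) (auto intro: bsupp_dz)
lemma bsupp_dzbn: "bsupp F \<Longrightarrow> bsupp (dzbn k F)" by (induction k) (auto intro: bsupp_dzb)

lemma integral_dzn_by_parts:
  assumes "smooth F" "smooth G" "bsupp G"
  shows "(LINT z|lborel. dzn k F z * G z) = (-1) ^ k * (LINT z|lborel. F z * dzn k G z)"
  using assms
proof (induction k arbitrary: G)
  case (Suc k)
  then show ?case using integral_dz_by_parts(1)[of "dzn k F" G] Suc.IH[of "dz G"]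
    by (simp add: smooth_dzn smooth_dz bsupp_dz funpow_swap1)
qed auto

lemma integral_dzbn_by_parts:
  assumes "smooth F" "smooth G" "bsupp G"
  shows "(LINT z|lborel. dzbn k F z * G z) = (-1) ^ k * (LINT z|lborel. F z * dzbn k G z)"
  using assms
proof (induction k arbitrary: G)
  case (Suc k)
  then show ?case using integral_dz_by_parts(2)[of "dzbn k F" G] Suc.IH[of "dzb G"]
    by (simp add: smooth_dzbn smooth_dzb bsupp_dzb funpow_swap1)
qed auto

lemma wirt_affine:
  assumes "smooth F"
  shows "wirt (\<lambda>z. F (a + of_real c * z)) (of_real c * dz F (a + of_real c * z)) (of_real c * dzb F (a + of_real c * z)) z"
proof -
  have "((\<lambda>z. F (a + of_real c * z)) has_derivative (\<lambda>h. dz F (a + of_real c * z) * (of_real c * h) + dzb F (a + of_real c * z) * cnj (of_real c * h))) (at z)"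
    by (rule has_derivative_compose[of "\<lambda>z. a + of_real c * z", OF _ smooth_wirt[OF assms, unfolded wirt_def]])
       (auto intro!: derivative_eq_intros)
  then show ?thesis by (simp add: wirt_def algebra_simps)
qed

lemma dz_scale: "smooth F \<Longrightarrow> dz (\<lambda>z. c' * F (of_real c * z)) = (\<lambda>z. (c' * of_real c) * dz F (of_real c * z))"
  and dzb_scale: "smooth F \<Longrightarrow> dzb (\<lambda>z. c' * F (of_real c * z)) = (\<lambda>z. (c' * of_real c) * dzb F (of_real c * z))"
  using wirt_dz[OF wirt_mult[OF wirt_const wirt_affine[where a=0]]] wirt_dzb[OF wirt_mult[OF wirt_const wirt_affine[where a=0]]]
  by (auto simp: fun_eq_iff mult.assoc)

lemma dzn_scale: "smooth F \<Longrightarrow> dzn k (\<lambda>z. c' * F (of_real c * z)) = (\<lambda>z. (c' * of_real c ^ k) * dzn k F (of_real c * z))"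
proof (induction k)
  case (Suc k)
  have "dzn (Suc k) (\<lambda>z. c' * F (of_real c * z)) = dz (dzn k (\<lambda>z. c' * F (of_real c * z)))" by simp
  also have "\<dots> = dz (\<lambda>z. (c' * of_real c ^ k) * dzn k F (of_real c * z))"
    by (subst Suc.IH[OF Suc.prems]) (rule refl)
  also have "\<dots> = (\<lambda>z. (c' * of_real c ^ k * of_real c) * dz (dzn k F) (of_real c * z))"
    by (rule dz_scale[OF smooth_dzn[OF Suc.prems]])
  finally show ?case by (simp add: mult_ac)
qed simp

lemma dzbn_scale: "smooth F \<Longrightarrow> dzbn k (\<lambda>z. c' * F (of_real c * z)) = (\<lambda>z. (c' * of_real c ^ k) * dzbn k F (of_real c * z))"
proof (induction k)
  case (Suc k)
  have "dzbn (Suc k) (\<lambda>z. c' * F (of_real c * z)) = dzb (dzbn k (\<lambda>z. c' * F (of_real c * z)))" by simp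
  also have "\<dots> = dzb (\<lambda>z. (c' * of_real c ^ k) * dzbn k F (of_real c * z))"
    by (subst Suc.IH[OF Suc.prems]) (rule refl)
  also have "\<dots> = (\<lambda>z. (c' * of_real c ^ k * of_real c) * dzb (dzbn k F) (of_real c * z))"
    by (rule dzb_scale[OF smooth_dzbn[OF Suc.prems]])
  finally show ?case by (simp add: mult_ac)
qed simp

lemma wirt_zero_imp_constant:
  assumes "\<And>z. wirt F 0 0 z" shows "F a = F b"
proof -
  have "\<exists>c. \<forall>x\<in>UNIV. F x = c"
    by (rule has_derivative_zero_constant) (use assms in \<open>auto simp: wirt_def\<close>)
  then show ?thesis by auto
qed

lemma sum_telescope_product:
  fixes w F :: "nat \<Rightarrow> 'a::comm_ring"
  assumes "w 0 = 0"
  shows "(\<Sum>k<N. w (Suc k) * F (Suc k) - w k * F k) = w N * F N"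
  using assms by (induction N) auto

text \<open>A function annihilated by powers of both Wirtinger operators is a polynomial in \<open>z\<close> and its
  conjugate: the Taylor polynomial of \<open>U\<close> at \<open>z\<close>, evaluated at a fixed point \<open>a\<close>, does not depend on \<open>z\<close>.\<close>

lemma bipolynomial_Taylor:
  assumes U: "smooth U" and N: "\<And>z. dzn N U z = 0" "\<And>z. dzbn N U z = 0"
  shows "U a = (\<Sum>k<N. \<Sum>j<N. (a - z0) ^ k / fact k * (cnj (a - z0) ^ j / fact j) * dzbn j (dzn k U) z0)"
proof -
  \<comment> \<open>The index is shifted by one: \<open>w (Suc k)\<close> is the Taylor weight of
    order \<open>k\<close>, and \<open>w 0 = 0\<close> accounts for the derivative of the constant
    weight, so that the derivative of \<open>w (Suc k)\<close> is \<open>- w k\<close> for all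
    \<open>k\<close>.\<close>
  define w where "w k z = (case k of 0 \<Rightarrow> 0 | Suc k \<Rightarrow> (a - z) ^ k / fact k)" for k and z :: complex
  define F where "F k j = dzbn j (dzn k U)" for k j
  have sF: "smooth (F k j)" for k j unfolding F_def by (intro smooth_dzbn smooth_dzn U)
  have dzF: "dz (F k j) = F (Suc k) j" for k j unfolding F_def by (simp add: dz_dzbn smooth_dzn U)
  have dzbF: "dzb (F k j) = F k (Suc j)" for k j unfolding F_def by simp
  \<comment> \<open>The upper ends of the two telescoping sums; the lower ends vanish by
    \<open>w 0 = 0\<close>.\<close>
  have FN: "F N j z = 0" "F j N z = 0" for j z
  proof -
    have z: "dzbn j (\<lambda>_. 0) = (\<lambda>_. 0)" "dzn j (\<lambda>_. 0) = (\<lambda>_. 0)" for j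
      by (induction j) (auto intro!: ext wirt_dz[OF wirt_const] wirt_dzb[OF wirt_const])
    have "dzn N U = (\<lambda>_. 0)" "dzbn N U = (\<lambda>_. 0)" using N by auto
    moreover have "F j N = dzn j (dzbn N U)" unfolding F_def by (rule dzn_dzbn[OF U, symmetric])
    ultimately show "F N j z = 0" "F j N z = 0" by (simp_all add: z F_def)
  qed
  have wS: "w (Suc k) = (\<lambda>z. (a - z) ^ k / fact k)" for k by (auto simp: w_def)
  have ww: "wirt (w (Suc k)) (- w k z) 0 z" for k z
  proof (rule wirt_holo, cases k)
    case 0
    then show "(w (Suc k) has_field_derivative - w k z) (at z)" by (simp add: wS) (simp add: w_def)
  next
    case (Suc l)
    have "((\<lambda>z. (a - z) ^ Suc l / fact (Suc l)) has_field_derivative ((1 + of_nat l) * (-1 * (a - z) ^ l)) / fact (Suc l)) (at z)"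
      by (intro DERIV_cdivide DERIV_power_Suc) (auto intro!: derivative_eq_intros)
    moreover have "((1 + of_nat l) * (-1 * (a - z) ^ l)) / fact (Suc l) = - ((a - z) ^ l / (fact l :: complex))"
    proof -
      have "fact (Suc l) = (1 + of_nat l) * (fact l :: complex)" by simp
      then show ?thesis using of_nat_neq_0[of l, where 'a=complex] by (simp only:) (subst mult_divide_mult_cancel_left, auto)
    qed
    ultimately show "(w (Suc k) has_field_derivative - w k z) (at z)" by (simp add: wS Suc del: power_Suc)
  qed
  define T where "T z = (\<Sum>k<N. \<Sum>j<N. w (Suc k) z * cnj (w (Suc j) z) * F k j z)" for z
  have "wirt T 0 0 z" for z
  proof -
    have "wirt (\<lambda>z. w (Suc k) z * cnj (w (Suc j) z) * F k j z)
       (cnj (w (Suc j) z) * (w (Suc k) z * F (Suc k) j z - w k z * F k j z))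
       (w (Suc k) z * (cnj (w (Suc j) z) * F k (Suc j) z - cnj (w j z) * F k j z)) z" for k j
      using wirt_mult[OF wirt_mult[OF ww[of k z] wirt_cnj[OF ww[of j z]]] smooth_wirt[OF sF[of k j], of z]]
      by (simp add: dzF dzbF algebra_simps)
    then have W: "wirt T (\<Sum>k<N. \<Sum>j<N. cnj (w (Suc j) z) * (w (Suc k) z * F (Suc k) j z - w k z * F k j z))
       (\<Sum>k<N. \<Sum>j<N. w (Suc k) z * (cnj (w (Suc j) z) * F k (Suc j) z - cnj (w j z) * F k j z)) z"
      unfolding T_def[abs_def] by (intro wirt_sum)
    have "(\<Sum>k<N. \<Sum>j<N. cnj (w (Suc j) z) * (w (Suc k) z * F (Suc k) j z - w k z * F k j z))
      = (\<Sum>j<N. cnj (w (Suc j) z) * (\<Sum>k<N. w (Suc k) z * F (Suc k) j z - w k z * F k j z))"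
      by (subst sum.swap) (simp add: sum_distrib_left)
    also have "\<dots> = 0"
      using sum_telescope_product[of "\<lambda>k. w k z" "\<lambda>k. F k _ z" N] FN(1) by (simp add: w_def)
    finally have 1: "(\<Sum>k<N. \<Sum>j<N. cnj (w (Suc j) z) * (w (Suc k) z * F (Suc k) j z - w k z * F k j z)) = 0" .
    have "(\<Sum>k<N. \<Sum>j<N. w (Suc k) z * (cnj (w (Suc j) z) * F k (Suc j) z - cnj (w j z) * F k j z))
      = (\<Sum>k<N. w (Suc k) z * (\<Sum>j<N. cnj (w (Suc j) z) * F k (Suc j) z - cnj (w j z) * F k j z))"
      by (simp add: sum_distrib_left)
    also have "\<dots> = 0"
      using sum_telescope_product[of "\<lambda>j. cnj (w j z)" "\<lambda>j. F _ j z" N] FN(2) by (simp add: w_def)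
    finally show ?thesis using W 1 by simp
  qed
  then have "T a = T z0" by (rule wirt_zero_imp_constant)
  moreover have "T a = U a"
  proof (cases N)
    case 0
    then show ?thesis using N(1)[of a] by (simp add: T_def)
  next
    case (Suc M)
    \<comment> \<open>With \<open>z = a\<close> all weights of positive order vanish, and only the
      term \<open>k = j = 0\<close> of the Taylor sum remains.\<close>
    have wa: "w (Suc k) a = (if k = 0 then 1 else 0)" for k by (simp add: w_def)
    have "T a = (\<Sum>k<N. if k = 0 then (\<Sum>j<N. if j = 0 then F k j a else 0) else 0)"
    proof -
      have "(1 * cnj (if j = 0 then 1 else 0)) * x = (if j = 0 then x else 0)" for j :: nat and x :: complex by simp
      then have "(\<Sum>j<N. w (Suc k) a * cnj (w (Suc j) a) * F k j a) = (if k = 0 then (\<Sum>j<N. if j = 0 then F k j a else 0) else 0)" for k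
        unfolding wa by (cases "k = 0") simp_all
      then show ?thesis unfolding T_def by simp
    qed
    also have "\<dots> = F 0 0 a" using Suc by (simp add: sum.delta)
    finally show ?thesis by (simp add: F_def)
  qed
  ultimately show ?thesis by (simp add: T_def w_def F_def)
qed

section \<open>The fundamental lemma and classical solutions\<close>

lemma AE_0_continuous_imp_0:
  fixes F :: "'a::euclidean_space \<Rightarrow> real"
  assumes F: "continuous_on UNIV F" and ae: "AE x in lborel. F x = 0"
  shows "F a = 0"
proof (rule ccontr)
  assume a: "F a \<noteq> 0"
  have "open {x. F x \<noteq> 0}"
    using F by (intro open_Collect_neq continuous_on_const)
  then obtain r where r: "r > 0" "ball a r \<subseteq> {x. F x \<noteq> 0}" using a open_contains_ball by blast
  have "AE x in lborel. x \<notin> ball a r" using ae by eventually_elim (use r in auto)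
  then have "emeasure lborel (ball a r) = 0"
    by (subst (asm) AE_iff_measurable[where N="ball a r"]) auto
  moreover have "unit_ball_vol (DIM('a)) * r ^ DIM('a) > 0" using r by (intro mult_pos_pos zero_less_power) auto
  ultimately show False using r by (simp add: emeasure_ball ennreal_eq_0_iff)
qed

text \<open>The test function is a bump supported where \<open>F\<close> has the sign of
  \<open>F a\<close>. Multiplication by \<open>F a\<close> makes the integrand nonnegative without a
  case distinction on that sign.\<close>

lemma fundamental_lemma:
  fixes F :: "'a::euclidean_space \<Rightarrow> real"
  assumes F: "continuous_on UNIV F"
    and test: "\<And>\<phi>. smooth \<phi> \<Longrightarrow> bsupp \<phi> \<Longrightarrow> (LINT x|lborel. F x * \<phi> x) = 0"
  shows "F a = 0"
proof (rule ccontr)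
  assume a: "F a \<noteq> 0"
  have "open {x. 0 < F a * F x}"
    using F by (intro open_Collect_less continuous_on_const continuous_on_mult)
  moreover have "a \<in> {x. 0 < F a * F x}" using a by (auto simp: zero_less_mult_iff linorder_neq_iff)
  ultimately obtain r where r: "r > 0" "ball a r \<subseteq> {x. 0 < F a * F x}" using open_contains_ball by blast
  define \<phi> where "\<phi> x = cutoff (- (1 / r) *\<^sub>R a + (1 / r) *\<^sub>R x)" for x
  have arg: "- (1 / r) *\<^sub>R a + (1 / r) *\<^sub>R x = (1 / r) *\<^sub>R (x - a)" for x
    by (simp add: scaleR_diff_right)
  have s: "smooth \<phi>" unfolding \<phi>_def[abs_def] by (rule smooth_affine[OF smooth_cutoff])
  have out: "\<phi> x = 0" if "x \<notin> ball a r" for x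
    unfolding \<phi>_def arg using that r(1) by (intro cutoff_eq_0) (simp add: dist_norm norm_minus_commute pos_le_divide_eq)
  have b: "bsupp \<phi>"
  proof (rule bsuppI[of "norm a + r"])
    fix x :: 'a assume "norm x > norm a + r"
    then have "x \<notin> ball a r" using norm_triangle_ineq2[of x a] by (simp add: dist_norm norm_minus_commute)
    then show "\<phi> x = 0" by (rule out)
  qed
  have nn: "0 \<le> F a * F x * \<phi> x" for x
  proof (cases "x \<in> ball a r")
    case True
    then have "0 < F a * F x" using r(2) by blast
    then show ?thesis unfolding \<phi>_def by (rule mult_nonneg_nonneg[OF less_imp_le cutoff_nonneg])
  qed (simp add: out)
  have c: "continuous_on UNIV (\<lambda>x. F a * F x * \<phi> x)" by (intro continuous_intros F smooth_continuous s)
  have int: "integrable lborel (\<lambda>x. F a * F x * \<phi> x)"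
    by (intro integrable_continuous_bsupp c bsupp_mult disjI2 b)
  have "(LINT x|lborel. F a * F x * \<phi> x) = F a * (LINT x|lborel. F x * \<phi> x)" by (simp add: mult.assoc)
  also have "\<dots> = 0" using test[OF s b] by simp
  finally have "AE x in lborel. F a * F x * \<phi> x = 0"
    using integral_nonneg_eq_0_iff_AE[OF int] nn by simp
  then have "F a * F a * \<phi> a = 0" by (rule AE_0_continuous_imp_0[OF c])
  moreover have "\<phi> a = 1" unfolding \<phi>_def arg by (simp add: cutoff_eq_1)
  ultimately show False using a by simp
qed

text \<open>Green's formula moves the Laplacian from the test function to \<open>v\<close>, and the
  fundamental lemma applies to the continuous function laplacian v + h exp v.\<close>

lemma classical_solution:
  fixes h v \<psi> :: "complex \<Rightarrow> real"
  assumes v: "smooth v" and h: "smooth h" and psi: "\<psi> \<in> borel_measurable borel" and ae: "AE z in lborel. \<psi> z = v z"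
    and eq: "\<And>\<phi>. smooth \<phi> \<Longrightarrow> bsupp \<phi> \<Longrightarrow>
       - (LINT x|lborel. \<psi> x * laplacian \<phi> x) = (LINT x|lborel. (h x * exp (\<psi> x)) * \<phi> x)"
  shows "laplacian v z = - (h z * exp (v z))"
proof -
  have sg: "smooth (\<lambda>z. h z * exp (1 * v z))"
    by (intro smooth_mult h smooth_compose_real[OF smooth_real_exp[of UNIV] _ v]) auto
  have "laplacian v z + h z * exp (1 * v z) = 0"
  proof (rule fundamental_lemma[where F="\<lambda>z. laplacian v z + h z * exp (1 * v z)"])
    show "continuous_on UNIV (\<lambda>z. laplacian v z + h z * exp (1 * v z))"
      by (intro smooth_continuous smooth_add smooth_laplacian v sg)
    fix \<phi> :: "complex \<Rightarrow> real" assume \<phi>: "smooth \<phi>" "bsupp \<phi>"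
    note [measurable] = psi smooth_measurable[OF v] smooth_measurable[OF h] smooth_measurable[OF \<phi>(1)] smooth_measurable[OF smooth_laplacian[OF \<phi>(1)]]
    have "(LINT x|lborel. \<psi> x * laplacian \<phi> x) = (LINT x|lborel. v x * laplacian \<phi> x)"
      by (rule integral_cong_AE) (use ae in \<open>auto elim!: eventually_mono\<close>)
    also have "\<dots> = (LINT x|lborel. laplacian v x * \<phi> x)" by (rule green[OF v \<phi>])
    finally have 1: "(LINT x|lborel. \<psi> x * laplacian \<phi> x) = (LINT x|lborel. laplacian v x * \<phi> x)" .
    have 2: "(LINT x|lborel. (h x * exp (\<psi> x)) * \<phi> x) = (LINT x|lborel. (h x * exp (1 * v x)) * \<phi> x)"
      by (rule integral_cong_AE) (use ae in \<open>auto elim!: eventually_mono\<close>)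
    have "integrable lborel (\<lambda>x. laplacian v x * \<phi> x)" "integrable lborel (\<lambda>x. (h x * exp (1 * v x)) * \<phi> x)"
      using \<phi> by (intro integrable_continuous_bsupp smooth_continuous bsupp_mult disjI2 smooth_mult[OF _ \<phi>(1)] sg smooth_laplacian v; simp)+
    then have "(LINT x|lborel. (laplacian v x + h x * exp (1 * v x)) * \<phi> x)
      = (LINT x|lborel. laplacian v x * \<phi> x) + (LINT x|lborel. (h x * exp (1 * v x)) * \<phi> x)"
      by (simp add: distrib_right)
    then show "(LINT x|lborel. (laplacian v x + h x * exp (1 * v x)) * \<phi> x) = 0"
      using eq[OF \<phi>] 1 2 by simp
  qed
  then show ?thesis by simp
qed

section \<open>A logarithmic lower bound for superharmonic functions\<close>

text \<open>Normalized to vanish beyond \<open>1\<close>, so that \<open>cutoff_primitive (|x|\<^sup>2)\<close> has compact support and gradient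
  \<open>x cutoff(x)\<close>.\<close>

definition cutoff_primitive :: "real \<Rightarrow> real" where
  "cutoff_primitive t = (integral {-1..t} cutoff_profile - integral {-1..1} cutoff_profile) / 2"

lemma cutoff_profile_integrable: "cutoff_profile integrable_on {a..b}"
  by (intro integrable_continuous_interval continuous_on_subset[OF continuous_on_cutoff_profile]) auto

text \<open>The primitive starts at -1 so that 0, the value of the squared norm at the origin, is an
  interior point and has a two-sided derivative.\<close>

lemma cutoff_primitive_deriv:
  assumes "t > -1" shows "(cutoff_primitive has_real_derivative cutoff_profile t / 2) (at t)"
proof -
  have "((\<lambda>u. integral {-1..u} cutoff_profile) has_real_derivative cutoff_profile t) (at t within {-1..t + 1})"
    by (rule integral_has_real_derivative[OF continuous_on_subset[OF continuous_on_cutoff_profile]]) (use assms in auto)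
  moreover have "t \<in> interior {-1..t + 1}" using assms by simp
  ultimately have "((\<lambda>u. integral {-1..u} cutoff_profile) has_real_derivative cutoff_profile t) (at t)"
    by (metis at_within_interior)
  then show ?thesis unfolding cutoff_primitive_def[abs_def]
    by (auto intro!: derivative_eq_intros)
qed

lemma cutoff_primitive_eq_0: "t \<ge> 1 \<Longrightarrow> cutoff_primitive t = 0"
proof -
  assume t: "t \<ge> 1"
  have "integral {1..t} cutoff_profile = integral {1..t} (\<lambda>_. 0)"
    by (rule integral_cong) (simp add: cutoff_profile_eq_0)
  then show ?thesis
    using Henstock_Kurzweil_Integration.integral_combine[of "-1" 1 t cutoff_profile] t cutoff_profile_integrable
    by (simp add: cutoff_primitive_def)
qed

lemma cutoff_primitive_bounds:
  assumes "t \<ge> 0" shows "- (1 / 2) \<le> cutoff_primitive t" "cutoff_primitive t \<le> 0"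
proof -
  have "- (1 / 2) \<le> cutoff_primitive t \<and> cutoff_primitive t \<le> 0"
  proof (cases "t \<ge> 1")
    case False
    have eq: "cutoff_primitive t = - (integral {t..1} cutoff_profile / 2)"
      using Henstock_Kurzweil_Integration.integral_combine[of "-1" t 1 cutoff_profile] False assms cutoff_profile_integrable
      by (simp add: cutoff_primitive_def)
    have "integral {t..1} cutoff_profile \<ge> 0"
      by (rule Henstock_Kurzweil_Integration.integral_nonneg[OF cutoff_profile_integrable]) (simp add: cutoff_profile_nonneg)
    moreover have "integral {t..1} cutoff_profile \<le> integral {t..1} (\<lambda>_. 1)"
      by (rule integral_le[OF cutoff_profile_integrable]) (auto simp: cutoff_profile_le_1)
    ultimately show ?thesis using eq assms False by simp
  qed (simp add: cutoff_primitive_eq_0)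
  then show "- (1 / 2) \<le> cutoff_primitive t" "cutoff_primitive t \<le> 0" by auto
qed

definition cutoff_pot :: "complex \<Rightarrow> real" where
  "cutoff_pot x = cutoff_primitive ((norm x)\<^sup>2)"

lemma cutoff_pot_has_derivative:
  "(cutoff_pot has_derivative (\<lambda>h. cutoff x * (x \<bullet> h))) (at x)"
proof -
  have "((\<lambda>x. (norm x)\<^sup>2) has_derivative (\<lambda>h. 2 * (x \<bullet> h))) (at x)"
    unfolding power2_norm_eq_inner by (auto intro!: derivative_eq_intros simp: inner_commute)
  moreover have "(cutoff_primitive has_derivative (*) (cutoff_profile ((norm x)\<^sup>2) / 2)) (at ((norm x)\<^sup>2))"
    using cutoff_primitive_deriv[of "(norm x)\<^sup>2"] unfolding has_field_derivative_def
    by (smt (verit) zero_le_power2)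
  ultimately have "((\<lambda>x. cutoff_primitive ((norm x)\<^sup>2)) has_derivative (\<lambda>h. cutoff_profile ((norm x)\<^sup>2) / 2 * (2 * (x \<bullet> h)))) (at x)"
    by (rule has_derivative_compose)
  then show ?thesis by (simp add: cutoff_pot_def[abs_def] cutoff_def)
qed

lemma cutoff_pot_props:
  "Ckv (Suc 0) cutoff_pot" "bsupp cutoff_pot" "pd b cutoff_pot x = cutoff x * (x \<bullet> b)"
  "- (1/2) \<le> cutoff_pot x" "cutoff_pot x \<le> 0"
proof -
  show "Ckv (Suc 0) cutoff_pot"
    by (rule Ckv_SucI[OF cutoff_pot_has_derivative])
       (intro smoothD smooth_mult smooth_cutoff smooth_inner smooth_ident smooth_const)
  have "cutoff_pot x = 0" if "norm x > 1" for x
    unfolding cutoff_pot_def using that by (intro cutoff_primitive_eq_0) simp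
  then show "bsupp cutoff_pot" by (rule bsuppI[of 1])
  show "pd b cutoff_pot x = cutoff x * (x \<bullet> b)" by (rule pd_eqI[OF cutoff_pot_has_derivative])
  show "- (1/2) \<le> cutoff_pot x" "cutoff_pot x \<le> 0"
    unfolding cutoff_pot_def by (intro cutoff_primitive_bounds; simp)+
qed

text \<open>A mean over the disc of radius \<open>s\<close> about \<open>z\<close> with a smooth
  weight in place of circular means. It is not normalized; its total weight is the integral of
  \<open>cutoff\<close>.\<close>

definition avg :: "(complex \<Rightarrow> real) \<Rightarrow> complex \<Rightarrow> real \<Rightarrow> real" where
  "avg v z s = (LINT x|lborel. v (z + s *\<^sub>R x) * cutoff x)"

lemma bsupp_cutoff: "bsupp (cutoff :: 'a::euclidean_space \<Rightarrow> real)"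
  by (rule bsuppI[of 1]) (simp add: cutoff_eq_0)

lemma continuous_on_affine_comp:
  fixes u :: "'a::real_normed_vector \<Rightarrow> 'b::topological_space"
  assumes "continuous_on UNIV u" shows "continuous_on UNIV (\<lambda>x. u (a + c *\<^sub>R x))"
  by (rule continuous_on_compose2[OF assms _ subset_UNIV]) (intro continuous_intros)

text \<open>Differentiation in \<open>s\<close> produces the gradient of \<open>v\<close> paired
  with \<open>x\<close> times the cutoff. That vector field is the gradient of
  \<open>cutoff_pot\<close>, so integration by parts yields the Laplacian of \<open>v\<close>, and
  the chain rule contributes the factor \<open>s\<close>.\<close>

lemma avg_deriv:
  assumes v: "smooth v"
  shows "(avg v z has_real_derivative (- s * (LINT x|lborel. laplacian v (z + s *\<^sub>R x) * cutoff_pot x))) (at s)"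
proof -
  let ?D = "\<lambda>s x. (\<Sum>b\<in>Basis. (x \<bullet> b) * pd b v (z + s *\<^sub>R x)) * cutoff x"
  let ?Q = "cbox (- (1 + \<i>)) (1 + \<i>) :: complex set"
  have cv: "continuous_on UNIV (\<lambda>x. pd b v (z + s *\<^sub>R x))" if "b \<in> Basis" for s b
    by (rule continuous_on_affine_comp[OF smooth_continuous[OF smooth_pd[OF v that]]])
  have cvv: "continuous_on UNIV (\<lambda>x. pd b (pd b v) (z + s *\<^sub>R x))" if "b \<in> Basis" for s b
    by (rule continuous_on_affine_comp[OF smooth_continuous[OF smooth_pd[OF smooth_pd[OF v that] that]]])
  have cc: "continuous_on UNIV (cutoff :: complex \<Rightarrow> real)" by (rule smooth_continuous[OF smooth_cutoff])
  \<comment> \<open>The Leibniz rule is applied to integrals over boxes; the square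
    \<open>?Q\<close> contains the support of the cutoff.\<close>
  have toQ: "(LINT x|lborel. F x * cutoff x) = integral ?Q (\<lambda>x. F x * cutoff x)" if F: "continuous_on UNIV F" for F :: "complex \<Rightarrow> real"
  proof -
    have c: "continuous_on ?Q (\<lambda>x. F x * cutoff x)"
      by (intro continuous_on_mult continuous_on_subset[OF F] continuous_on_subset[OF smooth_continuous[OF smooth_cutoff]]) auto
    have out: "cutoff x = 0" if "x \<notin> ?Q" for x :: complex
    proof (rule cutoff_eq_0)
      show "1 \<le> norm x" using that abs_Re_le_cmod[of x] abs_Im_le_cmod[of x]
        by (auto simp: in_cbox_complex_iff)
    qed
    have "(LINT x|lborel. F x * cutoff x) = set_lebesgue_integral lborel ?Q (\<lambda>x. F x * cutoff x)"
      unfolding set_lebesgue_integral_def using out by (intro Bochner_Integration.integral_cong) (auto simp: indicator_def)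
    also have "\<dots> = integral ?Q (\<lambda>x. F x * cutoff x)"
      by (intro set_borel_integral_eq_integral) (use borel_integrable_compact[OF compact_cbox c] in \<open>simp add: set_integrable_def\<close>)
    finally show ?thesis .
  qed
  have der: "((\<lambda>s. v (z + s *\<^sub>R x) * cutoff x) has_vector_derivative ?D s x) (at s within UNIV)" for s x
  proof -
    have "((\<lambda>s. v (z + s *\<^sub>R x)) has_derivative (\<lambda>h. \<Sum>b\<in>Basis. ((h *\<^sub>R x) \<bullet> b) *\<^sub>R pd b v (z + s *\<^sub>R x))) (at s)"
      by (rule has_derivative_compose[of "\<lambda>s. z + s *\<^sub>R x", OF _ smooth_has_derivative[OF v]])
         (auto intro!: derivative_eq_intros)
    from has_derivative_mult_left[OF this, of "cutoff x"]
    show ?thesis unfolding has_vector_derivative_def by (simp add: sum_distrib_left mult_ac)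
  qed
  have "((\<lambda>s. integral ?Q (\<lambda>x. v (z + s *\<^sub>R x) * cutoff x)) has_vector_derivative integral ?Q (\<lambda>x. ?D s x)) (at s within UNIV)"
  proof (rule leibniz_rule_vector_derivative[OF der])
    show "(\<lambda>x. v (z + s *\<^sub>R x) * cutoff x) integrable_on ?Q" for s
    proof (rule integrable_continuous[OF continuous_on_subset[OF _ subset_UNIV]])
      show "continuous_on UNIV (\<lambda>x. v (z + s *\<^sub>R x) * cutoff x)"
        by (rule continuous_on_mult[OF continuous_on_affine_comp[OF smooth_continuous[OF v]] cc])
    qed
    have 1: "continuous_on UNIV (\<lambda>p::real \<times> complex. pd b v (z + fst p *\<^sub>R snd p))" if "b \<in> Basis" for b
      by (rule continuous_on_compose2[OF smooth_continuous[OF smooth_pd[OF v that]] _ subset_UNIV]) (intro continuous_intros)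
    have 2: "continuous_on UNIV (\<lambda>p::real \<times> complex. cutoff (snd p))"
      by (rule continuous_on_compose2[OF smooth_continuous[OF smooth_cutoff] _ subset_UNIV]) (intro continuous_intros)
    have "continuous_on UNIV (\<lambda>p. ?D (fst p) (snd p))"
      by (intro continuous_on_mult continuous_on_sum 1 2 continuous_on_inner continuous_on_snd continuous_on_const continuous_on_id)
    then have "continuous_on (UNIV \<times> ?Q) (\<lambda>p. ?D (fst p) (snd p))" by (rule continuous_on_subset) simp
    then show "continuous_on (UNIV \<times> ?Q) (\<lambda>(s, x). ?D s x)" by (simp add: case_prod_beta)
  qed auto
  then have "(avg v z has_real_derivative integral ?Q (\<lambda>x. ?D s x)) (at s)"
    using toQ[OF continuous_on_affine_comp[OF smooth_continuous[OF v]]]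
    by (simp add: avg_def[abs_def] has_real_derivative_iff_has_vector_derivative)
  moreover have "integral ?Q (\<lambda>x. ?D s x) = (LINT x|lborel. ?D s x)"
    by (rule toQ[symmetric]) (intro continuous_on_sum continuous_on_mult continuous_on_inner continuous_on_id continuous_on_const cv)
  moreover have "(LINT x|lborel. ?D s x) = (\<Sum>b\<in>Basis. LINT x|lborel. pd b v (z + s *\<^sub>R x) * pd b cutoff_pot x)"
  proof -
    have i: "integrable lborel (\<lambda>x. pd b v (z + s *\<^sub>R x) * (cutoff x * (x \<bullet> b)))" if "b \<in> Basis" for b
    proof (rule integrable_continuous_bsupp)
      show "continuous_on UNIV (\<lambda>x. pd b v (z + s *\<^sub>R x) * (cutoff x * (x \<bullet> b)))"
        by (intro continuous_on_mult continuous_on_inner continuous_on_id continuous_on_const cv that cc)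
      show "bsupp (\<lambda>x. pd b v (z + s *\<^sub>R x) * (cutoff x * (x \<bullet> b)))"
        by (intro bsupp_mult disjI2 disjI1 bsupp_cutoff)
    qed
    have D: "?D s x = (\<Sum>b\<in>Basis. pd b v (z + s *\<^sub>R x) * (cutoff x * (x \<bullet> b)))" for x
      unfolding sum_distrib_right by (intro sum.cong refl) (simp only: mult_ac)
    show ?thesis unfolding D cutoff_pot_props(3) by (rule Bochner_Integration.integral_sum[OF i])
  qed
  moreover have "(LINT x|lborel. pd b v (z + s *\<^sub>R x) * pd b cutoff_pot x) = - s * (LINT x|lborel. pd b (pd b v) (z + s *\<^sub>R x) * cutoff_pot x)"
    if b: "b \<in> Basis" for b
  proof -
    have sb: "smooth (pd b v)" using v b by (rule smooth_pd)
    have "(LINT x|lborel. pd b (\<lambda>x. pd b v (z + s *\<^sub>R x)) x * cutoff_pot x) = - (LINT x|lborel. pd b v (z + s *\<^sub>R x) * pd b cutoff_pot x)"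
      by (rule integral_by_parts[OF smoothD[OF smooth_affine[OF sb]] cutoff_pot_props(1) disjI2[OF cutoff_pot_props(2)] b])
    then show ?thesis by (simp add: pd_affine[OF smoothD[OF sb, of "Suc 0"]] mult.assoc)
  qed
  moreover have "(\<Sum>b\<in>Basis. - s * (LINT x|lborel. pd b (pd b v) (z + s *\<^sub>R x) * cutoff_pot x))
     = - s * (LINT x|lborel. laplacian v (z + s *\<^sub>R x) * cutoff_pot x)"
  proof -
    have "integrable lborel (\<lambda>x. pd b (pd b v) (z + s *\<^sub>R x) * cutoff_pot x)" if "b \<in> Basis" for b
      using that by (intro integrable_continuous_bsupp continuous_on_mult cvv
         bsupp_mult disjI2 cutoff_pot_props(2) Ckv_imp_continuous[OF cutoff_pot_props(1)])
    then show ?thesis by (simp add: laplacian_pd sum_distrib_right sum_distrib_left)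
  qed
  ultimately show ?thesis by simp
qed

lemma cutoff_integral_pos: "(LINT x|lborel. cutoff (x::complex)) > 0"
proof -
  have i: "integrable lborel (cutoff :: complex \<Rightarrow> real)"
    by (intro integrable_continuous_bsupp smooth_continuous smooth_cutoff bsupp_cutoff)
  have "(LINT x|lborel. cutoff (x::complex)) \<noteq> 0"
  proof
    assume "(LINT x|lborel. cutoff (x::complex)) = 0"
    then have "AE x::complex in lborel. cutoff x = 0"
      using integral_nonneg_eq_0_iff_AE[OF i] by (simp add: cutoff_nonneg)
    then have "cutoff (0::complex) = 0"
      by (rule AE_0_continuous_imp_0[OF smooth_continuous[OF smooth_cutoff]])
    then show False by (simp add: cutoff_eq_1)
  qed
  moreover have "(LINT x|lborel. cutoff (x::complex)) \<ge> 0"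
    by (intro integral_nonneg_AE AE_I2) (simp add: cutoff_nonneg)
  ultimately show ?thesis by simp
qed

text \<open>The lower bound follows from the monotonicity of the weighted means \<open>avg v z s\<close> of the superharmonic
  function \<open>v\<close>: at fixed centre they decay at most like \<open>ln s\<close>, and the positive part of \<open>v\<close> is controlled by
  the integrability of \<open>g\<close>.\<close>

lemma superharmonic_log_lower_bound:
  fixes v g :: "complex \<Rightarrow> real"
  assumes v: "smooth v" and eq: "\<And>z. laplacian v z = - g z"
    and g: "\<And>z. g z \<ge> 0" "integrable lborel g" "continuous_on UNIV g"
    and c: "c > 0" "\<And>z. norm z \<ge> \<rho> \<Longrightarrow> c * exp (v z) \<le> g z"
  obtains K M where "M \<ge> 0" "\<And>R z. R \<ge> 1 \<Longrightarrow> norm z \<le> R \<Longrightarrow> - v z \<le> K + M * ln R"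
proof -
  define G where "G = (LINT z|lborel. g z)"
  define \<kappa> where "\<kappa> = (LINT x|lborel. cutoff (x::complex))"
  have G: "G \<ge> 0" unfolding G_def using g by (intro integral_nonneg_AE AE_I2) auto
  have \<kappa>: "\<kappa> > 0" unfolding \<kappa>_def by (rule cutoff_integral_pos)
  have vc: "continuous_on UNIV v" by (rule smooth_continuous[OF v])
  have icut: "integrable lborel (\<lambda>x. F x * cutoff x)" if "continuous_on UNIV F" for F :: "complex \<Rightarrow> real"
    by (intro integrable_continuous_bsupp continuous_on_mult that smooth_continuous smooth_cutoff bsupp_mult disjI2 bsupp_cutoff)
  define d where "d z s = s * (LINT x|lborel. g (z + s *\<^sub>R x) * cutoff_pot x)" for z s
  have der: "(avg v z has_real_derivative d z s) (at s)" for z s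
    using avg_deriv[OF v, of z s] by (simp add: eq d_def)
  have gaff: "integrable lborel (\<lambda>x. g (z + s *\<^sub>R x))" "s\<^sup>2 * (LINT x|lborel. g (z + s *\<^sub>R x)) = G" if "s > 0" for z s
    using lborel_integrable_affine[of s g z] lborel_integral_affine[of s g z] that g(2) by (simp_all add: G_def)
  have ipot: "integrable lborel (\<lambda>x. g (z + s *\<^sub>R x) * cutoff_pot x)" for z s
    by (intro integrable_continuous_bsupp continuous_on_mult continuous_on_affine_comp[OF g(3)] bsupp_mult disjI2 cutoff_pot_props(2)
      Ckv_imp_continuous[OF cutoff_pot_props(1)])
  have d_le: "d z s \<le> 0" if "s \<ge> 0" for z s
  proof -
    have "0 \<le> (LINT x|lborel. - (g (z + s *\<^sub>R x) * cutoff_pot x))"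
      using g(1) cutoff_pot_props(5) by (intro integral_nonneg_AE AE_I2) (simp add: mult_nonneg_nonpos)
    then show ?thesis unfolding d_def using that by (intro mult_nonneg_nonpos) simp_all
  qed
  \<comment> \<open>\<open>cutoff_pot\<close> is at least -1/2, and rescaling the plane by
    \<open>s\<close> divides the mass of \<open>g\<close> by \<open>s^2\<close>. The resulting rate
    G / (2 s) is the one that integrates to a logarithm.\<close>
  have d_ge: "- (G / 2) / s \<le> d z s" if s: "s > 0" for z s
  proof -
    have "(LINT x|lborel. - (1 / 2) * g (z + s *\<^sub>R x)) \<le> (LINT x|lborel. g (z + s *\<^sub>R x) * cutoff_pot x)"
    proof (rule integral_mono[OF _ ipot])
      show "integrable lborel (\<lambda>x. - (1 / 2) * g (z + s *\<^sub>R x))" using gaff(1)[OF s] by simp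
      show "- (1 / 2) * g (z + s *\<^sub>R x) \<le> g (z + s *\<^sub>R x) * cutoff_pot x" for x
        using mult_left_mono[OF cutoff_pot_props(4)[of x] g(1)[of "z + s *\<^sub>R x"]] by simp
    qed
    then have "s * (- (1 / 2) * (LINT x|lborel. g (z + s *\<^sub>R x))) \<le> d z s"
      unfolding d_def using s by (intro mult_left_mono) auto
    moreover have "s * (- (1 / 2) * (LINT x|lborel. g (z + s *\<^sub>R x))) = - (G / 2) / s"
      using gaff(2)[OF s, of z] s by (simp add: field_simps power2_eq_square)
    ultimately show ?thesis by simp
  qed
  have avg0: "avg v z 0 = v z * \<kappa>" for z by (simp add: avg_def \<kappa>_def)
  have mono: "avg v z s \<le> v z * \<kappa>" if "s \<ge> 0" for z s
    unfolding avg0[symmetric]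
    by (rule DERIV_nonpos_imp_nonincreasing[OF that]) (use der d_le in blast)
  have lower: "avg v 0 1 - G / 2 * ln s \<le> avg v 0 s" if s: "s \<ge> 1" for s
  proof -
    have "avg v 0 1 + G / 2 * ln 1 \<le> avg v 0 s + G / 2 * ln s"
    proof (rule DERIV_nonneg_imp_nondecreasing[OF s])
      fix x :: real assume "1 \<le> x" "x \<le> s"
      then have x: "x > 0" by simp
      have "((\<lambda>s. avg v 0 s + G / 2 * ln s) has_real_derivative (d 0 x + G / 2 * (1 / x))) (at x)"
        using x by (auto intro!: derivative_eq_intros der)
      moreover have "d 0 x + G / 2 * (1 / x) \<ge> 0" using d_ge[OF x, of 0] by simp
      ultimately show "\<exists>y. ((\<lambda>s. avg v 0 s + G / 2 * ln s) has_real_derivative y) (at x) \<and> 0 \<le> y" by blast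
    qed
    then show ?thesis by simp
  qed
  define vp where "vp w = max (v w) 0" for w
  define vm where "vm w = max (- v w) 0" for w
  have vpc: "continuous_on UNIV vp" "continuous_on UNIV vm"
    unfolding vp_def[abs_def] vm_def[abs_def] using vc by (auto intro!: continuous_intros)
  obtain V0 where V0: "V0 > 0" "\<And>x. x \<in> cball 0 \<rho> \<Longrightarrow> norm (v x) \<le> V0"
    using continuous_bounded_on_cball[OF vc] by blast
  \<comment> \<open>Outside the disc of radius \<rho> one has v <= exp v <= g / c, and inside it
    \<open>v\<close> is bounded by continuity; thus the mass controls the positive part of
    \<open>v\<close>.\<close>
  have vp_le: "vp w \<le> V0 + g w / c" for w
  proof (cases "norm w \<ge> \<rho>")
    case True
    have "v w \<le> exp (v w)" using exp_ge_add_one_self[of "v w"] by linarith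
    then have "c * vp w \<le> c * exp (v w)" using c(1) by (intro mult_left_mono) (auto simp: vp_def)
    also have "\<dots> \<le> g w" using c(2)[OF True] .
    finally have "vp w \<le> g w / c" using c(1) by (simp add: pos_le_divide_eq mult.commute)
    then show ?thesis using V0(1) by simp
  next
    case False
    then have "vp w \<le> V0" using V0(1) V0(2)[of w] by (auto simp: vp_def)
    moreover have "0 \<le> g w / c" using g(1) c(1) by simp
    ultimately show ?thesis by linarith
  qed
  \<comment> \<open>The scale is \<open>4 * R\<close> because for \<open>norm z <= R\<close> the
    disc of radius \<open>R\<close> about \<open>z\<close> lies in the disc of radius
    \<open>2 * R\<close> about 0, on which the cutoff at this scale equals 1.\<close>
  define N where "N R = (LINT x|lborel. vm (0 + (4 * R) *\<^sub>R x) * cutoff x)" for R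
  define K2 where "K2 = V0 * \<kappa> + G / c - avg v 0 1"
  have N_le: "N R \<le> K2 + G / 2 * ln (4 * R)" if R: "R \<ge> 1" for R
  proof -
    have R4: "4 * R > 0" "4 * R \<ge> 1" using R by auto
    note i = icut[OF continuous_on_affine_comp[OF vpc(1), of 0 "4 * R"]] icut[OF continuous_on_affine_comp[OF vc, of 0 "4 * R"]]
    have "vm (0 + (4 * R) *\<^sub>R x) * cutoff x = vp (0 + (4 * R) *\<^sub>R x) * cutoff x - v (0 + (4 * R) *\<^sub>R x) * cutoff x" for x
      by (simp add: vp_def vm_def max_def algebra_simps)
    then have "N R = (LINT x|lborel. vp (0 + (4 * R) *\<^sub>R x) * cutoff x) - avg v 0 (4 * R)"
      unfolding N_def avg_def using i by simp
    also have "(LINT x|lborel. vp (0 + (4 * R) *\<^sub>R x) * cutoff x) \<le> (LINT x|lborel. V0 * cutoff x + g (0 + (4 * R) *\<^sub>R x) / c)"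
    proof (rule integral_mono[OF i(1)])
      show "integrable lborel (\<lambda>x. V0 * cutoff x + g (0 + (4 * R) *\<^sub>R x) / c)"
        using gaff(1)[OF R4(1), of 0] icut[of "\<lambda>_. V0"] by simp
      fix x :: complex
      have "vp (0 + (4 * R) *\<^sub>R x) * cutoff x \<le> (V0 + g (0 + (4 * R) *\<^sub>R x) / c) * cutoff x"
        by (intro mult_right_mono vp_le cutoff_nonneg)
      also have "\<dots> \<le> V0 * cutoff x + g (0 + (4 * R) *\<^sub>R x) / c"
        using mult_left_mono[OF cutoff_le_1[of x], of "g (0 + (4 * R) *\<^sub>R x) / c"] g(1)[of "0 + (4 * R) *\<^sub>R x"] c(1)
        by (simp add: distrib_right)
      finally show "vp (0 + (4 * R) *\<^sub>R x) * cutoff x \<le> V0 * cutoff x + g (0 + (4 * R) *\<^sub>R x) / c" .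
    qed
    also have "\<dots> = V0 * \<kappa> + (LINT x|lborel. g (0 + (4 * R) *\<^sub>R x)) / c"
      using gaff(1)[OF R4(1), of 0] icut[of "\<lambda>_. V0"] by (simp add: \<kappa>_def)
    also have "\<dots> \<le> V0 * \<kappa> + G / c"
    proof -
      have "0 \<le> (LINT x|lborel. g (0 + (4 * R) *\<^sub>R x))" using g(1) by (intro integral_nonneg_AE AE_I2) auto
      then have "1 * (LINT x|lborel. g (0 + (4 * R) *\<^sub>R x)) \<le> (4 * R)\<^sup>2 * (LINT x|lborel. g (0 + (4 * R) *\<^sub>R x))"
        using R4(2) by (intro mult_right_mono one_le_power) auto
      then show ?thesis using gaff(2)[OF R4(1), of 0] c(1) by (simp add: divide_right_mono)
    qed
    finally show ?thesis using lower[OF R4(2)] by (simp add: K2_def)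
  qed
  \<comment> \<open>The factor 16 is the ratio of areas between the scales \<open>4 * R\<close> and
    \<open>R\<close>. The left side is bounded by the mean of \<open>- v\<close> about
    \<open>z\<close>, since the means of \<open>v\<close> decrease from their value at scale
    0.\<close>
  have main: "- v z * \<kappa> \<le> 16 * N R" if R: "R \<ge> 1" and z: "norm z \<le> R" for R z
  proof -
    let ?F = "\<lambda>y. vm (0 + (4 * R) *\<^sub>R y) * cutoff y"
    let ?t = "(1 / (4 * R)) *\<^sub>R z"
    have iF: "integrable lborel ?F" by (rule icut[OF continuous_on_affine_comp[OF vpc(2)]])
    have iF': "integrable lborel (\<lambda>x. ?F (?t + (1 / 4) *\<^sub>R x))"
      by (rule lborel_integrable_affine[OF _ iF]) simp
    have "N R = (1 / 4)\<^sup>2 * (LINT x|lborel. ?F (?t + (1 / 4) *\<^sub>R x))"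
      unfolding N_def using lborel_integral_affine[of "1/4" ?F ?t] by simp
    then have 1: "16 * N R = (LINT x|lborel. ?F (?t + (1 / 4) *\<^sub>R x))" by (simp add: power2_eq_square)
    have "- avg v z R = (LINT x|lborel. - (v (z + R *\<^sub>R x) * cutoff x))" by (simp add: avg_def)
    also have "\<dots> \<le> (LINT x|lborel. ?F (?t + (1 / 4) *\<^sub>R x))"
    proof (rule integral_mono[OF _ iF'])
      show "integrable lborel (\<lambda>x. - (v (z + R *\<^sub>R x) * cutoff x))"
        using icut[OF continuous_on_affine_comp[OF vc, of z R]] by simp
      fix x :: complex
      have arg: "0 + (4 * R) *\<^sub>R (?t + (1 / 4) *\<^sub>R x) = z + R *\<^sub>R x" using R by (simp add: scaleR_add_right)
      show "- (v (z + R *\<^sub>R x) * cutoff x) \<le> ?F (?t + (1 / 4) *\<^sub>R x)"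
      proof (cases "norm x \<le> 1")
        case True
        have "norm ?t \<le> 1 / 4" using z R by (simp add: field_simps)
        then have "norm (?t + (1 / 4) *\<^sub>R x) \<le> 1 / 2"
          using norm_triangle_ineq[of ?t "(1 / 4) *\<^sub>R x"] True by simp
        then have "cutoff (?t + (1 / 4) *\<^sub>R x) = 1" by (rule cutoff_eq_1)
        moreover have "- (v (z + R *\<^sub>R x) * cutoff x) \<le> vm (z + R *\<^sub>R x)"
        proof -
          have "- (v (z + R *\<^sub>R x) * cutoff x) \<le> vm (z + R *\<^sub>R x) * cutoff x"
            using mult_right_mono[OF _ cutoff_nonneg[of x], of "- v (z + R *\<^sub>R x)" "vm (z + R *\<^sub>R x)"] by (simp add: vm_def)
          also have "\<dots> \<le> vm (z + R *\<^sub>R x) * 1" by (intro mult_left_mono cutoff_le_1) (simp add: vm_def)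
          finally show ?thesis by simp
        qed
        ultimately show ?thesis unfolding arg by simp
      next
        case False
        then have "cutoff x = 0" by (intro cutoff_eq_0) simp
        moreover have "0 \<le> ?F (?t + (1 / 4) *\<^sub>R x)" by (intro mult_nonneg_nonneg cutoff_nonneg) (simp add: vm_def)
        ultimately show ?thesis by simp
      qed
    qed
    finally have "- avg v z R \<le> 16 * N R" using 1 by simp
    then show ?thesis using mono[of R z] R by simp
  qed
  show ?thesis
  proof (rule that[of "16 / \<kappa> * (G / 2)" "16 / \<kappa> * (K2 + G / 2 * ln 4)"])
    show "16 / \<kappa> * (G / 2) \<ge> 0" using G \<kappa> by simp
    fix R :: real and z :: complex assume R: "R \<ge> 1" and z: "norm z \<le> R"
    have "- v z * \<kappa> \<le> 16 * (K2 + G / 2 * ln (4 * R))" using order_trans[OF main[OF R z] mult_left_mono[OF N_le[OF R], of 16]] by simp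
    also have "ln (4 * R) = ln 4 + ln R" using R by (simp add: ln_mult)
    finally have "- v z \<le> 16 * (K2 + G / 2 * (ln 4 + ln R)) / \<kappa>" using \<kappa> by (simp add: pos_le_divide_eq)
    also have "\<dots> = 16 / \<kappa> * (K2 + G / 2 * ln 4) + 16 / \<kappa> * (G / 2) * ln R"
      by (simp add: algebra_simps add_divide_distrib)
    finally show "- v z \<le> 16 / \<kappa> * (K2 + G / 2 * ln 4) + 16 / \<kappa> * (G / 2) * ln R" .
  qed
qed

section \<open>Sums of squares of polynomials\<close>

text \<open>The identity \<open>star\<close> is the Liouville equation for \<open>\<psi>\<close> in terms of \<open>u = \<surd>8 exp (-\<psi>/2)\<close>.\<close>

context
  fixes U :: "complex \<Rightarrow> complex" and u :: "complex \<Rightarrow> real" and f :: "complex poly"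
  assumes U: "smooth U" and Uu: "\<And>z. U z = of_real (u z)" and upos: "\<And>z. u z > 0" and f: "f \<noteq> 0"
    and star: "\<And>z. U z * dz (dzb U) z - dz U z * dzb U z = poly f z * cnj (poly f z)"
begin

lemma U_nonzero: "U z \<noteq> 0"
  using upos[of z] by (simp add: Uu)

lemma cnj_dzU: "dzb U z = cnj (dz U z)"
proof -
  have "(\<lambda>z. cnj (U z)) = U" by (auto simp: Uu)
  then show ?thesis using dzb_cnj[OF U] by metis
qed

lemma poly_f_wirt: "wirt (poly p) (poly (pderiv p) z) 0 z"
  by (rule wirt_holo[OF poly_DERIV])

text \<open>Differentiating the identity \<open>star\<close> shows that \<open>(f U'' - f' U') / U\<close> is holomorphic, where the
  primes denote \<open>dz\<close>; thus \<open>U\<close> satisfies a linear second order equation in \<open>z\<close>.\<close>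

lemma Schwarzian_holomorphic:
  "(\<lambda>z. (poly f z * dz (dz U) z - poly (pderiv f) z * dz U z) / U z) holomorphic_on UNIV"
proof -
  let ?W = "\<lambda>z. (poly f z * dz (dz U) z - poly (pderiv f) z * dz U z)"
  have sm: "smooth (dz U)" "smooth (dz (dz U))" "smooth (dzb U)" "smooth (dz (dzb U))" by (intro smooth_dz smooth_dzb U)+
  note w = smooth_wirt[OF U] smooth_wirt[OF sm(1)] smooth_wirt[OF sm(2)] smooth_wirt[OF sm(3)] smooth_wirt[OF sm(4)]
  \<comment> \<open>This is \<open>dz\<close> applied to \<open>star\<close>: the two products of
    \<open>dz U\<close> with \<open>dz (dzb U)\<close> cancel, and the conjugate of \<open>f\<close>
    is annihilated by \<open>dz\<close>.\<close>
  have dstar: "U z * dz (dz (dzb U)) z - dz (dz U) z * dzb U z = poly (pderiv f) z * cnj (poly f z)" for z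
  proof -
    have "wirt (\<lambda>z. U z * dz (dzb U) z + (-1) * (dz U z * dzb U z))
      ((dz U z * dz (dzb U) z + U z * dz (dz (dzb U)) z) + (0 * (dz U z * dzb U z) + (-1) * (dz (dz U) z * dzb U z + dz U z * dz (dzb U) z)))
      ((dzb U z * dz (dzb U) z + U z * dzb (dz (dzb U)) z) + (0 * (dz U z * dzb U z) + (-1) * (dzb (dz U) z * dzb U z + dz U z * dzb (dzb U) z))) z"
      by (intro wirt_add wirt_mult wirt_const w)
    then have "dz (\<lambda>z. U z * dz (dzb U) z + (-1) * (dz U z * dzb U z)) z = U z * dz (dz (dzb U)) z - dz (dz U) z * dzb U z"
      by (simp add: wirt_dz)
    moreover have "(\<lambda>z. U z * dz (dzb U) z + (-1) * (dz U z * dzb U z)) = (\<lambda>z. poly f z * cnj (poly f z))"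
      using star by simp
    moreover have "dz (\<lambda>z. poly f z * cnj (poly f z)) z = poly (pderiv f) z * cnj (poly f z)"
      using wirt_dz[OF wirt_mult[OF poly_f_wirt[of f z] wirt_cnj[OF poly_f_wirt[of f z]]]] by simp
    ultimately show ?thesis by simp
  qed
  have "\<exists>p. ((\<lambda>z. ?W z / U z) has_field_derivative p) (at z)" for z
  proof -
    have comm: "dzb (dz U) = dz (dzb U)" "dzb (dz (dz U)) = dz (dz (dzb U))"
      using dz_dzb_commute[OF U] dz_dzb_commute[OF sm(1)] by simp_all
    have W: "wirt (\<lambda>z. poly f z * dz (dz U) z + (-1) * (poly (pderiv f) z * dz U z))
      ((poly (pderiv f) z * dz (dz U) z + poly f z * dz (dz (dz U)) z) + (0 * (poly (pderiv f) z * dz U z) + (-1) * (poly (pderiv (pderiv f)) z * dz U z + poly (pderiv f) z * dz (dz U) z)))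
      ((0 * dz (dz U) z + poly f z * dzb (dz (dz U)) z) + (0 * (poly (pderiv f) z * dz U z) + (-1) * (0 * dz U z + poly (pderiv f) z * dzb (dz U) z))) z"
      by (intro wirt_add wirt_mult wirt_const w poly_f_wirt)
    have inv: "wirt (\<lambda>z. inverse (U z)) (- (inverse (U z) * inverse (U z)) * dz U z) (- (inverse (U z) * inverse (U z)) * dzb U z) z"
      by (rule wirt_compose[OF w(1)]) (use U_nonzero in \<open>auto intro!: derivative_eq_intros\<close>)
    from wirt_mult[OF W inv] obtain p where p: "wirt (\<lambda>z. (poly f z * dz (dz U) z + (-1) * (poly (pderiv f) z * dz U z)) * inverse (U z)) p
       (((0 * dz (dz U) z + poly f z * dzb (dz (dz U)) z) + (0 * (poly (pderiv f) z * dz U z) + (-1) * (0 * dz U z + poly (pderiv f) z * dzb (dz U) z))) * inverse (U z)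
        + (poly f z * dz (dz U) z + (-1) * (poly (pderiv f) z * dz U z)) * (- (inverse (U z) * inverse (U z)) * dzb U z)) z" by blast
    \<comment> \<open>The \<open>dzb\<close> derivative of the quotient has as numerator
      \<open>f\<close> times \<open>dstar\<close> minus the derivative of \<open>f\<close> times
      \<open>star\<close>, and the right sides of these two identities cancel.\<close>
    have "(((0 * dz (dz U) z + poly f z * dzb (dz (dz U)) z) + (0 * (poly (pderiv f) z * dz U z) + (-1) * (0 * dz U z + poly (pderiv f) z * dzb (dz U) z))) * inverse (U z)
        + (poly f z * dz (dz U) z + (-1) * (poly (pderiv f) z * dz U z)) * (- (inverse (U z) * inverse (U z)) * dzb U z))
      = (poly f z * (U z * dz (dz (dzb U)) z - dz (dz U) z * dzb U z) - poly (pderiv f) z * (U z * dz (dzb U) z - dz U z * dzb U z)) * (inverse (U z) * inverse (U z))"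
      using U_nonzero[of z] unfolding comm by (simp add: field_simps)
    also have "\<dots> = 0" unfolding dstar star by (simp add: algebra_simps)
    finally have e: "(((0 * dz (dz U) z + poly f z * dzb (dz (dz U)) z) + (0 * (poly (pderiv f) z * dz U z) + (-1) * (0 * dz U z + poly (pderiv f) z * dzb (dz U) z))) * inverse (U z)
        + (poly f z * dz (dz U) z + (-1) * (poly (pderiv f) z * dz U z)) * (- (inverse (U z) * inverse (U z)) * dzb U z)) = 0" .
    have "wirt (\<lambda>z. ?W z / U z) p 0 z" using p unfolding e by (simp add: divide_inverse)
    then show ?thesis using wirt_imp_field_derivative by blast
  qed
  then show ?thesis by (auto simp: holomorphic_on_def field_differentiable_def)
qed

lemma open_regular: "open {z. poly f z \<noteq> 0}"
  by (intro open_Collect_neq continuous_intros)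

text \<open>Off the zeros of \<open>f\<close> the linear equation expresses \<open>dz (dz U)\<close>
  through \<open>U\<close> and \<open>dz U\<close> with holomorphic coefficients \<open>A\<close>
  and \<open>B\<close>; differentiating a combination and substituting the equation gives the
  recursion for the coefficients.\<close>

lemma dzn_linear_combination:
  obtains a b where "\<And>k. a k holomorphic_on {z. poly f z \<noteq> 0}" "\<And>k. b k holomorphic_on {z. poly f z \<noteq> 0}"
    "\<And>k z. poly f z \<noteq> 0 \<Longrightarrow> dzn k U z = a k z * U z + b k z * dz U z"
proof -
  let ?S = "{z. poly f z \<noteq> 0}"
  define A where "A z = poly (pderiv f) z / poly f z" for z
  define B where "B z = (poly f z * dz (dz U) z - poly (pderiv f) z * dz U z) / U z / poly f z" for z
  have A: "A holomorphic_on ?S" unfolding A_def[abs_def] by (intro holomorphic_intros) auto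
  have B: "B holomorphic_on ?S" unfolding B_def[abs_def]
    by (intro holomorphic_on_divide holomorphic_on_subset[OF Schwarzian_holomorphic] holomorphic_intros) auto
  have ode: "dz (dz U) z = A z * dz U z + B z * U z" if "poly f z \<noteq> 0" for z
    using that U_nonzero[of z] by (simp add: A_def B_def field_simps)
  have "\<exists>a b. a holomorphic_on ?S \<and> b holomorphic_on ?S \<and> (\<forall>z\<in>?S. dzn k U z = a z * U z + b z * dz U z)" for k
  proof (induction k)
    case 0
    show ?case by (intro exI[of _ "\<lambda>_. 1"] exI[of _ "\<lambda>_. 0"]) auto
  next
    case (Suc k)
    then obtain a b where ab: "a holomorphic_on ?S" "b holomorphic_on ?S"
      and eq: "\<And>z. z \<in> ?S \<Longrightarrow> dzn k U z = a z * U z + b z * dz U z" by blast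
    let ?a = "\<lambda>z. deriv a z + b z * B z" and ?b = "\<lambda>z. a z + deriv b z + b z * A z"
    have "dzn (Suc k) U z = ?a z * U z + ?b z * dz U z" if z: "z \<in> ?S" for z
    proof -
      have "wirt (\<lambda>z. a z * U z + b z * dz U z) ((deriv a z * U z + a z * dz U z) + (deriv b z * dz U z + b z * dz (dz U) z))
         ((0 * U z + a z * dzb U z) + (0 * dz U z + b z * dzb (dz U) z)) z"
        using holomorphic_derivI[OF ab(1) open_regular z] holomorphic_derivI[OF ab(2) open_regular z]
        by (intro wirt_add wirt_mult wirt_holo smooth_wirt U smooth_dz)
      then have "wirt (dzn k U) ((deriv a z * U z + a z * dz U z) + (deriv b z * dz U z + b z * dz (dz U) z))
         ((0 * U z + a z * dzb U z) + (0 * dz U z + b z * dzb (dz U) z)) z"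
        by (rule wirt_cong_open[OF _ open_regular z]) (simp only: eq)
      from wirt_dz[OF this] show ?thesis using ode[of z] z by (simp add: algebra_simps)
    qed
    moreover have "?a holomorphic_on ?S" "?b holomorphic_on ?S"
      by (intro holomorphic_on_add holomorphic_on_mult holomorphic_deriv ab A B open_regular)+
    ultimately show ?case by (intro exI[of _ ?a] exI[of _ ?b] conjI ballI)
  qed
  then have "\<forall>k. \<exists>a b. a holomorphic_on ?S \<and> b holomorphic_on ?S \<and> (\<forall>z\<in>?S. dzn k U z = a z * U z + b z * dz U z)" ..
  from choice[OF this] obtain a where "\<forall>k. \<exists>b. a k holomorphic_on ?S \<and> b holomorphic_on ?S \<and> (\<forall>z\<in>?S. dzn k U z = a k z * U z + b z * dz U z)" ..
  from choice[OF this] obtain b where *: "\<forall>k. a k holomorphic_on ?S \<and> b k holomorphic_on ?S \<and> (\<forall>z\<in>?S. dzn k U z = a k z * U z + b k z * dz U z)" ..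
  show ?thesis
  proof (rule that)
    show "a k holomorphic_on ?S" "b k holomorphic_on ?S" for k using * by blast+
    show "dzn k U z = a k z * U z + b k z * dz U z" if "poly f z \<noteq> 0" for k z using * that by blast
  qed
qed

text \<open>Holomorphic coefficients pass through \<open>dzb\<close>, and \<open>U\<close> is real,
  so the mixed derivatives are the values of one hermitian form on the coefficient pairs (a_k, b_k).
  Its matrix has the entries U, dz U, dzb U and dz (dzb U), and by \<open>star\<close> its
  determinant is the squared modulus of \<open>f\<close>, so it is positive definite at a regular
  point.\<close>

lemma derivatives_Gram:
  assumes z: "poly f z \<noteq> 0"
  obtains X Y where "\<And>k j. dzbn j (dzn k U) z = X k * cnj (X j) + Y k * cnj (Y j)"
proof -
  let ?S = "{z. poly f z \<noteq> 0}"
  have zS: "z \<in> ?S" using z by simp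
  obtain a b where a: "\<And>k. a k holomorphic_on ?S" and b: "\<And>k. b k holomorphic_on ?S"
    and eq: "\<And>k z. poly f z \<noteq> 0 \<Longrightarrow> dzn k U z = a k z * U z + b k z * dz U z"
    using dzn_linear_combination by blast
  have sd: "smooth (dz U)" by (rule smooth_dz[OF U])
  have step: "dzbn j (dzn k U) z = a k z * dzbn j U z + b k z * dzbn j (dz U) z" if "z \<in> ?S" for j k z
    using that
  proof (induction j arbitrary: z)
    case 0
    then show ?case using eq by simp
  next
    case (Suc j)
    have "wirt (\<lambda>z. a k z * dzbn j U z + b k z * dzbn j (dz U) z)
      ((deriv (a k) z * dzbn j U z + a k z * dz (dzbn j U) z) + (deriv (b k) z * dzbn j (dz U) z + b k z * dz (dzbn j (dz U)) z))
      ((0 * dzbn j U z + a k z * dzb (dzbn j U) z) + (0 * dzbn j (dz U) z + b k z * dzb (dzbn j (dz U)) z)) z"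
      using holomorphic_derivI[OF a open_regular Suc.prems] holomorphic_derivI[OF b open_regular Suc.prems]
      by (intro wirt_add wirt_mult wirt_holo smooth_wirt smooth_dzbn U sd)
    then have "wirt (dzbn j (dzn k U))
      ((deriv (a k) z * dzbn j U z + a k z * dz (dzbn j U) z) + (deriv (b k) z * dzbn j (dz U) z + b k z * dz (dzbn j (dz U)) z))
      ((0 * dzbn j U z + a k z * dzb (dzbn j U) z) + (0 * dzbn j (dz U) z + b k z * dzb (dzbn j (dz U)) z)) z"
      by (rule wirt_cong_open[OF _ open_regular Suc.prems]) (simp only: Suc.IH)
    from wirt_dzb[OF this] show ?case by simp
  qed
  have cj: "dzbn j U z = cnj (a j z) * U z + cnj (b j z) * dzb U z" if "z \<in> ?S" for j z
    using dzbn_real[OF U, of j] eq[of z j] that by (simp add: Uu cnj_dzU)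
  have cj2: "dzbn j (dz U) z = cnj (a j z) * dz U z + cnj (b j z) * dz (dzb U) z" for j
  proof -
    have "wirt (\<lambda>z. cnj (a j z) * U z + cnj (b j z) * dzb U z)
      ((cnj 0 * U z + cnj (a j z) * dz U z) + (cnj 0 * dzb U z + cnj (b j z) * dz (dzb U) z))
      ((cnj (deriv (a j) z) * U z + cnj (a j z) * dzb U z) + (cnj (deriv (b j) z) * dzb U z + cnj (b j z) * dzb (dzb U) z)) z"
      using holomorphic_derivI[OF a open_regular zS] holomorphic_derivI[OF b open_regular zS]
      by (intro wirt_add wirt_mult wirt_cnj wirt_holo smooth_wirt smooth_dzb U)
    then have "wirt (dzbn j U)
      ((cnj 0 * U z + cnj (a j z) * dz U z) + (cnj 0 * dzb U z + cnj (b j z) * dz (dzb U) z))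
      ((cnj (deriv (a j) z) * U z + cnj (a j z) * dzb U z) + (cnj (deriv (b j) z) * dzb U z + cnj (b j z) * dzb (dzb U) z)) z"
      by (rule wirt_cong_open[OF _ open_regular zS]) (simp only: cj)
    from wirt_dz[OF this] show ?thesis using dz_dzbn[OF U, of j] by simp
  qed
  \<comment> \<open>The Cholesky factorization of that matrix: \<open>r\<close> is the square root
    of the pivot u, and the remaining diagonal entry is |f|^2 / u.\<close>
  define r where "r = complex_of_real (sqrt (u z))"
  have r: "r * r = U z" "cnj r = r" "r \<noteq> 0" using upos[of z] unfolding r_def Uu by (auto simp flip: of_real_mult)
  define X where "X k = r * a k z + b k z * dz U z / r" for k
  define Y where "Y k = b k z * poly f z / r" for k
  have UV: "r * r * dz (dzb U) z = poly f z * cnj (poly f z) + dz U z * cnj (dz U z)"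
    using star[of z] unfolding r cnj_dzU by (simp add: algebra_simps)
  have "dzbn j (dzn k U) z = X k * cnj (X j) + Y k * cnj (Y j)" for k j
  proof -
    have "dzbn j (dzn k U) z = a k z * (cnj (a j z) * (r * r) + cnj (b j z) * cnj (dz U z))
        + b k z * (cnj (a j z) * dz U z + cnj (b j z) * (dz (dzb U) z))"
      unfolding step[OF zS] cj[OF zS] cj2 cnj_dzU r ..
    also have "dz (dzb U) z = (poly f z * cnj (poly f z) + dz U z * cnj (dz U z)) / (r * r)"
      using UV r(3) by (simp add: field_simps)
    finally show ?thesis using r(3) by (simp add: X_def Y_def r(2) field_simps)
  qed
  then show ?thesis by (rule that)
qed

lemma closure_regular: "closure {z. poly f z \<noteq> 0} = UNIV"
proof -
  have "finite {z. poly f z = 0}" by (rule poly_roots_finite[OF f])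
  then have "interior {z. poly f z = 0} = {}" by (rule empty_interior_finite)
  moreover have "{z. poly f z \<noteq> 0} = - {z. poly f z = 0}" by auto
  ultimately show ?thesis by (simp add: closure_complement)
qed

text \<open>At regular points this is a diagonal entry of a Gram matrix; the condition is closed and
  the regular points are dense.\<close>

lemma D_nonneg: "Im (dzbn N (dzn N U) z) = 0 \<and> 0 \<le> Re (dzbn N (dzn N U) z)"
proof -
  have c: "continuous_on UNIV (dzbn N (dzn N U))" by (intro smooth_continuous smooth_dzbn smooth_dzn U)
  have "closed {z. Im (dzbn N (dzn N U) z) = 0 \<and> 0 \<le> Re (dzbn N (dzn N U) z)}"
    by (intro closed_Collect_conj closed_Collect_eq closed_Collect_le continuous_intros c)
  moreover have "{z. poly f z \<noteq> 0} \<subseteq> {z. Im (dzbn N (dzn N U) z) = 0 \<and> 0 \<le> Re (dzbn N (dzn N U) z)}"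
  proof safe
    fix z assume "poly f z \<noteq> 0"
    then obtain X Y where XY: "\<And>k j. dzbn j (dzn k U) z = X k * cnj (X j) + Y k * cnj (Y j)" using derivatives_Gram by blast
    show "Im (dzbn N (dzn N U) z) = 0" "0 \<le> Re (dzbn N (dzn N U) z)"
      unfolding XY complex_norm_square[symmetric] by simp_all
  qed
  ultimately have "closure {z. poly f z \<noteq> 0} \<subseteq> {z. Im (dzbn N (dzn N U) z) = 0 \<and> 0 \<le> Re (dzbn N (dzn N U) z)}"
    by (rule closure_minimal[rotated])
  then show ?thesis unfolding closure_regular by blast
qed

text \<open>All functions \<open>dzb\<^sup>N dz\<^sup>N U\<close> are nonnegative; testing with a cutoff at scale \<open>R\<close> and moving the
  derivatives to it shows that they vanish once \<open>2 N\<close> exceeds the growth of the integral of \<open>U\<close>.\<close>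

lemma D_vanishes:
  assumes growth: "\<And>R z. R \<ge> 1 \<Longrightarrow> norm z \<le> R \<Longrightarrow> u z \<le> C * R ^ M"
  shows "dzbn (M + 2) (dzn (M + 2) U) a = 0"
proof -
  \<comment> \<open>With this \<open>N\<close> the area R^2, the growth R^M of \<open>U\<close> and
    the factor R^(-2N) from differentiating the dilated cutoff leave R^(-(M+2)).\<close>
  define N where "N = M + 2"
  define D where "D z = Re (dzbn N (dzn N U) z)" for z
  have Deq: "dzbn N (dzn N U) z = of_real (D z)" for z
    using D_nonneg[of N z] by (simp add: D_def complex_eq_iff)
  have D0: "D z \<ge> 0" for z using D_nonneg[of N z] by (simp add: D_def)
  have Dc: "continuous_on UNIV D" unfolding D_def[abs_def]
    by (intro continuous_intros smooth_continuous smooth_dzbn smooth_dzn U)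
  define chi where "chi z = complex_of_real (cutoff z)" for z :: complex
  have chi: "smooth chi" unfolding chi_def[abs_def] by (rule smooth_bounded_linear[OF bounded_linear_of_real smooth_cutoff])
  have chi0: "chi z = 0" if "norm z > 1" for z using that by (simp add: chi_def cutoff_eq_0)
  define Chi where "Chi = dzn N (dzbn N chi)"
  have sChi: "smooth Chi" unfolding Chi_def by (intro smooth_dzn smooth_dzbn chi)
  have out: "dzn k F z = 0" "dzbn k F z = 0" if "\<And>z. norm z > 1 \<Longrightarrow> F z = 0" "norm z > 1" for F k and z :: complex
    using that by (induction k arbitrary: z) (auto simp: dz_def dzb_def pd_eq_0_outside[of 1])
  have Chi0: "Chi z = 0" if "norm z > 1" for z
    unfolding Chi_def by (rule out(1)[OF out(2)[OF chi0] that])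
  obtain CC where CC: "CC > 0" "\<And>z. z \<in> cball 0 1 \<Longrightarrow> norm (Chi z) \<le> CC"
    using continuous_bounded_on_cball[OF smooth_continuous[OF sChi]] by blast
  have C0: "C \<ge> 0" using growth[of 1 0] upos[of 0] by simp
  define I where "I R = (LINT z|lborel. D z * cutoff (0 + (1 / R) *\<^sub>R z))" for R
  have bs: "bsupp (\<lambda>z::complex. cutoff (0 + (1 / R) *\<^sub>R z))" if "R > 0" for R
    by (rule bsuppI[of R]) (use that in \<open>auto intro!: cutoff_eq_0 simp: field_simps\<close>)
  have Ii: "integrable lborel (\<lambda>z. D z * cutoff (0 + (1 / R) *\<^sub>R z))" if "R > 0" for R
    by (intro integrable_continuous_bsupp continuous_on_mult Dc smooth_continuous smooth_affine smooth_cutoff bsupp_mult disjI2 bs that)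
  have I_le: "I R \<le> pi * C * CC / R ^ (M + 2)" if R: "R \<ge> 1" for R
  proof -
    define \<phi> where "\<phi> z = 1 * chi (of_real (1 / R) * z)" for z
    have s\<phi>: "smooth \<phi>"
    proof -
      have "smooth (\<lambda>z. chi (0 + (1 / R) *\<^sub>R z))" by (rule smooth_affine[OF chi])
      then show ?thesis by (simp add: \<phi>_def[abs_def] scaleR_conv_of_real)
    qed
    have b\<phi>: "bsupp \<phi>"
      by (rule bsuppI[of R]) (use R in \<open>auto intro!: chi0 simp: \<phi>_def norm_mult norm_divide field_simps\<close>)
    have scale: "dzn N (dzbn N \<phi>) z = of_real ((1 / R) ^ (2 * N)) * Chi (of_real (1 / R) * z)" for z
    proof -
      have "dzbn N \<phi> = (\<lambda>z. (1 * of_real (1 / R) ^ N) * dzbn N chi (of_real (1 / R) * z))"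
        unfolding \<phi>_def[abs_def] by (rule dzbn_scale[OF chi])
      then show ?thesis
        using dzn_scale[where k=N and c'="1 * of_real (1 / R) ^ N" and c="1 / R", OF smooth_dzbn[where k=N, OF chi]]
        by (simp add: Chi_def mult_2 power_add)
    qed
    have "complex_of_real (I R) = (LINT z|lborel. dzbn N (dzn N U) z * \<phi> z)"
      unfolding I_def Deq by (simp add: \<phi>_def chi_def scaleR_conv_of_real flip: of_real_mult)
    also have "\<dots> = (-1) ^ N * (LINT z|lborel. dzn N U z * dzbn N \<phi> z)"
      by (rule integral_dzbn_by_parts[OF smooth_dzn[OF U] s\<phi> b\<phi>])
    also have "\<dots> = (-1) ^ N * ((-1) ^ N * (LINT z|lborel. U z * dzn N (dzbn N \<phi>) z))"
      by (simp only: integral_dzn_by_parts[OF U smooth_dzbn[OF s\<phi>] bsupp_dzbn[OF b\<phi>]])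
    also have "\<dots> = (LINT z|lborel. U z * dzn N (dzbn N \<phi>) z)"
      by (simp flip: mult.assoc power_mult_distrib)
    finally have "complex_of_real (I R) = (LINT z|lborel. U z * dzn N (dzbn N \<phi>) z)" .
    then have "I R \<le> norm (LINT z|lborel. U z * dzn N (dzbn N \<phi>) z)" by (metis abs_ge_self norm_of_real)
    also have "\<dots> \<le> (LINT z|lborel. norm (U z * dzn N (dzbn N \<phi>) z))" by (rule integral_norm_bound)
    also have "\<dots> \<le> (LINT z|lborel. indicator (cball (0::complex) R) z * (C * R ^ M * ((1 / R) ^ (2 * N) * CC)))"
    proof (rule integral_mono)
      show "integrable lborel (\<lambda>z. norm (U z * dzn N (dzbn N \<phi>) z))"
        by (intro integrable_norm integrable_continuous_bsupp smooth_continuous smooth_mult U smooth_dzn smooth_dzbn s\<phi>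
            bsupp_mult disjI2 bsupp_dzn bsupp_dzbn b\<phi>)
      show "integrable lborel (\<lambda>z::complex. indicator (cball 0 R) z * (C * R ^ M * ((1 / R) ^ (2 * N) * CC)))"
        using emeasure_lborel_cball_finite[of "0::complex" R] by (intro integrable_mult_left integrable_real_indicator) auto
      fix z :: complex
      show "norm (U z * dzn N (dzbn N \<phi>) z) \<le> indicator (cball 0 R) z * (C * R ^ M * ((1 / R) ^ (2 * N) * CC))"
      proof (cases "norm z \<le> R")
        case True
        have "norm (of_real (1 / R) * z) \<le> 1" using True R by (simp add: norm_mult norm_divide field_simps)
        then have "norm (dzn N (dzbn N \<phi>) z) \<le> (1 / R) ^ (2 * N) * CC"
          unfolding scale norm_mult using CC(2)[of "of_real (1 / R) * z"] R by (intro mult_mono) (auto simp: norm_power norm_divide)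
        moreover have "norm (U z) \<le> C * R ^ M" using growth[OF R True] upos[of z] by (simp add: Uu)
        ultimately show ?thesis using True R C0 by (simp add: norm_mult mult_mono)
      next
        case False
        have "norm (of_real (1 / R) * z) > 1" using False R by (simp add: norm_mult norm_divide field_simps)
        then have "Chi (of_real (1 / R) * z) = 0" by (rule Chi0)
        then show ?thesis using False by (simp add: scale)
      qed
    qed
    also have "\<dots> = pi * R\<^sup>2 * (C * R ^ M * ((1 / R) ^ (2 * N) * CC))"
      using R by (simp add: content_cball unit_ball_vol_2)
    also have "\<dots> = pi * C * CC / R ^ (M + 2)"
    proof -
      have "R ^ (2 * N) = R\<^sup>2 * R ^ M * R ^ (M + 2)" by (simp add: N_def mult_2 flip: power_add)
      then show ?thesis using R by (simp add: power_divide)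
    qed
    finally show ?thesis .
  qed
  have lim: "((\<lambda>R. pi * C * CC / R ^ (M + 2)) \<longlongrightarrow> 0) at_top"
  proof -
    have "filterlim (\<lambda>R::real. R ^ (M + 2)) at_top at_top"
      by (rule filterlim_pow_at_top[OF _ filterlim_ident]) simp
    then show ?thesis by (rule tendsto_divide_0[OF tendsto_const filterlim_at_top_imp_at_infinity])
  qed
  have I0: "I r = 0" if r: "r > 0" for r
  proof -
    \<comment> \<open>For \<open>R >= 2 * r\<close> the cutoff at scale \<open>R\<close> equals 1 on
      the support of the cutoff at scale \<open>r\<close>; with \<open>D\<close> nonnegative the
      integrals increase, so the decay for large \<open>R\<close> reaches the fixed scale
      \<open>r\<close>.\<close>
    have mono: "I r \<le> I R" if R: "R \<ge> 2 * r" for R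
      unfolding I_def
    proof (rule integral_mono[OF Ii[OF r] Ii])
      show "R > 0" using R r by simp
      fix z :: complex
      have "cutoff (0 + (1 / r) *\<^sub>R z) \<le> cutoff (0 + (1 / R) *\<^sub>R z)"
      proof (cases "norm z \<le> r")
        case True
        then have "norm (0 + (1 / R) *\<^sub>R z) \<le> 1 / 2" using R r by (simp add: field_simps)
        from cutoff_eq_1[OF this] show ?thesis by (simp only: cutoff_le_1)
      next
        case False
        then have "cutoff (0 + (1 / r) *\<^sub>R z) = 0" using r by (intro cutoff_eq_0) (simp add: field_simps)
        then show ?thesis using cutoff_nonneg by simp
      qed
      then show "D z * cutoff (0 + (1 / r) *\<^sub>R z) \<le> D z * cutoff (0 + (1 / R) *\<^sub>R z)" by (rule mult_left_mono[OF _ D0])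
    qed
    have "eventually (\<lambda>R. I r \<le> pi * C * CC / R ^ (M + 2)) at_top"
      using eventually_ge_at_top[of "max 1 (2 * r)"]
    proof eventually_elim
      case (elim R)
      then show ?case using mono[of R] I_le[of R] by simp
    qed
    then have "I r \<le> 0" by (rule tendsto_lowerbound[OF lim]) simp
    moreover have "I r \<ge> 0" unfolding I_def
      using D0 by (intro integral_nonneg_AE AE_I2 mult_nonneg_nonneg cutoff_nonneg)
    ultimately show ?thesis by simp
  qed
  \<comment> \<open>Large enough for \<open>a\<close> to lie where the cutoff at scale
    \<open>r\<close> equals 1.\<close>
  define r where "r = 2 * norm a + 1"
  have r: "r > 0" by (simp add: r_def add_nonneg_pos)
  have nn: "AE z in lborel. 0 \<le> D z * cutoff (0 + (1 / r) *\<^sub>R z)"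
    by (intro AE_I2 mult_nonneg_nonneg D0 cutoff_nonneg)
  have ae: "AE z in lborel. D z * cutoff (0 + (1 / r) *\<^sub>R z) = 0"
    using integral_nonneg_eq_0_iff_AE[OF Ii[OF r] nn] I0[OF r] unfolding I_def by blast
  have "D a * cutoff (0 + (1 / r) *\<^sub>R a) = 0"
    by (rule AE_0_continuous_imp_0[OF continuous_on_mult[OF Dc smooth_continuous[OF smooth_affine[OF smooth_cutoff]]] ae])
  moreover have "cutoff (0 + (1 / r) *\<^sub>R a) = 1" by (rule cutoff_eq_1) (use r in \<open>simp add: r_def field_simps\<close>)
  ultimately show ?thesis using Deq[of a] by (simp add: N_def)
qed

text \<open>A vanishing diagonal entry of a Gram matrix kills the vectors X_N, Y_N and with them the
  whole row, including \<open>dzn N U\<close> itself. Then \<open>bipolynomial_Taylor\<close>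
  applies, and the Gram form at one regular point \<open>z0\<close> splits the double Taylor sum
  into two products of a polynomial with its conjugate.\<close>

lemma sum_of_squares:
  assumes growth: "\<And>R z. R \<ge> 1 \<Longrightarrow> norm z \<le> R \<Longrightarrow> u z \<le> C * R ^ M"
  obtains P Q where "\<And>z. u z = (cmod (poly P z))\<^sup>2 + (cmod (poly Q z))\<^sup>2"
proof -
  define N where "N = M + 2"
  have dzn0: "dzn N U z = 0" for z
  proof -
    have "closed {z. dzn N U z = 0}"
      by (intro closed_Collect_eq smooth_continuous smooth_dzn U continuous_on_const)
    moreover have "{z. poly f z \<noteq> 0} \<subseteq> {z. dzn N U z = 0}"
    proof safe
      fix z assume "poly f z \<noteq> 0"
      then obtain X Y where XY: "\<And>k j. dzbn j (dzn k U) z = X k * cnj (X j) + Y k * cnj (Y j)" using derivatives_Gram by blast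
      have "complex_of_real ((cmod (X N))\<^sup>2 + (cmod (Y N))\<^sup>2) = 0"
        using D_vanishes[OF growth, of z] unfolding XY N_def[symmetric] complex_norm_square[symmetric] by simp
      then have "X N = 0" "Y N = 0" unfolding of_real_eq_0_iff sum_power2_eq_zero_iff by auto
      then show "dzn N U z = 0" using XY[of 0 N] by simp
    qed
    ultimately have "closure {z. poly f z \<noteq> 0} \<subseteq> {z. dzn N U z = 0}" by (rule closure_minimal[rotated])
    then show ?thesis unfolding closure_regular by blast
  qed
  have dzbn0: "dzbn N U z = 0" for z using dzbn_real[OF U, of N] dzn0 by (simp add: Uu)
  obtain z0 where z0: "poly f z0 \<noteq> 0" using f poly_all_0_iff_0 by blast
  obtain X Y where XY: "\<And>k j. dzbn j (dzn k U) z0 = X k * cnj (X j) + Y k * cnj (Y j)" using derivatives_Gram[OF z0] by blast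
  define P where "P = (\<Sum>k<N. smult (X k / fact k) ([:-z0, 1:] ^ k))"
  define Q where "Q = (\<Sum>k<N. smult (Y k / fact k) ([:-z0, 1:] ^ k))"
  have pP: "poly P a = (\<Sum>k<N. X k * ((a - z0) ^ k / fact k))" "poly Q a = (\<Sum>k<N. Y k * ((a - z0) ^ k / fact k))" for a
    by (simp_all add: P_def Q_def poly_sum)
  have "u a = (cmod (poly P a))\<^sup>2 + (cmod (poly Q a))\<^sup>2" for a
  proof -
    let ?w = "\<lambda>k. (a - z0) ^ k / fact k"
    have cw: "cnj (a - z0) ^ j / fact j = cnj (?w j)" for j by simp
    have "U a = (\<Sum>k<N. \<Sum>j<N. ?w k * (cnj (a - z0) ^ j / fact j) * dzbn j (dzn k U) z0)"
      by (rule bipolynomial_Taylor[OF U dzn0 dzbn0])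
    also have "\<dots> = (\<Sum>k<N. \<Sum>j<N. (X k * ?w k) * cnj (X j * ?w j) + (Y k * ?w k) * cnj (Y j * ?w j))"
      unfolding cw XY by (intro sum.cong refl) (simp add: algebra_simps add_divide_distrib)
    also have "\<dots> = (\<Sum>k<N. X k * ?w k) * cnj (\<Sum>j<N. X j * ?w j) + (\<Sum>k<N. Y k * ?w k) * cnj (\<Sum>j<N. Y j * ?w j)"
      unfolding sum.distrib cnj_sum sum_product ..
    also have "\<dots> = of_real ((cmod (poly P a))\<^sup>2 + (cmod (poly Q a))\<^sup>2)"
      unfolding pP[symmetric] complex_norm_square[symmetric] by simp
    finally show ?thesis unfolding Uu of_real_eq_iff .
  qed
  then show ?thesis by (rule that)
qed

end

lemma poly_zero_on_reals:
  fixes p :: "complex poly"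
  assumes "\<And>x::real. poly p (of_real x) = 0" shows "p = 0"
proof (rule ccontr)
  assume "p \<noteq> 0"
  then have "finite {z. poly p z = 0}" by (rule poly_roots_finite)
  moreover have "range complex_of_real \<subseteq> {z. poly p z = 0}" using assms by auto
  ultimately have "finite (range complex_of_real)" by (rule rev_finite_subset)
  then have "finite (UNIV :: real set)" by (rule finite_imageD) (simp add: inj_on_def)
  then show False using infinite_UNIV_char_0 by blast
qed

section \<open>Uniqueness up to unitary matrices\<close>

text \<open>Polarization: \<open>z\<close> and its conjugate are independent in a polynomial identity, as one sees by writing
  \<open>z = x + i y\<close> and letting first \<open>x\<close>, then \<open>y\<close> become complex.\<close>

lemma polarization:
  fixes P Q :: "'i \<Rightarrow> complex poly"
  assumes zero: "\<And>z. (\<Sum>i\<in>I. poly (P i) z * poly (Q i) (cnj z)) = 0"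
  shows "(\<Sum>i\<in>I. poly (P i) z * poly (Q i) w) = 0"
proof -
  have 1: "(\<Sum>i\<in>I. poly (P i) (x + \<i> * of_real y) * poly (Q i) (x - \<i> * of_real y)) = 0" for x and y :: real
  proof -
    define p where "p = (\<Sum>i\<in>I. pcompose (P i) [:\<i> * of_real y, 1:] * pcompose (Q i) [:- (\<i> * of_real y), 1:])"
    have p: "poly p x = (\<Sum>i\<in>I. poly (P i) (x + \<i> * of_real y) * poly (Q i) (x - \<i> * of_real y))" for x
      by (simp add: p_def poly_sum poly_pcompose add.commute)
    have "poly p (of_real t) = 0" for t
      using zero[of "of_real t + \<i> * of_real y"] unfolding p by simp
    then have "p = 0" by (rule poly_zero_on_reals)
    then show ?thesis using p[of x] by simp
  qed
  have 2: "(\<Sum>i\<in>I. poly (P i) (x + \<i> * y) * poly (Q i) (x - \<i> * y)) = 0" for x y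
  proof -
    define p where "p = (\<Sum>i\<in>I. pcompose (P i) [:x, \<i>:] * pcompose (Q i) [:x, - \<i>:])"
    have p: "poly p y = (\<Sum>i\<in>I. poly (P i) (x + \<i> * y) * poly (Q i) (x - \<i> * y))" for y
      by (simp add: p_def poly_sum poly_pcompose mult.commute)
    have "poly p (of_real t) = 0" for t using 1[of x t] unfolding p by simp
    then have "p = 0" by (rule poly_zero_on_reals)
    then show ?thesis using p[of y] by simp
  qed
  have "(z + w) / 2 + \<i> * ((z - w) / (2 * \<i>)) = z" "(z + w) / 2 - \<i> * ((z - w) / (2 * \<i>)) = w"
    by (simp_all add: field_simps)
  then show ?thesis using 2[of "(z + w) / 2" "(z - w) / (2 * \<i>)"] by simp
qed

lemma sum_of_squares_polarize:
  assumes eq: "\<And>z. (cmod (poly P z))\<^sup>2 + (cmod (poly Q z))\<^sup>2 = (cmod (poly P' z))\<^sup>2 + (cmod (poly Q' z))\<^sup>2"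
  shows "poly P z * cnj (poly P w) + poly Q z * cnj (poly Q w) = poly P' z * cnj (poly P' w) + poly Q' z * cnj (poly Q' w)"
proof -
  \<comment> \<open>The signs of the last two entries bring both sides into one vanishing sum.
    Conjugating the coefficients in \<open>B\<close> makes the conjugated values polynomials in the
    conjugate of \<open>z\<close>, as \<open>polarization\<close> requires.\<close>
  define A where "A = (\<lambda>i::nat. if i = 0 then P else if i = 1 then Q else if i = 2 then - P' else - Q')"
  define B where "B = (\<lambda>i::nat. map_poly cnj (if i = 0 then P else if i = 1 then Q else if i = 2 then P' else Q'))"
  have S: "(\<Sum>i\<in>{0,1,2,3}. poly (A i) z * poly (B i) w)
     = (poly P z * cnj (poly P (cnj w)) + poly Q z * cnj (poly Q (cnj w))) - (poly P' z * cnj (poly P' (cnj w)) + poly Q' z * cnj (poly Q' (cnj w)))" for z w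
    by (simp add: A_def B_def)
  have "(\<Sum>i\<in>{0,1,2,3}. poly (A i) z * poly (B i) (cnj z)) = 0" for z
  proof -
    have "complex_of_real ((cmod (poly P z))\<^sup>2 + (cmod (poly Q z))\<^sup>2) = complex_of_real ((cmod (poly P' z))\<^sup>2 + (cmod (poly Q' z))\<^sup>2)"
      by (simp only: eq)
    then show ?thesis unfolding S by (simp only: of_real_add complex_norm_square complex_cnj_cnj) simp
  qed
  from polarization[where I="{0,1,2,3}" and P=A and Q=B, OF this, of z "cnj w"] show ?thesis unfolding S by simp
qed

text \<open>Fixing one \<open>w\<close> with \<open>c w\<close> nonzero determines the factor, and
  the case \<open>z = w\<close> shows that it is a phase. Besides its use for orthogonal components
  below, it compares two polynomials of equal modulus.\<close>

lemma proportional_of_rank_one: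
  fixes c c' :: "'a \<Rightarrow> complex"
  assumes eq: "\<And>z w. c z * cnj (c w) = c' z * cnj (c' w)"
  obtains \<theta> where "\<theta> * cnj \<theta> = 1" "\<And>z. c' z = \<theta> * c z"
proof (cases "\<exists>w. c w \<noteq> 0")
  case False
  then have "c' z = 0" for z using eq[of z z] by simp
  then show ?thesis using that[of 1] False by simp
next
  case True
  then obtain w where w: "c w \<noteq> 0" by blast
  then have w': "c' w \<noteq> 0" using eq[of w w] by auto
  define \<theta> where "\<theta> = cnj (c w) / cnj (c' w)"
  have 1: "c' z = \<theta> * c z" for z using eq[of z w] w' by (simp add: \<theta>_def field_simps)
  have "\<theta> * cnj \<theta> = 1" using eq[of w w] w w' by (simp add: \<theta>_def field_simps)
  then show ?thesis using 1 by (rule that)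
qed

text \<open>Unitarity of the matrix constructed below, cleared of denominators. The letters
  \<open>u\<close>, \<open>v\<close>, \<open>u'\<close>, \<open>v'\<close>, \<open>t'\<close> stand
  for the conjugates of \<open>a\<close>, \<open>b\<close>, \<open>a'\<close>, \<open>b'\<close>,
  \<open>t\<close>; as independent letters they turn the claims into ring identities.\<close>

lemma gram_identities:
  fixes a b a' b' u v u' v' t t' n :: "'a::comm_ring_1"
  assumes n: "n = a * u + b * v" "n = a' * u' + b' * v'" and t: "t * t' = 1"
  shows
    "(a * u' + t' * v * b') * (u * a' + t * b * v') + (a * v' - t' * v * a') * (u * b' - t * b * u') = n * n"
    "(a * u' + t' * v * b') * (v * a' - t * a * v') + (a * v' - t' * v * a') * (v * b' + t * a * u') = 0"
    "(b * u' - t' * u * b') * (u * a' + t * b * v') + (b * v' + t' * u * a') * (u * b' - t * b * u') = 0"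
    "(b * u' - t' * u * b') * (v * a' - t * a * v') + (b * v' + t' * u * a') * (v * b' + t * a * u') = n * n"
proof -
  have "(a * u' + t' * v * b') * (u * a' + t * b * v') + (a * v' - t' * v * a') * (u * b' - t * b * u') = a * u * (a' * u' + b' * v') + (t * t') * (b * v) * (a' * u' + b' * v')"
    by (simp add: algebra_simps)
  also have "\<dots> = n * n" unfolding t n(2)[symmetric] by (simp add: n(1) algebra_simps)
  finally show "(a * u' + t' * v * b') * (u * a' + t * b * v') + (a * v' - t' * v * a') * (u * b' - t * b * u') = n * n" .
  have "(a * u' + t' * v * b') * (v * a' - t * a * v') + (a * v' - t' * v * a') * (v * b' + t * a * u') = a * v * (a' * u' + b' * v') - (t * t') * (a * v) * (a' * u' + b' * v')"
    by (simp add: algebra_simps)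
  also have "\<dots> = 0" unfolding t n(2)[symmetric] by simp
  finally show "(a * u' + t' * v * b') * (v * a' - t * a * v') + (a * v' - t' * v * a') * (v * b' + t * a * u') = 0" .
  have "(b * u' - t' * u * b') * (u * a' + t * b * v') + (b * v' + t' * u * a') * (u * b' - t * b * u') = b * u * (a' * u' + b' * v') - (t * t') * (b * u) * (a' * u' + b' * v')"
    by (simp add: algebra_simps)
  also have "\<dots> = 0" unfolding t n(2)[symmetric] by simp
  finally show "(b * u' - t' * u * b') * (u * a' + t * b * v') + (b * v' + t' * u * a') * (u * b' - t * b * u') = 0" .
  have "(b * u' - t' * u * b') * (v * a' - t * a * v') + (b * v' + t' * u * a') * (v * b' + t * a * u') = b * v * (a' * u' + b' * v') + (t * t') * (a * u) * (a' * u' + b' * v')"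
    by (simp add: algebra_simps)
  also have "\<dots> = n * n" unfolding t n(2)[symmetric] by (simp add: n(1) algebra_simps)
  finally show "(b * u' - t' * u * b') * (v * a' - t * a * v') + (b * v' + t' * u * a') * (v * b' + t * a * u') = n * n" .
qed

text \<open>At a point \<open>z1\<close> where (P, Q) takes a nonzero value (a, b), the components
  along (a, b) of the first pair and along (a', b') of the second agree. The orthogonal components
  \<open>a * Q z - b * P z\<close> and their primed counterparts have equal rank one kernels, so
  they differ by a phase \<theta>. The matrix sought maps one orthogonal frame to the other, with
  that phase.\<close>

lemma proportional_of_equal_Gram:
  fixes P Q P' Q' :: "'a \<Rightarrow> complex"
  assumes gram: "\<And>z w. P z * cnj (P w) + Q z * cnj (Q w) = P' z * cnj (P' w) + Q' z * cnj (Q' w)"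
  obtains \<alpha> \<beta> \<gamma> \<delta> where "\<And>z. P' z = \<alpha> * P z + \<beta> * Q z" "\<And>z. Q' z = \<gamma> * P z + \<delta> * Q z"
    "cnj \<alpha> * \<alpha> + cnj \<gamma> * \<gamma> = 1" "cnj \<alpha> * \<beta> + cnj \<gamma> * \<delta> = 0" "cnj \<beta> * \<alpha> + cnj \<delta> * \<gamma> = 0" "cnj \<beta> * \<beta> + cnj \<delta> * \<delta> = 1"
proof (cases "\<exists>z. P z \<noteq> 0 \<or> Q z \<noteq> 0")
  case False
  have "P' z = 0 \<and> Q' z = 0" for z
  proof -
    have "complex_of_real ((cmod (P' z))\<^sup>2 + (cmod (Q' z))\<^sup>2) = 0"
      using gram[of z z] False by (simp only: of_real_add complex_norm_square) simp
    then show ?thesis unfolding of_real_eq_0_iff sum_power2_eq_zero_iff by simp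
  qed
  then show ?thesis using that[of 1 0 0 1] False by simp
next
  case True
  then obtain z1 where z1: "P z1 \<noteq> 0 \<or> Q z1 \<noteq> 0" by blast
  define a where "a = P z1"
  define b where "b = Q z1"
  define a' where "a' = P' z1"
  define b' where "b' = Q' z1"
  define n where "n = a * cnj a + b * cnj b"
  have n': "n = a' * cnj a' + b' * cnj b'" using gram[of z1 z1] by (simp add: n_def a_def b_def a'_def b'_def)
  have "n = of_real ((cmod a)\<^sup>2 + (cmod b)\<^sup>2)" by (simp only: n_def of_real_add complex_norm_square)
  then have cn: "cnj n = n" and n0: "n \<noteq> 0" using z1 by (auto simp: a_def b_def sum_power2_eq_zero_iff simp del: of_real_add)
  have s: "P z * cnj a + Q z * cnj b = P' z * cnj a' + Q' z * cnj b'" for z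
    using gram[of z z1] by (simp add: a_def b_def a'_def b'_def)
  \<comment> \<open>Lagrange's identity: \<open>n\<close> times the Gram kernel minus the product of
    the parallel components is the product of the orthogonal ones, and the first two quantities are
    common to both pairs.\<close>
  have c: "(a * Q z - b * P z) * cnj (a * Q w - b * P w) = (a' * Q' z - b' * P' z) * cnj (a' * Q' w - b' * P' w)" for z w
  proof -
    have s': "cnj (P w) * a + cnj (Q w) * b = cnj (P' w) * a' + cnj (Q' w) * b'"
      using arg_cong[OF s[of w], of cnj] by simp
    have g: "P z * cnj (P w) + Q z * cnj (Q w) = P' z * cnj (P' w) + Q' z * cnj (Q' w)" by (rule gram)
    have d: "cnj (a * Q w - b * P w) = cnj a * cnj (Q w) - cnj b * cnj (P w)"
      "cnj (a' * Q' w - b' * P' w) = cnj a' * cnj (Q' w) - cnj b' * cnj (P' w)" by simp_all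
    have "(a * Q z - b * P z) * cnj (a * Q w - b * P w)
        = n * (P z * cnj (P w) + Q z * cnj (Q w)) - (P z * cnj a + Q z * cnj b) * (cnj (P w) * a + cnj (Q w) * b)"
      unfolding d n_def by (simp add: algebra_simps)
    also have "\<dots> = n * (P' z * cnj (P' w) + Q' z * cnj (Q' w)) - (P' z * cnj a' + Q' z * cnj b') * (cnj (P' w) * a' + cnj (Q' w) * b')"
      unfolding g s s' ..
    also have "\<dots> = (a' * Q' z - b' * P' z) * cnj (a' * Q' w - b' * P' w)"
      unfolding d n' by (simp add: algebra_simps)
    finally show ?thesis .
  qed
  obtain \<theta> where \<theta>: "\<theta> * cnj \<theta> = 1" and c': "\<And>z. a' * Q' z - b' * P' z = \<theta> * (a * Q z - b * P z)"
    using proportional_of_rank_one[of "\<lambda>z. a * Q z - b * P z" "\<lambda>z. a' * Q' z - b' * P' z"] c by metis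
  \<comment> \<open>These four entries form the matrix that sends (a, b) to (a', b') and (- cnj b,
    cnj a) to \<theta> (- cnj b', cnj a').\<close>
  define \<alpha> where "\<alpha> = (cnj a * a' + \<theta> * b * cnj b') / n"
  define \<beta> where "\<beta> = (cnj b * a' - \<theta> * a * cnj b') / n"
  define \<gamma> where "\<gamma> = (cnj a * b' - \<theta> * b * cnj a') / n"
  define \<delta> where "\<delta> = (cnj b * b' + \<theta> * a * cnj a') / n"
  have cc: "cnj \<alpha> = (a * cnj a' + cnj \<theta> * cnj b * b') / n" "cnj \<beta> = (b * cnj a' - cnj \<theta> * cnj a * b') / n"
    "cnj \<gamma> = (a * cnj b' - cnj \<theta> * cnj b * a') / n" "cnj \<delta> = (b * cnj b' + cnj \<theta> * cnj a * a') / n"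
    by (simp_all add: \<alpha>_def \<beta>_def \<gamma>_def \<delta>_def cn)
  show ?thesis
  proof (rule that[of \<alpha> \<beta> \<gamma> \<delta>])
    show "P' z = \<alpha> * P z + \<beta> * Q z" for z
    proof -
      have "n * P' z = (P' z * cnj a' + Q' z * cnj b') * a' - (a' * Q' z - b' * P' z) * cnj b'" unfolding n' by (simp add: algebra_simps)
      also have "\<dots> = (P z * cnj a + Q z * cnj b) * a' - \<theta> * (a * Q z - b * P z) * cnj b'" unfolding s c' ..
      also have "\<dots> = n * (\<alpha> * P z + \<beta> * Q z)"
      proof -
        have e: "n * (\<alpha> * P z + \<beta> * Q z) = (n * \<alpha>) * P z + (n * \<beta>) * Q z" by (simp add: algebra_simps)
        have e': "n * \<alpha> = cnj a * a' + \<theta> * b * cnj b'" "n * \<beta> = cnj b * a' - \<theta> * a * cnj b'"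
          using n0 by (simp_all add: \<alpha>_def \<beta>_def)
        show ?thesis unfolding e unfolding e' by (simp add: algebra_simps)
      qed
      finally show ?thesis using n0 by simp
    qed
    show "Q' z = \<gamma> * P z + \<delta> * Q z" for z
    proof -
      have "n * Q' z = (P' z * cnj a' + Q' z * cnj b') * b' + (a' * Q' z - b' * P' z) * cnj a'" unfolding n' by (simp add: algebra_simps)
      also have "\<dots> = (P z * cnj a + Q z * cnj b) * b' + \<theta> * (a * Q z - b * P z) * cnj a'" unfolding s c' ..
      also have "\<dots> = n * (\<gamma> * P z + \<delta> * Q z)"
      proof -
        have e: "n * (\<gamma> * P z + \<delta> * Q z) = (n * \<gamma>) * P z + (n * \<delta>) * Q z" by (simp add: algebra_simps)
        have e': "n * \<gamma> = cnj a * b' - \<theta> * b * cnj a'" "n * \<delta> = cnj b * b' + \<theta> * a * cnj a'"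
          using n0 by (simp_all add: \<gamma>_def \<delta>_def)
        show ?thesis unfolding e unfolding e' by (simp add: algebra_simps)
      qed
      finally show ?thesis using n0 by simp
    qed
    have nn: "n * n \<noteq> 0" using n0 by simp
    show "cnj \<alpha> * \<alpha> + cnj \<gamma> * \<gamma> = 1" "cnj \<alpha> * \<beta> + cnj \<gamma> * \<delta> = 0" "cnj \<beta> * \<alpha> + cnj \<delta> * \<gamma> = 0" "cnj \<beta> * \<beta> + cnj \<delta> * \<delta> = 1"
      unfolding cc unfolding \<alpha>_def \<beta>_def \<gamma>_def \<delta>_def times_divide_times_eq add_divide_distrib[symmetric] gram_identities[OF n_def n' \<theta>]
      using nn by simp_all
  qed
qed

section \<open>Unitary matrices of size two and equality of the functions psi\<close>

abbreviation entry :: "'a^'n^'m \<Rightarrow> 'm \<Rightarrow> 'n \<Rightarrow> 'a"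
  where "entry A i j \<equiv> vec_nth (vec_nth A i) j"

lemma vector_eq_matrix_iff:
  fixes \<Lambda> :: "complex^2^2"
  shows "vector [x', y'] = \<Lambda> *v vector [x, y] \<longleftrightarrow> x' = entry \<Lambda> 1 1 * x + entry \<Lambda> 1 2 * y \<and> y' = entry \<Lambda> 2 1 * x + entry \<Lambda> 2 2 * y"
  by (simp add: vec_eq_iff forall_2 matrix_vector_mult_def sum_2 vector_2)

lemma matrix_2_eq_iff:
  fixes A B :: "'a^2^2"
  shows "A = B \<longleftrightarrow> entry A 1 1 = entry B 1 1 \<and> entry A 1 2 = entry B 1 2 \<and> entry A 2 1 = entry B 2 1 \<and> entry A 2 2 = entry B 2 2"
proof (rule iffI)
  assume r: "entry A 1 1 = entry B 1 1 \<and> entry A 1 2 = entry B 1 2 \<and> entry A 2 1 = entry B 2 1 \<and> entry A 2 2 = entry B 2 2"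
  have "entry A i j = entry B i j" for i j
    using exhaust_2[of i] exhaust_2[of j] r by metis
  then show "A = B" unfolding vec_eq_iff by blast
qed blast

lemma unitary_matrix_iff:
  fixes \<Lambda> :: "complex^2^2"
  shows "unitary_matrix \<Lambda> \<longleftrightarrow>
     cnj (entry \<Lambda> 1 1) * entry \<Lambda> 1 1 + cnj (entry \<Lambda> 2 1) * entry \<Lambda> 2 1 = 1 \<and> cnj (entry \<Lambda> 1 1) * entry \<Lambda> 1 2 + cnj (entry \<Lambda> 2 1) * entry \<Lambda> 2 2 = 0 \<and>
     cnj (entry \<Lambda> 1 2) * entry \<Lambda> 1 1 + cnj (entry \<Lambda> 2 2) * entry \<Lambda> 2 1 = 0 \<and> cnj (entry \<Lambda> 1 2) * entry \<Lambda> 1 2 + cnj (entry \<Lambda> 2 2) * entry \<Lambda> 2 2 = 1"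
proof -
  have c: "entry (conj_transpose \<Lambda> ** \<Lambda>) i j = cnj (entry \<Lambda> 1 i) * entry \<Lambda> 1 j + cnj (entry \<Lambda> 2 i) * entry \<Lambda> 2 j" for i j
    by (simp add: matrix_matrix_mult_def sum_2 conj_transpose_def)
  have m: "entry (mat 1 :: complex^2^2) 1 1 = 1" "entry (mat 1 :: complex^2^2) 1 2 = 0" "entry (mat 1 :: complex^2^2) 2 1 = 0" "entry (mat 1 :: complex^2^2) 2 2 = 1"
    by (simp_all add: mat_def)
  have "unitary_matrix \<Lambda> \<longleftrightarrow> conj_transpose \<Lambda> ** \<Lambda> = mat 1"
    by (metis matrix_left_right_inverse unitary_matrix_def)
  then show ?thesis by (simp only: matrix_2_eq_iff c m)
qed

text \<open>The value of \<open>psi\<close> at a point determines the sum of squares there: the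
  value \<infinity> occurs exactly when the sum is 0, and \<open>ln\<close> is injective on positive
  reals.\<close>

lemma psi_eq_iff:
  "psi P Q = psi P' Q' \<longleftrightarrow> (\<forall>z. (cmod (poly P z))\<^sup>2 + (cmod (poly Q z))\<^sup>2 = (cmod (poly P' z))\<^sup>2 + (cmod (poly Q' z))\<^sup>2)"
proof
  assume eq: "psi P Q = psi P' Q'"
  have inj: "r = r'" if "r \<ge> 0" "r' \<ge> 0"
    "(if r = 0 then \<infinity> else ereal (ln 8 - 2 * ln r)) = (if r' = 0 then \<infinity> else ereal (ln 8 - 2 * ln r'))" for r r' :: real
    using that by (cases "r = 0"; cases "r' = 0") auto
  show "\<forall>z. (cmod (poly P z))\<^sup>2 + (cmod (poly Q z))\<^sup>2 = (cmod (poly P' z))\<^sup>2 + (cmod (poly Q' z))\<^sup>2"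
  proof
    fix z
    let ?r = "(cmod (poly P z))\<^sup>2 + (cmod (poly Q z))\<^sup>2" and ?r' = "(cmod (poly P' z))\<^sup>2 + (cmod (poly Q' z))\<^sup>2"
    have "psi P Q z = psi P' Q' z" using eq by simp
    then have e: "(if ?r = 0 then \<infinity> else ereal (ln 8 - 2 * ln ?r)) = (if ?r' = 0 then \<infinity> else ereal (ln 8 - 2 * ln ?r'))"
      by (simp only: psi_def Let_def)
    show "?r = ?r'" by (rule inj[OF _ _ e]) simp_all
  qed
next
  assume "\<forall>z. (cmod (poly P z))\<^sup>2 + (cmod (poly Q z))\<^sup>2 = (cmod (poly P' z))\<^sup>2 + (cmod (poly Q' z))\<^sup>2"
  then show "psi P Q = psi P' Q'" by (simp only: psi_def)
qed

lemma psi_eq_iff_unitary: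
  "psi P Q = psi P' Q' \<longleftrightarrow> (\<exists>\<Lambda> :: complex^2^2. unitary_matrix \<Lambda> \<and>
     (\<forall>z. vector [poly P' z, poly Q' z] = \<Lambda> *v vector [poly P z, poly Q z]))"
proof
  assume "psi P Q = psi P' Q'"
  then have gram: "poly P z * cnj (poly P w) + poly Q z * cnj (poly Q w) = poly P' z * cnj (poly P' w) + poly Q' z * cnj (poly Q' w)" for z w
    unfolding psi_eq_iff by (intro sum_of_squares_polarize) blast
  obtain \<alpha> \<beta> \<gamma> \<delta> where *: "\<And>z. poly P' z = \<alpha> * poly P z + \<beta> * poly Q z" "\<And>z. poly Q' z = \<gamma> * poly P z + \<delta> * poly Q z"
    "cnj \<alpha> * \<alpha> + cnj \<gamma> * \<gamma> = 1" "cnj \<alpha> * \<beta> + cnj \<gamma> * \<delta> = 0" "cnj \<beta> * \<alpha> + cnj \<delta> * \<gamma> = 0" "cnj \<beta> * \<beta> + cnj \<delta> * \<delta> = 1"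
    using proportional_of_equal_Gram[of "poly P" "poly Q" "poly P'" "poly Q'", OF gram] by metis
  define \<Lambda> :: "complex^2^2" where "\<Lambda> = vector [vector [\<alpha>, \<beta>], vector [\<gamma>, \<delta>]]"
  have "entry \<Lambda> 1 1 = \<alpha>" "entry \<Lambda> 1 2 = \<beta>" "entry \<Lambda> 2 1 = \<gamma>" "entry \<Lambda> 2 2 = \<delta>" by (simp_all add: \<Lambda>_def vector_2)
  then show "\<exists>\<Lambda> :: complex^2^2. unitary_matrix \<Lambda> \<and> (\<forall>z. vector [poly P' z, poly Q' z] = \<Lambda> *v vector [poly P z, poly Q z])"
    unfolding vector_eq_matrix_iff unitary_matrix_iff using * by (intro exI[of _ \<Lambda>]) simp
next
  assume "\<exists>\<Lambda> :: complex^2^2. unitary_matrix \<Lambda> \<and> (\<forall>z. vector [poly P' z, poly Q' z] = \<Lambda> *v vector [poly P z, poly Q z])"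
  then obtain \<Lambda> :: "complex^2^2" where L: "unitary_matrix \<Lambda>"
    "\<And>z. poly P' z = entry \<Lambda> 1 1 * poly P z + entry \<Lambda> 1 2 * poly Q z" "\<And>z. poly Q' z = entry \<Lambda> 2 1 * poly P z + entry \<Lambda> 2 2 * poly Q z"
    unfolding vector_eq_matrix_iff by blast
  have "(cmod (poly P z))\<^sup>2 + (cmod (poly Q z))\<^sup>2 = (cmod (poly P' z))\<^sup>2 + (cmod (poly Q' z))\<^sup>2" for z
  proof -
    have u: "cnj (entry \<Lambda> 1 1) * entry \<Lambda> 1 1 + cnj (entry \<Lambda> 2 1) * entry \<Lambda> 2 1 = 1" "cnj (entry \<Lambda> 1 1) * entry \<Lambda> 1 2 + cnj (entry \<Lambda> 2 1) * entry \<Lambda> 2 2 = 0"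
     "cnj (entry \<Lambda> 1 2) * entry \<Lambda> 1 1 + cnj (entry \<Lambda> 2 2) * entry \<Lambda> 2 1 = 0" "cnj (entry \<Lambda> 1 2) * entry \<Lambda> 1 2 + cnj (entry \<Lambda> 2 2) * entry \<Lambda> 2 2 = 1"
      using L(1) unfolding unitary_matrix_iff by auto
    have "poly P' z * cnj (poly P' z) + poly Q' z * cnj (poly Q' z)
      = (cnj (entry \<Lambda> 1 1) * entry \<Lambda> 1 1 + cnj (entry \<Lambda> 2 1) * entry \<Lambda> 2 1) * (poly P z * cnj (poly P z))
      + (cnj (entry \<Lambda> 1 1) * entry \<Lambda> 1 2 + cnj (entry \<Lambda> 2 1) * entry \<Lambda> 2 2) * (poly Q z * cnj (poly P z))
      + (cnj (entry \<Lambda> 1 2) * entry \<Lambda> 1 1 + cnj (entry \<Lambda> 2 2) * entry \<Lambda> 2 1) * (poly P z * cnj (poly Q z))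
      + (cnj (entry \<Lambda> 1 2) * entry \<Lambda> 1 2 + cnj (entry \<Lambda> 2 2) * entry \<Lambda> 2 2) * (poly Q z * cnj (poly Q z))"
      unfolding L(2,3) by (simp add: algebra_simps)
    also have "\<dots> = poly P z * cnj (poly P z) + poly Q z * cnj (poly Q z)" unfolding u by simp
    finally have "complex_of_real ((cmod (poly P' z))\<^sup>2 + (cmod (poly Q' z))\<^sup>2) = complex_of_real ((cmod (poly P z))\<^sup>2 + (cmod (poly Q z))\<^sup>2)"
      by (simp only: of_real_add complex_norm_square)
    then show ?thesis unfolding of_real_eq_iff by simp
  qed
  then show "psi P Q = psi P' Q'" unfolding psi_eq_iff by blast
qed

section \<open>Equal moduli and coprimality of polynomials\<close>

text \<open>Polarization with the second polynomial of each pair set to 0 gives equal rank one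
  kernels, hence proportionality by a phase.\<close>

lemma poly_eq_unimodular_multiple:
  fixes f h :: "complex poly"
  assumes "\<And>z. cmod (poly f z) = cmod (poly h z)"
  obtains \<theta> where "cmod \<theta> = 1" "f = smult \<theta> h"
proof -
  have "poly h z * cnj (poly h w) = poly f z * cnj (poly f w)" for z w
    using sum_of_squares_polarize[of h 0 f 0 z w] assms by simp
  then obtain \<theta> where \<theta>: "\<theta> * cnj \<theta> = 1" "\<And>z. poly f z = \<theta> * poly h z"
    using proportional_of_rank_one[of "poly h" "poly f"] by metis
  have "f = smult \<theta> h" using \<theta>(2) by (intro poly_ext) simp
  moreover have "cmod \<theta> = 1"
  proof -
    have "complex_of_real ((cmod \<theta>)\<^sup>2) = 1" unfolding complex_norm_square by (rule \<theta>(1))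
    then have "(cmod \<theta>)\<^sup>2 = 1" by (simp only: of_real_eq_1_iff)
    then show ?thesis using norm_ge_zero[of \<theta>] by (auto simp: power2_eq_1_iff)
  qed
  ultimately show ?thesis using that by blast
qed

lemma coprime_iff_no_common_root:
  fixes P Q :: "complex poly"
  shows "coprime P Q \<longleftrightarrow> (\<nexists>z. poly P z = 0 \<and> poly Q z = 0)"
proof
  assume "coprime P Q"
  show "\<nexists>z. poly P z = 0 \<and> poly Q z = 0"
  proof
    assume "\<exists>z. poly P z = 0 \<and> poly Q z = 0"
    then obtain z where "[:-z, 1:] dvd P" "[:-z, 1:] dvd Q" by (auto simp: poly_eq_0_iff_dvd)
    then have "is_unit [:-z, 1:]" using \<open>coprime P Q\<close> by (meson coprime_common_divisor)
    then show False by (simp add: is_unit_iff_degree)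
  qed
next
  assume no: "\<nexists>z. poly P z = 0 \<and> poly Q z = 0"
  show "coprime P Q"
  proof (rule coprimeI)
    fix d assume d: "d dvd P" "d dvd Q"
    have "d \<noteq> 0" using d no by auto
    moreover have "degree d = 0"
    proof (rule ccontr)
      assume "degree d \<noteq> 0"
      then have "\<not> constant (poly d)" by (simp add: constant_degree)
      then obtain z where "poly d z = 0" using fundamental_theorem_of_algebra by blast
      then show False using d no by (auto elim!: dvdE)
    qed
    ultimately show "is_unit d" by (simp add: is_unit_iff_degree)
  qed
qed

section \<open>The total mass\<close>

lemma bounded_of_tendsto_0_at_infinity:
  fixes w :: "'a::euclidean_space \<Rightarrow> real"
  assumes "continuous_on UNIV w" "(w \<longlongrightarrow> 0) at_infinity"
  obtains B where "\<And>z. \<bar>w z\<bar> \<le> B"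
proof -
  obtain r where r: "\<And>z. norm z \<ge> r \<Longrightarrow> \<bar>w z\<bar> < 1"
    using assms(2) unfolding Lim_at_infinity dist_real_def by (metis diff_0_right zero_less_one)
  obtain C where C: "\<And>z. z \<in> cball 0 r \<Longrightarrow> norm (w z) \<le> C"
    using continuous_bounded_on_cball[OF assms(1)] by metis
  have "\<bar>w z\<bar> \<le> max C 1" for z
    using r[of z] C[of z] by (cases "norm z \<ge> r") (auto simp: less_imp_le le_max_iff_disj)
  then show ?thesis by (rule that)
qed

text \<open>Rescaling a cutoff preserves the total mass of its Laplacian exactly in dimension two.\<close>

lemma integral_laplacian_eq_0:
  fixes w :: "complex \<Rightarrow> real"
  assumes w: "smooth w" "(w \<longlongrightarrow> 0) at_infinity" and int: "integrable lborel (laplacian w)"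
  shows "(LINT z|lborel. laplacian w z) = 0"
proof -
  note wc = smooth_continuous[OF w(1)]
  obtain B where B: "\<And>z. \<bar>w z\<bar> \<le> B" using bounded_of_tendsto_0_at_infinity[OF wc w(2)] by blast
  have Bnn: "B \<ge> 0" using B[of 0] by (meson abs_ge_zero order_trans)
  define s where "s n = 1 / real (Suc n)" for n
  have s0: "s n > 0" for n by (simp add: s_def)
  define \<kappa> where "\<kappa> n z = cutoff (0 + s n *\<^sub>R z)" for n and z :: complex
  have \<kappa>s: "smooth (\<kappa> n)" for n unfolding \<kappa>_def[abs_def] by (rule smooth_affine[OF smooth_cutoff])
  have \<kappa>b: "bsupp (\<kappa> n)" for n
    by (rule bsuppI[of "real (Suc n)"]) (use s0[of n] in \<open>simp add: \<kappa>_def s_def cutoff_eq_0 field_simps\<close>)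
  have lcs: "smooth (laplacian (cutoff :: complex \<Rightarrow> real))" by (intro smooth_laplacian smooth_cutoff)
  have lcb: "bsupp (laplacian (cutoff :: complex \<Rightarrow> real))" by (intro bsupp_laplacian bsupp_cutoff)
  have lci: "integrable lborel (laplacian (cutoff :: complex \<Rightarrow> real))"
    by (rule integrable_continuous_bsupp[OF smooth_continuous[OF lcs] lcb])
  have wm: "w \<in> borel_measurable borel" by (rule borel_measurable_continuous_onI[OF wc])
  have eq: "(LINT z|lborel. laplacian w z * \<kappa> n z) = (LINT y|lborel. w (real (Suc n) *\<^sub>R y) * laplacian cutoff y)" for n
  proof -
    have "(LINT z|lborel. laplacian w z * \<kappa> n z) = (LINT z|lborel. w z * laplacian (\<kappa> n) z)"
      using green[OF w(1) \<kappa>s \<kappa>b] by simp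
    also have "\<dots> = (LINT z|lborel. w z * ((s n)\<^sup>2 * laplacian cutoff (s n *\<^sub>R z)))"
      unfolding \<kappa>_def[abs_def] laplacian_affine[OF smooth_cutoff] by simp
    also have "\<dots> = \<bar>real (Suc n)\<bar> ^ DIM(complex) *\<^sub>R (LINT y|lborel. w (0 + real (Suc n) *\<^sub>R y) * ((s n)\<^sup>2 * laplacian cutoff (s n *\<^sub>R (0 + real (Suc n) *\<^sub>R y))))"
      by (rule lborel_integral_affine) simp
    also have "\<dots> = (LINT y|lborel. w (real (Suc n) *\<^sub>R y) * laplacian cutoff y)"
    proof -
      have arg: "s n *\<^sub>R (0 + real (Suc n) *\<^sub>R y) = y" for y :: complex by (simp add: s_def)
      have "(LINT y|lborel. w (0 + real (Suc n) *\<^sub>R y) * ((s n)\<^sup>2 * laplacian cutoff (s n *\<^sub>R (0 + real (Suc n) *\<^sub>R y))))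
          = (s n)\<^sup>2 * (LINT y|lborel. w (real (Suc n) *\<^sub>R y) * laplacian cutoff y)"
        unfolding arg by (subst integral_mult_right_zero[symmetric]) (simp add: mult.left_commute)
      moreover have "\<bar>real (Suc n)\<bar> ^ DIM(complex) * (s n)\<^sup>2 = 1" by (simp add: s_def power_divide)
      ultimately show ?thesis by (simp only: real_scaleR_def mult.assoc[symmetric] mult_1)
    qed
    finally show ?thesis .
  qed
  have "(\<lambda>n. LINT z|lborel. laplacian w z * \<kappa> n z) \<longlonglongrightarrow> (LINT z|lborel. laplacian w z)"
  proof (rule integral_dominated_convergence[where w="\<lambda>z. \<bar>laplacian w z\<bar>"])
    show "laplacian w \<in> borel_measurable lborel" using int by (rule borel_measurable_integrable)
    show "(\<lambda>z. laplacian w z * \<kappa> n z) \<in> borel_measurable lborel" for n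
      using smooth_continuous[OF smooth_mult[OF smooth_laplacian[OF w(1)] \<kappa>s]] by (simp add: borel_measurable_continuous_onI)
    show "integrable lborel (\<lambda>z. \<bar>laplacian w z\<bar>)" using int by (rule integrable_abs)
    show "AE z in lborel. (\<lambda>n. laplacian w z * \<kappa> n z) \<longlonglongrightarrow> laplacian w z"
    proof (rule AE_I2)
      fix z :: complex
      obtain N where N: "2 * norm z \<le> real N" using real_arch_simple by blast
      have "laplacian w z * \<kappa> n z = laplacian w z" if "n \<ge> N" for n
        using N that by (simp add: \<kappa>_def s_def cutoff_eq_1 field_simps)
      then have "eventually (\<lambda>n. laplacian w z * \<kappa> n z = laplacian w z) sequentially"
        unfolding eventually_sequentially by blast
      then show "(\<lambda>n. laplacian w z * \<kappa> n z) \<longlonglongrightarrow> laplacian w z" by (rule tendsto_eventually)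
    qed
    show "AE z in lborel. norm (laplacian w z * \<kappa> n z) \<le> \<bar>laplacian w z\<bar>" for n
      by (auto simp: abs_mult \<kappa>_def abs_of_nonneg[OF cutoff_nonneg] cutoff_le_1 intro!: AE_I2 mult_left_le)
  qed
  moreover have "(\<lambda>n. LINT y|lborel. w (real (Suc n) *\<^sub>R y) * laplacian cutoff y) \<longlonglongrightarrow> (LINT y|(lborel :: complex measure). 0)"
  proof (rule integral_dominated_convergence[where w="\<lambda>y. B * \<bar>laplacian cutoff y\<bar>"])
    show "(\<lambda>y. w (real (Suc n) *\<^sub>R y) * laplacian cutoff y) \<in> borel_measurable lborel" for n
      using borel_measurable_integrable[OF lci] wm by measurable
    show "integrable lborel (\<lambda>y::complex. B * \<bar>laplacian cutoff y\<bar>)" using lci by (intro integrable_mult_right integrable_abs)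
    show "AE y in lborel. norm (w (real (Suc n) *\<^sub>R y) * laplacian cutoff y) \<le> B * \<bar>laplacian cutoff y\<bar>" for n
      using B by (auto simp: abs_mult intro!: AE_I2 mult_right_mono)
    \<comment> \<open>For \<open>y\<close> nonzero the dilated point tends to infinity, where
      \<open>w\<close> tends to 0; the origin stays fixed and is discarded as a null set.\<close>
    show "AE y in lborel. (\<lambda>n. w (real (Suc n) *\<^sub>R y) * laplacian cutoff y) \<longlonglongrightarrow> 0"
      using AE_lborel_singleton[of "0::complex"]
    proof (rule AE_mp, intro AE_I2 impI)
      fix y :: complex assume y: "y \<noteq> 0"
      have "filterlim (\<lambda>n. real (Suc n) * norm y) at_top sequentially"
        using y by real_asymp
      then have "filterlim (\<lambda>n. real (Suc n) *\<^sub>R y) at_infinity sequentially"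
        by (subst filterlim_at_infinity_conv_norm_at_top) simp
      then have "(\<lambda>n. w (real (Suc n) *\<^sub>R y)) \<longlonglongrightarrow> 0" using w(2) by (rule filterlim_compose[rotated])
      then show "(\<lambda>n. w (real (Suc n) *\<^sub>R y) * laplacian cutoff y) \<longlonglongrightarrow> 0" by (rule tendsto_mult_left_zero)
    qed
  qed simp
  ultimately show ?thesis unfolding eq using LIMSEQ_unique by fastforce
qed

lemma tendsto_poly_over_power:
  fixes p :: "complex poly"
  assumes "degree p \<le> d"
  shows "((\<lambda>z. poly p z / z ^ d) \<longlongrightarrow> coeff p d) at_infinity"
proof (cases "degree p = d")
  case True
  then show ?thesis using poly_divide_tendsto_aux[of p] by simp
next
  case False
  then have "degree p < degree (monom (1::complex) d)" using assms by (simp add: degree_monom_eq)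
  from poly_divide_tendsto_0_at_infinity[OF this] have "((\<lambda>z. poly p z / z ^ d) \<longlongrightarrow> 0) at_infinity"
    by (simp add: poly_monom)
  then show ?thesis using False assms by (simp add: coeff_eq_0)
qed

text \<open>The comparison is with (|z|^2 + 1)^d rather than |z|^(2d), because the logarithm of the
  former is smooth on the whole plane and its Laplacian is a multiple of
  \<open>eta 1\<close>.\<close>

lemma tendsto_log_sum_of_squares:
  fixes P Q :: "complex poly"
  defines "d \<equiv> max (degree P) (degree Q)"
  assumes pos: "\<And>z. (cmod (poly P z))\<^sup>2 + (cmod (poly Q z))\<^sup>2 > 0"
  obtains c where "((\<lambda>z. ln ((cmod (poly P z))\<^sup>2 + (cmod (poly Q z))\<^sup>2) - real d * ln ((norm z)\<^sup>2 + 1)) \<longlongrightarrow> c) at_infinity"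
proof -
  define K where "K = (cmod (coeff P d))\<^sup>2 + (cmod (coeff Q d))\<^sup>2"
  have K: "K > 0"
  proof -
    have "coeff P d \<noteq> 0 \<or> coeff Q d \<noteq> 0"
    \<comment> \<open>For \<open>d = 0\<close> both polynomials are constants and \<open>pos\<close>
      excludes that both vanish; for \<open>d > 0\<close> the polynomial of degree \<open>d\<close>
      has a nonzero leading coefficient.\<close>
    proof (cases "d = 0")
      case True
      then have "degree P = 0" "degree Q = 0" by (simp_all add: d_def)
      then obtain a b where ab: "P = [:a:]" "Q = [:b:]" by (metis degree_eq_zeroE)
      then have "a \<noteq> 0 \<or> b \<noteq> 0" using pos[of 0] by auto
      then show ?thesis using ab True by simp
    next
      case False
      then show ?thesis unfolding d_def by (cases "degree P \<le> degree Q") (auto simp: max_def)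
    qed
    then show ?thesis unfolding K_def by (auto simp: add_pos_nonneg add_nonneg_pos)
  qed
  define u where "u z = (cmod (poly P z))\<^sup>2 + (cmod (poly Q z))\<^sup>2" for z
  have upos: "u z > 0" for z using pos by (simp add: u_def)
  have "((\<lambda>z. (cmod (poly P z / z ^ d))\<^sup>2 + (cmod (poly Q z / z ^ d))\<^sup>2) \<longlongrightarrow> K) at_infinity"
    unfolding K_def by (intro tendsto_intros tendsto_poly_over_power) (simp_all add: d_def)
  \<comment> \<open>This factor is (|z|^2 / (|z|^2 + 1))^d and converts the normalization by
    |z|^(2d) into that by (|z|^2 + 1)^d.\<close>
  moreover have "((\<lambda>z::complex. (1 - 1 / ((norm z)\<^sup>2 + 1)) ^ d) \<longlongrightarrow> (1 - 0) ^ d) at_infinity"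
  proof (intro tendsto_intros)
    have "((\<lambda>t::real. 1 / (t\<^sup>2 + 1)) \<longlongrightarrow> 0) at_top" by real_asymp
    then show "((\<lambda>z::complex. 1 / ((norm z)\<^sup>2 + 1)) \<longlongrightarrow> 0) at_infinity"
      by (rule filterlim_compose) (rule filterlim_norm_at_top)
  qed
  ultimately have "((\<lambda>z. ((cmod (poly P z / z ^ d))\<^sup>2 + (cmod (poly Q z / z ^ d))\<^sup>2) * (1 - 1 / ((norm z)\<^sup>2 + 1)) ^ d) \<longlongrightarrow> K * (1 - 0) ^ d) at_infinity"
    by (rule tendsto_mult)
  then have lim: "((\<lambda>z. ((cmod (poly P z / z ^ d))\<^sup>2 + (cmod (poly Q z / z ^ d))\<^sup>2) * (1 - 1 / ((norm z)\<^sup>2 + 1)) ^ d) \<longlongrightarrow> K) at_infinity"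
    by simp
  have rw: "((cmod (poly P z / z ^ d))\<^sup>2 + (cmod (poly Q z / z ^ d))\<^sup>2) * (1 - 1 / ((norm z)\<^sup>2 + 1)) ^ d = u z / ((norm z)\<^sup>2 + 1) ^ d"
    if "norm z \<ge> 1" for z
  proof -
    have n: "norm z \<noteq> 0" "(norm z)\<^sup>2 + 1 \<noteq> 0" using that by (auto simp: add_nonneg_eq_0_iff)
    have "1 - 1 / ((norm z)\<^sup>2 + 1) = (norm z)\<^sup>2 / ((norm z)\<^sup>2 + 1)" using n(2) by (simp add: field_simps)
    moreover have "(cmod (poly P z / z ^ d))\<^sup>2 + (cmod (poly Q z / z ^ d))\<^sup>2 = u z / ((norm z)\<^sup>2) ^ d"
      by (simp add: u_def norm_divide norm_power power_divide add_divide_distrib flip: power_mult) (simp add: mult.commute)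
    ultimately show ?thesis using n by (simp add: power_divide)
  qed
  have "((\<lambda>z. u z / ((norm z)\<^sup>2 + 1) ^ d) \<longlongrightarrow> K) at_infinity"
    by (rule Lim_transform_eventually[OF lim]) (use rw in \<open>auto simp: eventually_at_infinity\<close>)
  then have "((\<lambda>z. ln (u z / ((norm z)\<^sup>2 + 1) ^ d)) \<longlongrightarrow> ln K) at_infinity"
    using K by (intro tendsto_ln) simp_all
  moreover have "ln (u z / ((norm z)\<^sup>2 + 1) ^ d) = ln (u z) - real d * ln ((norm z)\<^sup>2 + 1)" for z :: complex
    using upos[of z] norm_sq_add_pos[of 1 z] by (simp add: ln_div ln_realpow)
  ultimately show ?thesis using that unfolding u_def by simp
qed

lemma laplacian_add:
  assumes "smooth u" "smooth v"
  shows "laplacian (\<lambda>x. u x + v x) z = laplacian u z + laplacian v z"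
proof -
  have 1: "pd b (\<lambda>x. u x + v x) = (\<lambda>x. pd b u x + pd b v x)" for b
    using pd_add[OF smoothD[OF assms(1)] smoothD[OF assms(2)]] by blast
  have "pd b (\<lambda>x. pd b u x + pd b v x) z = pd b (pd b u) z + pd b (pd b v) z" if "b \<in> Basis" for b
    by (rule pd_add[OF smoothD[OF smooth_pd[OF assms(1) that]] smoothD[OF smooth_pd[OF assms(2) that]]])
  then show ?thesis unfolding laplacian_pd 1 by (simp add: sum.distrib)
qed

lemma laplacian_const: "laplacian (\<lambda>x. c) z = 0"
  by (simp add: laplacian_pd pd_locally_const[of UNIV _ _ c] pd_locally_const[of UNIV _ _ 0])

lemma laplacian_cmult:
  assumes "smooth u"
  shows "laplacian (\<lambda>x. c * u x) z = c * laplacian u z"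
proof -
  have 1: "pd b (\<lambda>x. c * w x) z = c * pd b w z" if "smooth w" for b z and w :: "'a \<Rightarrow> real"
    by (rule pd_bounded_linear[OF bounded_linear_mult_right smoothD[OF that]])
  have "pd b (\<lambda>x. c * w x) = (\<lambda>z. c * pd b w z)" if "smooth w" for b and w :: "'a \<Rightarrow> real"
    using 1[OF that] by blast
  then show ?thesis unfolding laplacian_pd using assms by (simp add: smooth_pd sum_distrib_left)
qed

text \<open>Adding 2 d ln(|z|^2 + 1), which is 8 pi d times \<open>elog 1\<close>, and a constant to
  \<open>v\<close> gives a function that tends to 0 at infinity, so its Laplacian has integral 0.
  That Laplacian is -g plus 8 pi d times \<open>eta 1\<close>, and \<open>eta 1\<close> has integral
  1.\<close>

lemma total_mass_eq_degree:
  fixes P Q :: "complex poly" and v g :: "complex \<Rightarrow> real"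
  assumes pos: "\<And>z. (cmod (poly P z))\<^sup>2 + (cmod (poly Q z))\<^sup>2 > 0"
    and v: "smooth v" "\<And>z. v z = ln 8 - 2 * ln ((cmod (poly P z))\<^sup>2 + (cmod (poly Q z))\<^sup>2)"
    and eq: "\<And>z. laplacian v z = - g z" and g: "integrable lborel g"
  shows "(LINT z|lborel. g z) = 8 * pi * real (max (degree P) (degree Q))"
proof -
  let ?d = "real (max (degree P) (degree Q))"
  obtain c where c: "((\<lambda>z. ln ((cmod (poly P z))\<^sup>2 + (cmod (poly Q z))\<^sup>2) - ?d * ln ((norm z)\<^sup>2 + 1)) \<longlongrightarrow> c) at_infinity"
    using tendsto_log_sum_of_squares[OF pos] by blast
  define w where "w z = v z + (8 * pi * ?d) * elog 1 z + (2 * c - ln 8)" for z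
  have w_eq: "w z = 2 * c - 2 * (ln ((cmod (poly P z))\<^sup>2 + (cmod (poly Q z))\<^sup>2) - ?d * ln ((norm z)\<^sup>2 + 1))" for z
    by (simp add: w_def v(2) elog_def)
  have "((\<lambda>z. 2 * c - 2 * (ln ((cmod (poly P z))\<^sup>2 + (cmod (poly Q z))\<^sup>2) - ?d * ln ((norm z)\<^sup>2 + 1))) \<longlongrightarrow> 2 * c - 2 * c) at_infinity"
    by (intro tendsto_intros c)
  then have lim: "(w \<longlongrightarrow> 0) at_infinity" unfolding w_eq[abs_def] by simp
  have sm: "smooth w" unfolding w_def[abs_def] by (intro smooth_intros v(1) smooth_elog) simp
  have lap: "laplacian w z = - g z + (8 * pi * ?d) * eta 1 z" for z
  proof -
    have "laplacian w z = laplacian v z + (8 * pi * ?d) * laplacian (elog 1) z"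
      using v(1) smooth_elog[of 1] unfolding w_def[abs_def]
      by (simp add: laplacian_add laplacian_cmult laplacian_const smooth_intros)
    then show ?thesis by (simp add: eq laplacian_elog)
  qed
  have i: "integrable lborel (\<lambda>z. - g z + (8 * pi * ?d) * eta 1 z)"
    using g eta_integral(1)[of 1] by simp
  have "0 = (LINT z|lborel. - g z + (8 * pi * ?d) * eta 1 z)"
    using integral_laplacian_eq_0[OF sm lim] i unfolding lap[abs_def] by simp
  also have "\<dots> = - (LINT z|lborel. g z) + 8 * pi * ?d"
    using g eta_integral[of 1] by simp
  finally show ?thesis by simp
qed

section \<open>Weak solutions of the Liouville equation\<close>

text \<open>Weak solutions are measurable only for the completed measure, whereas convolutions and
  Fubini are carried out with Borel functions; this is the passage between the two.\<close>

lemma lebesgue_lborel_AE_eq: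
  fixes F G :: "'a::euclidean_space \<Rightarrow> real"
  assumes F: "F \<in> borel_measurable lebesgue" and G: "G \<in> borel_measurable borel" and ae: "AE x in lborel. F x = G x"
  shows "(LINT x|lebesgue. F x) = (LINT x|lborel. G x)" "integrable lebesgue F \<longleftrightarrow> integrable lborel G"
proof -
  have G': "G \<in> borel_measurable lborel" using G by simp
  then have Gl: "G \<in> borel_measurable lebesgue" by (rule measurable_completion)
  have ae': "AE x in lebesgue. F x = G x" using ae by (rule AE_completion)
  show "(LINT x|lebesgue. F x) = (LINT x|lborel. G x)"
    using integral_cong_AE[OF F Gl ae'] integral_completion[OF G'] by simp
  show "integrable lebesgue F \<longleftrightarrow> integrable lborel G"
    using integrable_cong_AE[OF F Gl ae'] integrable_completion[OF G'] by simp
qed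

lemma locally_integrable_measurable:
  fixes \<psi> :: "'a::euclidean_space \<Rightarrow> real"
  assumes "locally_integrable \<psi>" shows "\<psi> \<in> borel_measurable lebesgue"
proof (rule borel_measurable_LIMSEQ_real)
  show "(\<lambda>w. indicator (cball 0 (real n)) w * \<psi> w) \<in> borel_measurable lebesgue" for n
    using assms unfolding locally_integrable_def set_integrable_def real_scaleR_def
    by (intro borel_measurable_integrable) auto
  fix w :: 'a
  obtain N where N: "norm w \<le> real N" using real_arch_simple by blast
  have "indicator (cball 0 (real n)) w * \<psi> w = \<psi> w" if "n \<ge> N" for n
    using N that by (simp add: indicator_def)
  then have "eventually (\<lambda>n. indicator (cball 0 (real n)) w * \<psi> w = \<psi> w) sequentially"
    unfolding eventually_sequentially by blast
  then show "(\<lambda>n. indicator (cball 0 (real n)) w * \<psi> w) \<longlonglongrightarrow> \<psi> w" by (rule tendsto_eventually)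
qed

lemma smooth_poly: "smooth (poly p)" for p :: "complex poly"
proof -
  have "smooth (\<lambda>z. \<Sum>i\<le>degree p. coeff p i * z ^ i)" by (intro smooth_intros)
  then show ?thesis by (simp add: poly_altdef[abs_def])
qed

lemma smooth_cmod_sq: "smooth F \<Longrightarrow> smooth (\<lambda>z. (cmod (F z))\<^sup>2)"
  unfolding power2_norm_eq_inner by (rule smooth_inner)

text \<open>The solution is first replaced by a Borel representative \<open>\<psi>\<^sub>0\<close>,
  which inherits local integrability, the finite mass and the tested equation because all of these
  are integrals; the regularity theory then applies to it.\<close>

lemma liouville_smooth_solution:
  assumes "liouville_weak_solution f \<psi>"
  obtains v where "smooth v" "AE z in lebesgue. \<psi> z = v z"
    "\<And>z. laplacian v z = - ((cmod (poly f z))\<^sup>2 * exp (v z))" "integrable lborel (\<lambda>z. (cmod (poly f z))\<^sup>2 * exp (v z))"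
    "(LINT z|lebesgue. (cmod (poly f z))\<^sup>2 * exp (\<psi> z)) = (LINT z|lborel. (cmod (poly f z))\<^sup>2 * exp (v z))"
proof -
  define h where "h z = (cmod (poly f z))\<^sup>2" for z
  have li: "locally_integrable \<psi>" and gi: "integrable lebesgue (\<lambda>z. h z * exp (\<psi> z))"
    and pois: "distributional_poisson \<psi> (\<lambda>z. h z * exp (\<psi> z))"
    using assms unfolding liouville_weak_solution_def liouville_density_def h_def by auto
  have hs: "smooth h" unfolding h_def[abs_def] by (intro smooth_cmod_sq smooth_poly)
  have hm: "h \<in> borel_measurable borel" using smooth_continuous[OF hs] by (rule borel_measurable_continuous_onI)
  have hml: "h \<in> borel_measurable lebesgue" using hm by (intro measurable_completion) simp
  have \<psi>m: "\<psi> \<in> borel_measurable lebesgue" using li by (rule locally_integrable_measurable)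
  then obtain \<psi>\<^sub>0 where p0: "\<psi>\<^sub>0 \<in> borel_measurable lborel" and ae: "AE z in lborel. \<psi> z = \<psi>\<^sub>0 z"
    using completion_ex_borel_measurable_real by blast
  have p0b [measurable]: "\<psi>\<^sub>0 \<in> borel_measurable borel" using p0 by simp
  note [measurable] = hm hml \<psi>m
  have loc: "loc_int \<psi>\<^sub>0" unfolding loc_int_def
  proof
    fix R
    have i: "integrable lebesgue (\<lambda>w. indicator (cball 0 R) w * \<psi> w)"
      using li unfolding locally_integrable_def set_integrable_def real_scaleR_def by auto
    have "AE w in lborel. indicator (cball 0 R) w * \<psi> w = indicator (cball 0 R) w * \<psi>\<^sub>0 w"
      using ae by eventually_elim simp
    moreover have "(\<lambda>w. indicator (cball 0 R) w * \<psi>\<^sub>0 w) \<in> borel_measurable borel"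
      by (intro borel_measurable_times borel_measurable_indicator p0b) simp
    ultimately show "integrable lborel (\<lambda>w. indicator (cball 0 R) w * \<psi>\<^sub>0 w)"
      using lebesgue_lborel_AE_eq(2)[OF borel_measurable_integrable[OF i]] i by blast
  qed
  have gm: "(\<lambda>z. h z * exp (\<psi> z)) \<in> borel_measurable lebesgue" by measurable
  have g0m: "(\<lambda>z. h z * exp (\<psi>\<^sub>0 z)) \<in> borel_measurable borel" by measurable
  have gae: "AE z in lborel. h z * exp (\<psi> z) = h z * exp (\<psi>\<^sub>0 z)" using ae by eventually_elim simp
  have gi0: "integrable lborel (\<lambda>z. h z * exp (\<psi>\<^sub>0 z))"
    and gint: "(LINT z|lebesgue. h z * exp (\<psi> z)) = (LINT z|lborel. h z * exp (\<psi>\<^sub>0 z))"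
    using lebesgue_lborel_AE_eq[OF gm g0m gae] gi by blast+
  have eq: "- (LINT x|lborel. \<psi>\<^sub>0 x * laplacian \<phi> x) = (LINT x|lborel. (h x * exp (\<psi>\<^sub>0 x)) * \<phi> x)"
    if \<phi>: "smooth \<phi>" "bsupp \<phi>" for \<phi>
  proof -
    obtain R where "\<And>x. norm x > R \<Longrightarrow> \<phi> x = 0" using bsuppE[OF \<phi>(2)] by blast
    then have "test_function \<phi>" using test_functionI[OF \<phi>(1)] by blast
    then have w: "- (LINT x|lebesgue. \<psi> x * laplacian \<phi> x) = (LINT x|lebesgue. (h x * exp (\<psi> x)) * \<phi> x)"
      using pois unfolding distributional_poisson_def by blast
    have \<phi>m: "\<phi> \<in> borel_measurable borel" "laplacian \<phi> \<in> borel_measurable borel"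
      using \<phi>(1) by (auto intro!: borel_measurable_continuous_onI smooth_continuous smooth_laplacian)
    then have \<phi>l: "\<phi> \<in> borel_measurable lebesgue" "laplacian \<phi> \<in> borel_measurable lebesgue"
      by (auto intro!: measurable_completion)
    have "(LINT x|lebesgue. \<psi> x * laplacian \<phi> x) = (LINT x|lborel. \<psi>\<^sub>0 x * laplacian \<phi> x)"
      by (rule lebesgue_lborel_AE_eq(1)) (use \<phi>m \<phi>l ae in \<open>auto intro!: borel_measurable_times \<psi>m p0b\<close>)
    moreover have "(LINT x|lebesgue. (h x * exp (\<psi> x)) * \<phi> x) = (LINT x|lborel. (h x * exp (\<psi>\<^sub>0 x)) * \<phi> x)"
      by (rule lebesgue_lborel_AE_eq(1)) (use \<phi>m \<phi>l gae in \<open>auto intro!: borel_measurable_times gm g0m\<close>)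
    ultimately show ?thesis using w by simp
  qed
  obtain v where v: "smooth v" and vae: "AE z in lborel. \<psi>\<^sub>0 z = v z"
    using weak_solution_smooth[OF loc hs _ gi0 eq] by (auto simp: h_def)
  have lap: "laplacian v z = - (h z * exp (v z))" for z
    by (rule classical_solution[OF v hs p0b vae eq])
  have aev: "AE z in lborel. h z * exp (\<psi>\<^sub>0 z) = h z * exp (v z)" using vae by eventually_elim simp
  have vm [measurable]: "v \<in> borel_measurable borel" using smooth_continuous[OF v] by (rule borel_measurable_continuous_onI)
  have "integrable lborel (\<lambda>z. h z * exp (v z))"
    by (subst integrable_cong_AE[OF _ _ aev, symmetric]) (use gi0 in measurable)
  moreover have "(LINT z|lborel. h z * exp (\<psi>\<^sub>0 z)) = (LINT z|lborel. h z * exp (v z))"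
    by (rule integral_cong_AE[OF _ _ aev]) measurable
  moreover have "AE z in lebesgue. \<psi> z = v z"
  proof (rule AE_completion)
    show "AE z in lborel. \<psi> z = v z" using ae vae by eventually_elim simp
  qed
  ultimately show ?thesis using that[OF v] lap gint unfolding h_def by simp
qed

text \<open>Converts the finite mass of |f|^2 exp v into control of exp v far out, the form in which
  \<open>superharmonic_log_lower_bound\<close> uses it.\<close>

lemma polynomial_lower_bound_at_infinity:
  fixes f :: "complex poly"
  assumes "f \<noteq> 0"
  obtains c \<rho> where "c > 0" "\<And>z. norm z \<ge> \<rho> \<Longrightarrow> c \<le> cmod (poly f z)"
proof (cases "degree f = 0")
  case True
  then obtain a where "f = [:a:]" by (metis degree_eq_zeroE)
  then show ?thesis using assms that[of "cmod a"] by simp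
next
  case False
  then obtain a p where "f = pCons a p" "p \<noteq> 0" by (metis degree_pCons_0 pCons_cases)
  then show ?thesis using poly_infinity[of p 1 a] that[of 1] by auto
qed

section \<open>The equation in terms of sums of squares\<close>

text \<open>Lagrange's identity for the vectors (P, Q) and (P', Q'), with primes for derivatives:
  the product of their squared lengths minus the squared modulus of their inner product is the
  squared modulus of their determinant.\<close>

lemma wronskian_of_sum_of_squares:
  fixes P Q :: "complex poly" and U :: "complex \<Rightarrow> complex"
  assumes U: "\<And>z. U z = poly P z * cnj (poly P z) + poly Q z * cnj (poly Q z)"
  defines "W z \<equiv> poly (pderiv P * Q - P * pderiv Q) z"
  shows "U z * dz (dzb U) z - dz U z * dzb U z = W z * cnj (W z)"
proof -
  have p: "wirt (poly p) (poly (pderiv p) z) 0 z" for p :: "complex poly" and z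
    by (rule wirt_holo[OF poly_DERIV])
  have 1: "wirt U (poly (pderiv P) z * cnj (poly P z) + poly (pderiv Q) z * cnj (poly Q z))
      (poly P z * cnj (poly (pderiv P) z) + poly Q z * cnj (poly (pderiv Q) z)) z" for z
    using wirt_add[OF wirt_mult[OF p[of P] wirt_cnj[OF p[of P]]] wirt_mult[OF p[of Q] wirt_cnj[OF p[of Q]]], of z]
    unfolding U[abs_def] by simp
  have U1: "dz U z = poly (pderiv P) z * cnj (poly P z) + poly (pderiv Q) z * cnj (poly Q z)" for z using wirt_dz[OF 1] .
  have U2: "dzb U = (\<lambda>z. poly P z * cnj (poly (pderiv P) z) + poly Q z * cnj (poly (pderiv Q) z))" using wirt_dzb[OF 1] by blast
  have U3: "dz (dzb U) z = poly (pderiv P) z * cnj (poly (pderiv P) z) + poly (pderiv Q) z * cnj (poly (pderiv Q) z)"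
    using wirt_dz[OF wirt_add[OF wirt_mult[OF p[of P] wirt_cnj[OF p[of "pderiv P"]]] wirt_mult[OF p[of Q] wirt_cnj[OF p[of "pderiv Q"]]], of z]]
    unfolding U2 by simp
  have U4: "dzb U z = poly P z * cnj (poly (pderiv P) z) + poly Q z * cnj (poly (pderiv Q) z)" using wirt_dzb[OF 1] .
  show ?thesis unfolding U1 U3 U4 unfolding U W_def by (simp add: algebra_simps)
qed

text \<open>The function u^2 times the Laplacian of ln u equals u times the Laplacian of u minus the
  squared gradient. Since ln u is a constant minus v/2 and u^2 exp v = 8, this is 4 h; the factor 4
  disappears in passing to Wirtinger derivatives.\<close>

lemma liouville_star:
  fixes v u h :: "complex \<Rightarrow> real"
  assumes v: "smooth v" and lap: "\<And>z. laplacian v z = - (h z * exp (v z))"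
  defines "u z \<equiv> sqrt 8 * exp (- 1 / 2 * v z)" and "U z \<equiv> of_real (u z) :: complex"
  shows "smooth U" "U z * dz (dzb U) z - dz U z * dzb U z = of_real (h z)"
proof -
  have us: "smooth u" unfolding u_def[abs_def]
    by (intro smooth_mult smooth_const smooth_compose_real[OF smooth_real_exp[of UNIV "- 1 / 2"] _ v]) simp
  have "smooth (\<lambda>z. of_real (u z) :: complex)" by (rule smooth_bounded_linear[OF bounded_linear_of_real us])
  then show "smooth U" by (simp add: U_def[abs_def])
  have pdu: "pd b u = (\<lambda>z. (- 1 / 2) * (u z * pd b v z))" for b
  proof
    fix z
    have "pd b (\<lambda>z. sqrt 8 * exp (- 1 / 2 * v z)) z = (sqrt 8 * (- 1 / 2 * exp (- 1 / 2 * v z))) * pd b v z"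
      by (rule pd_compose_real[where h="\<lambda>t. sqrt 8 * exp (- 1 / 2 * t)", OF _ smoothD[OF v]]) (auto intro!: derivative_eq_intros)
    then show "pd b u z = (- 1 / 2) * (u z * pd b v z)" by (simp add: u_def[abs_def])
  qed
  have pdd: "u z * pd b (pd b u) z - (pd b u z)\<^sup>2 = - 1 / 2 * (u z)\<^sup>2 * pd b (pd b v) z" if b: "b \<in> Basis" for b
  proof -
    have s: "smooth (pd b v)" using v b by (rule smooth_pd)
    have "pd b (pd b u) z = (- 1 / 2) * pd b (\<lambda>z. u z * pd b v z) z"
      unfolding pdu by (rule pd_bounded_linear[OF bounded_linear_mult_right smoothD[OF smooth_mult[OF us s]]])
    also have "pd b (\<lambda>z. u z * pd b v z) z = u z * pd b (pd b v) z + pd b u z * pd b v z"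
      by (rule pd_mult[OF smoothD[OF us] smoothD[OF s]])
    finally have A: "pd b (pd b u) z = - 1 / 2 * (u z * pd b (pd b v) z + pd b u z * pd b v z)" .
    have B: "pd b u z = - 1 / 2 * (u z * pd b v z)" by (simp only: pdu)
    show ?thesis unfolding A B by (simp add: algebra_simps power2_eq_square)
  qed
  have u2: "(u z)\<^sup>2 = 8 * exp (- v z)"
    by (simp add: u_def power_mult_distrib flip: exp_of_nat_mult)
  have sum: "u z * laplacian u z - (\<Sum>b\<in>Basis. (pd b u z)\<^sup>2) = 4 * h z"
  proof -
    have "u z * laplacian u z - (\<Sum>b\<in>Basis. (pd b u z)\<^sup>2) = (\<Sum>b\<in>Basis. u z * pd b (pd b u) z - (pd b u z)\<^sup>2)"
      by (simp add: laplacian_pd sum_distrib_left sum_subtractf)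
    also have "\<dots> = (\<Sum>b\<in>Basis. - 1 / 2 * (u z)\<^sup>2 * pd b (pd b v) z)" by (rule sum.cong) (simp_all only: pdd)
    also have "\<dots> = - 1 / 2 * (u z)\<^sup>2 * laplacian v z" by (simp only: laplacian_pd sum_distrib_left)
    also have "\<dots> = 4 * h z * (exp (- v z) * exp (v z))" unfolding u2 lap by simp
    also have "\<dots> = 4 * h z" by (simp flip: exp_add)
    finally show ?thesis .
  qed
  have pdU: "pd b U z = of_real (pd b u z)" for b
    unfolding U_def[abs_def] by (rule pd_bounded_linear[OF bounded_linear_of_real smoothD[OF us, of "Suc 0"]])
  have 1: "dz U z * dzb U z = of_real (\<Sum>b\<in>Basis. (pd b u z)\<^sup>2) / 4"
    unfolding dz_def dzb_def pdU by (simp add: Basis_complex_def algebra_simps power2_eq_square)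
  have 2: "U z * dz (dzb U) z = of_real (u z * laplacian u z) / 4"
    using dz_dzb_of_real[OF us, of z] unfolding U_def[abs_def] by simp
  have "U z * dz (dzb U) z - dz U z * dzb U z = of_real (u z * laplacian u z - (\<Sum>b\<in>Basis. (pd b u z)\<^sup>2)) / 4"
    unfolding 1 2 by (simp only: of_real_diff diff_divide_distrib)
  then show "U z * dz (dzb U) z - dz U z * dzb U z = of_real (h z)" unfolding sum by simp
qed

lemma liouville_representation:
  fixes v :: "complex \<Rightarrow> real"
  assumes f: "f \<noteq> 0" and v: "smooth v" and lap: "\<And>z. laplacian v z = - ((cmod (poly f z))\<^sup>2 * exp (v z))"
    and int: "integrable lborel (\<lambda>z. (cmod (poly f z))\<^sup>2 * exp (v z))"
  obtains P Q where "f = pderiv P * Q - P * pderiv Q" "\<And>z. (cmod (poly P z))\<^sup>2 + (cmod (poly Q z))\<^sup>2 > 0"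
    "\<And>z. v z = ln 8 - 2 * ln ((cmod (poly P z))\<^sup>2 + (cmod (poly Q z))\<^sup>2)"
proof -
  define u where "u z = sqrt 8 * exp (- 1 / 2 * v z)" for z
  define U where "U z = complex_of_real (u z)" for z
  have upos: "u z > 0" for z by (simp add: u_def)
  have smU: "smooth U"
    unfolding U_def[abs_def] u_def[abs_def] by (rule liouville_star(1)[OF v lap])
  have starU: "U z * dz (dzb U) z - dz U z * dzb U z = poly f z * cnj (poly f z)" for z
    using liouville_star(2)[OF v lap, of z] unfolding U_def[abs_def] u_def[abs_def] complex_norm_square .
  obtain c \<rho> where c: "c > 0" "\<And>z. norm z \<ge> \<rho> \<Longrightarrow> c \<le> cmod (poly f z)"
    using polynomial_lower_bound_at_infinity[OF f] by blast
  have lower: "c\<^sup>2 * exp (v z) \<le> (cmod (poly f z))\<^sup>2 * exp (v z)" if "norm z \<ge> \<rho>" for z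
    using c(1) c(2)[OF that] by (intro mult_right_mono power_mono) auto
  have gc: "continuous_on UNIV (\<lambda>z. (cmod (poly f z))\<^sup>2 * exp (v z))"
    by (intro continuous_intros smooth_continuous[OF v])
  obtain K M where M: "M \<ge> 0" and low: "\<And>R z. R \<ge> 1 \<Longrightarrow> norm z \<le> R \<Longrightarrow> - v z \<le> K + M * ln R"
    using superharmonic_log_lower_bound[OF v lap _ int gc _ lower] c(1) by (metis zero_le_mult_iff zero_le_power2 exp_ge_zero zero_less_power)
  \<comment> \<open>The exponent is halved because u contains -v/2, and rounded up because
    \<open>sum_of_squares\<close> takes a natural exponent; \<open>R >= 1\<close> makes the rounding
    harmless.\<close>
  have growth: "u z \<le> (sqrt 8 * exp (K / 2)) * R ^ nat \<lceil>M / 2\<rceil>" if R: "R \<ge> 1" "norm z \<le> R" for R z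
  proof -
    have "M / 2 \<le> real (nat \<lceil>M / 2\<rceil>)" by linarith
    then have "M / 2 * ln R \<le> real (nat \<lceil>M / 2\<rceil>) * ln R" using R(1) by (intro mult_right_mono) auto
    moreover have "real (nat \<lceil>M / 2\<rceil>) * ln R = ln (R ^ nat \<lceil>M / 2\<rceil>)" using R(1) by (simp add: ln_realpow)
    ultimately have "- 1 / 2 * v z \<le> K / 2 + ln (R ^ nat \<lceil>M / 2\<rceil>)" using low[OF R] by simp
    then have "exp (- 1 / 2 * v z) \<le> exp (K / 2) * exp (ln (R ^ nat \<lceil>M / 2\<rceil>))" by (simp only: exp_le_cancel_iff flip: exp_add)
    then show ?thesis using R(1) by (simp add: u_def)
  qed
  obtain P Q where PQ: "\<And>z. u z = (cmod (poly P z))\<^sup>2 + (cmod (poly Q z))\<^sup>2"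
    using sum_of_squares[OF smU U_def upos f starU growth] by blast
  have "U z = poly P z * cnj (poly P z) + poly Q z * cnj (poly Q z)" for z
    unfolding U_def PQ by (simp only: of_real_add complex_norm_square)
  from wronskian_of_sum_of_squares[of U, OF this]
  have "poly f z * cnj (poly f z) = poly (pderiv P * Q - P * pderiv Q) z * cnj (poly (pderiv P * Q - P * pderiv Q) z)" for z
    unfolding starU .
  then have "complex_of_real ((cmod (poly f z))\<^sup>2) = complex_of_real ((cmod (poly (pderiv P * Q - P * pderiv Q) z))\<^sup>2)" for z
    by (simp only: complex_norm_square)
  then have "(cmod (poly f z))\<^sup>2 = (cmod (poly (pderiv P * Q - P * pderiv Q) z))\<^sup>2" for z unfolding of_real_eq_iff .
  then have "cmod (poly f z) = cmod (poly (pderiv P * Q - P * pderiv Q) z)" for z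
    by (rule power2_eq_imp_eq) simp_all
  then obtain \<theta> where \<theta>: "cmod \<theta> = 1" "f = smult \<theta> (pderiv P * Q - P * pderiv Q)"
    by (rule poly_eq_unimodular_multiple)
  \<comment> \<open>The phase between \<open>f\<close> and the Wronskian is absorbed into
    \<open>P\<close>, which changes neither the modulus of \<open>P\<close> nor the sum of
    squares.\<close>
  let ?P = "smult \<theta> P"
  have sq: "(cmod (poly ?P z))\<^sup>2 + (cmod (poly Q z))\<^sup>2 = u z" for z by (simp add: PQ norm_mult \<theta>(1))
  show ?thesis
  proof (rule that[of ?P Q])
    show "f = pderiv ?P * Q - ?P * pderiv Q" unfolding \<theta>(2) by (simp add: pderiv_smult smult_diff_right)
    show "(cmod (poly ?P z))\<^sup>2 + (cmod (poly Q z))\<^sup>2 > 0" for z unfolding sq by (rule upos)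
    show "v z = ln 8 - 2 * ln ((cmod (poly ?P z))\<^sup>2 + (cmod (poly Q z))\<^sup>2)" for z
      unfolding sq u_def by (simp add: ln_mult ln_sqrt)
  qed
qed

lemma coprime_iff_sum_of_squares_pos:
  fixes P Q :: "complex poly"
  shows "coprime P Q \<longleftrightarrow> (\<forall>z. (cmod (poly P z))\<^sup>2 + (cmod (poly Q z))\<^sup>2 > 0)"
  unfolding coprime_iff_no_common_root by (simp add: sum_power2_gt_zero_iff)

lemma psi_eq_of_pos:
  assumes "(cmod (poly P z))\<^sup>2 + (cmod (poly Q z))\<^sup>2 > 0"
  shows "psi P Q z = ereal (ln 8 - 2 * ln ((cmod (poly P z))\<^sup>2 + (cmod (poly Q z))\<^sup>2))"
  using assms unfolding psi_def Let_def by (simp only: less_irrefl if_False split: if_splits) auto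

lemma liouville_weak_solution_form:
  assumes "f \<noteq> 0" "liouville_weak_solution f \<psi>"
  obtains P Q where "coprime P Q" "f = pderiv P * Q - P * pderiv Q" "AE z in lebesgue. ereal (\<psi> z) = psi P Q z"
proof -
  obtain v where v: "smooth v" "AE z in lebesgue. \<psi> z = v z"
    "\<And>z. laplacian v z = - ((cmod (poly f z))\<^sup>2 * exp (v z))" "integrable lborel (\<lambda>z. (cmod (poly f z))\<^sup>2 * exp (v z))"
    using liouville_smooth_solution[OF assms(2)] by blast
  obtain P Q where PQ: "f = pderiv P * Q - P * pderiv Q" "\<And>z. (cmod (poly P z))\<^sup>2 + (cmod (poly Q z))\<^sup>2 > 0"
    "\<And>z. v z = ln 8 - 2 * ln ((cmod (poly P z))\<^sup>2 + (cmod (poly Q z))\<^sup>2)"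
    using liouville_representation[OF assms(1) v(1,3,4)] by blast
  have "AE z in lebesgue. ereal (\<psi> z) = psi P Q z"
    using v(2) by eventually_elim (simp only: psi_eq_of_pos[OF PQ(2)] PQ(3))
  then show ?thesis using that[OF _ PQ(1)] PQ(2) unfolding coprime_iff_sum_of_squares_pos by blast
qed

text \<open>The pair is an arbitrary one that represents \<psi> almost everywhere. The smooth
  representative \<open>v\<close> and the formula in \<open>P\<close> and \<open>Q\<close> are both
  continuous, the latter by coprimality, so they agree everywhere, and the mass follows from the
  behaviour at infinity.\<close>

lemma liouville_total_mass:
  assumes sol: "liouville_weak_solution f \<psi>" and cop: "coprime P Q" and ae: "AE z in lebesgue. ereal (\<psi> z) = psi P Q z"
  shows "(LINT z|lebesgue. (cmod (poly f z))\<^sup>2 * exp (\<psi> z)) = 8 * pi * real (max (degree P) (degree Q))"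
proof -
  obtain v where v: "smooth v" "AE z in lebesgue. \<psi> z = v z"
    "\<And>z. laplacian v z = - ((cmod (poly f z))\<^sup>2 * exp (v z))" "integrable lborel (\<lambda>z. (cmod (poly f z))\<^sup>2 * exp (v z))"
    "(LINT z|lebesgue. (cmod (poly f z))\<^sup>2 * exp (\<psi> z)) = (LINT z|lborel. (cmod (poly f z))\<^sup>2 * exp (v z))"
    using liouville_smooth_solution[OF sol] by blast
  have pos: "(cmod (poly P z))\<^sup>2 + (cmod (poly Q z))\<^sup>2 > 0" for z using cop unfolding coprime_iff_sum_of_squares_pos by blast
  define d where "d z = v z - (ln 8 - 2 * ln ((cmod (poly P z))\<^sup>2 + (cmod (poly Q z))\<^sup>2))" for z
  have "(cmod (poly P z))\<^sup>2 + (cmod (poly Q z))\<^sup>2 \<noteq> 0" for z using pos[of z] by (metis less_irrefl)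
  then have dc: "continuous_on UNIV d" unfolding d_def[abs_def]
    by (intro continuous_intros smooth_continuous[OF v(1)]) blast
  have "AE z in lebesgue. d z = 0"
    using v(2) ae by eventually_elim (simp add: psi_eq_of_pos[OF pos] d_def)
  then have "AE z in lborel. d z = 0" by (simp add: AE_completion_iff)
  then have "d z = 0" for z using AE_0_continuous_imp_0[OF dc] by blast
  then have "v z = ln 8 - 2 * ln ((cmod (poly P z))\<^sup>2 + (cmod (poly Q z))\<^sup>2)" for z by (simp add: d_def)
  from total_mass_eq_degree[OF pos v(1) this v(3,4)] show ?thesis unfolding v(5) .
qed

text \<open>A locally integrable \<psi> is determined only up to a null set, so the representation
  is an equality almost everywhere. The mass formula is asserted for every coprime pair that
  represents \<psi> and has Wronskian \<open>f\<close>, not merely for one such pair.\<close>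

theorem theorem1:
  fixes f :: "complex poly"
  assumes "f \<noteq> 0"
  shows "(\<forall>\<psi>. liouville_weak_solution f \<psi> \<longrightarrow>
            (\<exists>P Q. coprime P Q \<and> f = pderiv P * Q - P * pderiv Q \<and>
                   (AE z in lebesgue. ereal (\<psi> z) = psi P Q z)) \<and>
            (\<forall>P Q. coprime P Q \<longrightarrow> f = pderiv P * Q - P * pderiv Q \<longrightarrow>
                   (AE z in lebesgue. ereal (\<psi> z) = psi P Q z) \<longrightarrow>
                   real (max (degree P) (degree Q)) =
                     1 / (8 * pi) * (LINT z|lebesgue. (cmod (poly f z))\<^sup>2 * exp (\<psi> z)))) \<and>
         (\<forall>P Q P' Q' :: complex poly.
            psi P Q = psi P' Q' \<longleftrightarrow>
            (\<exists>\<Lambda> :: complex^2^2. unitary_matrix \<Lambda> \<and>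
               (\<forall>z. vector [poly P' z, poly Q' z] = \<Lambda> *v vector [poly P z, poly Q z])))"
proof (intro conjI allI impI)
  fix \<psi> assume sol: "liouville_weak_solution f \<psi>"
  show "\<exists>P Q. coprime P Q \<and> f = pderiv P * Q - P * pderiv Q \<and> (AE z in lebesgue. ereal (\<psi> z) = psi P Q z)"
    using liouville_weak_solution_form[OF assms sol] by blast
  show "real (max (degree P) (degree Q)) = 1 / (8 * pi) * (LINT z|lebesgue. (cmod (poly f z))\<^sup>2 * exp (\<psi> z))"
    if "coprime P Q" "AE z in lebesgue. ereal (\<psi> z) = psi P Q z" for P Q
    unfolding liouville_total_mass[OF sol that] by simp
qed (rule psi_eq_iff_unitary)

end
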